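(* The category of normal categories is equivalent to the category of totally left reductive semigroups.
   Context: Conventions. Mappings, morphisms and functors are composed from left to right ($fg$ means first $f$, then $g$). For a category $\mathcal C$, $v\mathcal C$ denotes its class of objects and $\mathcal C(c,c')$ the set of morphisms from $c$ to $c'$. A monomorphism is a right cancellable morphism and an epimorphism is a left cancellable morphism. A semigroup $S$ is regular if for every $a\in S$ there is $x\in S$ with $axa=a$; $E(S)$ is its set of idempotents. Normal categories. A strict preorder is a category with at most one morphism between any two (possibly equal) objects in which the only isomorphisms are identities. A category with subobjects is a small category $\mathcal C$ with a subcategory $\mathcal P$ such that: $\mathcal P$ is a strict preorder with $v\mathcal P=v\mathcal C$; every $f\in\mathcal P$ is a monomorphism in $\mathcal C$; if $f,g\in\mathcal P$ and $f=hg$ with $h\in\mathcal C$, then $h\in\mathcal P$. Morphisms of $\mathcal P$ are called inclusions; $c\preceq c'$ means $\mathcal P(c,c')\neq\emptyset$, and $j(c,c')$ is then the unique inclusion. An inclusion $j\colon c\to c'$ splits if there is $q\colon c'\to c$ in $\mathcal C$ with $jq=1_c$; such a $q$ is called a retraction. A normal factorisation of a morphism $f$ is $f=quj$ with $q$ a retraction, $u$ an isomorphism, $j$ an inclusion. A cone with vertex $z\in v\mathcal C$ is a map $\gamma$ assigning to each $c\in v\mathcal C$ a morphism $\gamma(c)\in\mathcal C(c,z)$ such that $j(a,b)\gamma(b)=\gamma(a)$ whenever $a\preceq b$, and $\gamma(c)$ is an isomorphism for at least one $c$; the vertex is denoted $z_\gamma$. $\mathcal C$ is a normal category if it is a category with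 subobjects in which every inclusion splits, every morphism has a normal factorisation, and for each $c\in v\mathcal C$ there is a cone $\mu$ with vertex $c$ and $\mu(c)=1_c$. In a normal category, for a normal factorisation $f=quj$ the epimorphism $f^\circ:=qu$ does not depend on the factorisation. Semigroup of cones. For a cone $\gamma$ and an epimorphism $f$ with domain $z_\gamma$, $\gamma\ast f$ is the cone $c\mapsto\gamma(c)f$. The set $\widehat{\mathcal C}$ of all cones in a normal category $\mathcal C$ is a regular semigroup under $\gamma\cdot\delta=\gamma\ast(\delta(z_\gamma))^\circ$. Let $\mathscr R$ be Green's relation on $\widehat{\mathcal C}$, $R_\gamma$ the $\mathscr R$-class of $\gamma$; $\widehat{\mathcal C}/\mathscr R$ is partially ordered by $R_\gamma\sqsubseteq R_\delta$ iff the principal right ideal generated by $\gamma$ is contained in that generated by $\delta$. Connected categories and the category of normal categories. Let $\mathcal C$ be a normal category and $\mathfrak D$ a down-set of $(\widehat{\mathcal C}/\mathscr R,\sqsubseteq)$. An object $c$ is connected by (or to) $\mathfrak d\in\mathfrak D$ if $\mathfrak d$ contains an idempotent cone with vertex $c$; this idempotent cone is then unique and is denoted $\epsilon(c,\mathfrak d)$. $\mathcal C$ is connected by $\mathfrak D$ if every $c\in v\mathcal C$ is connected by some $\mathfrak d\in\mathfrak D$; then the pair is denoted $\mathcal C_{\mathfrak D}$ and called a connected category. A CC-morphism from $\mathcal C_{\mathfrak D}$ to $\mathcal C'_{\mathfrak D'}$ is a pair $(F,G)$ where $F\colon\mathcal C\to\mathcal C'$ is an inclusion preserving functor and $G\colon\mathfrak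 D\to\mathfrak D'$ is an order preserving map such that whenever $c$ is connected to $\mathfrak d$, $F(c)$ is connected to $G(\mathfrak d)$ and $F(\epsilon(c,\mathfrak d)(c'))=\epsilon(F(c),G(\mathfrak d))(F(c'))$ for every $c'\in v\mathcal C$. Every normal category $\mathcal C$ is treated as the connected category $\mathcal C_{\mathfrak D}$ with $\mathfrak D=\widehat{\mathcal C}/\mathscr R$; the category of normal categories has normal categories as objects and, under this identification, CC-morphisms as morphisms. Totally left reductive semigroups. For a regular semigroup $S$, $\mathbb L(S)$ is the category whose objects are the principal left ideals $Se$ ($e\in E(S)$) and whose morphisms from $Se$ to $Sf$ are the mappings $r(e,u,f)\colon Se\to Sf$, $x\mapsto xu$, for $u\in eSf$, composed as maps; its inclusions are the morphisms $r(e,e,f)$ for $Se\subseteq Sf$. It is a normal category. A regular semigroup $S$ is totally left reductive if $S$ is isomorphic to the semigroup $\widehat{\mathbb L(S)}$ of all cones in $\mathbb L(S)$. The category of totally left reductive semigroups has all semigroup homomorphisms as morphisms. *)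

theory Defs
  imports "HOL-Library.FuncSet" "HOL-Library.Equipollence"
begin

text \<open>
  Throughout, composition is written from left to right: \<open>f \<cdot> g\<close> means first \<open>f\<close>, then \<open>g\<close>.
  Maps defined on a set are represented as functions that are \<^const>\<open>extensional\<close> on
  that set, so that equality of maps is equality of HOL functions.
\<close>

section \<open>Categories, functors, equivalence\<close>

record ('o, 'm) cat =
  Ob :: "'o set"
  Ar :: "'m set"
  src :: "'m \<Rightarrow> 'o"
  tgt :: "'m \<Rightarrow> 'o"
  idn :: "'o \<Rightarrow> 'm"
  cmp :: "'m \<Rightarrow> 'm \<Rightarrow> 'm" (infixl "\<cdot>\<index>" 70)

definition Hom :: "('o, 'm, 'x) cat_scheme \<Rightarrow> 'o \<Rightarrow> 'o \<Rightarrow> 'm set" where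
  "Hom C a b = {f \<in> Ar C. src C f = a \<and> tgt C f = b}"

locale category =
  fixes C :: "('o, 'm, 'x) cat_scheme" (structure)
  assumes src_closed: "f \<in> Ar C \<Longrightarrow> src C f \<in> Ob C"
    and tgt_closed: "f \<in> Ar C \<Longrightarrow> tgt C f \<in> Ob C"
    and idn_in_Hom: "a \<in> Ob C \<Longrightarrow> idn C a \<in> Hom C a a"
    and cmp_in_Hom: "\<lbrakk>f \<in> Hom C a b; g \<in> Hom C b c\<rbrakk> \<Longrightarrow> f \<cdot> g \<in> Hom C a c"
    and idn_left: "f \<in> Hom C a b \<Longrightarrow> idn C a \<cdot> f = f"
    and idn_right: "f \<in> Hom C a b \<Longrightarrow> f \<cdot> idn C b = f"
    and cmp_assoc: "\<lbrakk>f \<in> Hom C a b; g \<in> Hom C b c; h \<in> Hom C c d\<rbrakk>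
      \<Longrightarrow> f \<cdot> g \<cdot> h = f \<cdot> (g \<cdot> h)"

definition mono_arr :: "('o, 'm, 'x) cat_scheme \<Rightarrow> 'm \<Rightarrow> bool" where
  "mono_arr C f \<longleftrightarrow> f \<in> Ar C \<and>
    (\<forall>g\<in>Ar C. \<forall>h\<in>Ar C. tgt C g = src C f \<and> tgt C h = src C f \<and>
      g \<cdot>\<^bsub>C\<^esub> f = h \<cdot>\<^bsub>C\<^esub> f \<longrightarrow> g = h)"

definition iso_arr :: "('o, 'm, 'x) cat_scheme \<Rightarrow> 'm \<Rightarrow> bool" where
  "iso_arr C f \<longleftrightarrow> f \<in> Ar C \<and>
    (\<exists>g \<in> Hom C (tgt C f) (src C f).
      f \<cdot>\<^bsub>C\<^esub> g = idn C (src C f) \<and> g \<cdot>\<^bsub>C\<^esub> f = idn C (tgt C f))"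

type_synonym ('o, 'm, 'p, 'n) fctr = "('o \<Rightarrow> 'p) \<times> ('m \<Rightarrow> 'n)"

definition is_functor ::
  "('o, 'm, 'x) cat_scheme \<Rightarrow> ('p, 'n, 'y) cat_scheme \<Rightarrow> ('o, 'm, 'p, 'n) fctr \<Rightarrow> bool" where
  "is_functor C D F \<longleftrightarrow>
    fst F \<in> Ob C \<rightarrow>\<^sub>E Ob D \<and>
    snd F \<in> Ar C \<rightarrow>\<^sub>E Ar D \<and>
    (\<forall>f\<in>Ar C. src D (snd F f) = fst F (src C f) \<and> tgt D (snd F f) = fst F (tgt C f)) \<and>
    (\<forall>a\<in>Ob C. snd F (idn C a) = idn D (fst F a)) \<and>
    (\<forall>f\<in>Ar C. \<forall>g\<in>Ar C. tgt C f = src C g \<longrightarrow>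
      snd F (f \<cdot>\<^bsub>C\<^esub> g) = snd F f \<cdot>\<^bsub>D\<^esub> snd F g)"

definition id_functor :: "('o, 'm, 'x) cat_scheme \<Rightarrow> ('o, 'm, 'o, 'm) fctr" where
  "id_functor C = ((\<lambda>a\<in>Ob C. a), (\<lambda>f\<in>Ar C. f))"

definition comp_functor ::
  "('o, 'm, 'x) cat_scheme \<Rightarrow> ('o, 'm, 'p, 'n) fctr \<Rightarrow> ('p, 'n, 'q, 'k) fctr
    \<Rightarrow> ('o, 'm, 'q, 'k) fctr" where
  "comp_functor C F G =
    ((\<lambda>a\<in>Ob C. fst G (fst F a)), (\<lambda>f\<in>Ar C. snd G (snd F f)))"

definition natural_iso ::
  "('o, 'm, 'x) cat_scheme \<Rightarrow> ('p, 'n, 'y) cat_scheme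
    \<Rightarrow> ('o, 'm, 'p, 'n) fctr \<Rightarrow> ('o, 'm, 'p, 'n) fctr \<Rightarrow> ('o \<Rightarrow> 'n) \<Rightarrow> bool" where
  "natural_iso C D F G \<tau> \<longleftrightarrow>
    (\<forall>a\<in>Ob C. \<tau> a \<in> Hom D (fst F a) (fst G a) \<and> iso_arr D (\<tau> a)) \<and>
    (\<forall>f\<in>Ar C. snd F f \<cdot>\<^bsub>D\<^esub> \<tau> (tgt C f) = \<tau> (src C f) \<cdot>\<^bsub>D\<^esub> snd G f)"

definition equivalent_categories ::
  "('o, 'm, 'x) cat_scheme \<Rightarrow> ('p, 'n, 'y) cat_scheme \<Rightarrow> bool" where
  "equivalent_categories C D \<longleftrightarrow> category C \<and> category D \<and>
    (\<exists>F G \<eta> \<epsilon>. is_functor C D F \<and> is_functor D C G \<and>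
      natural_iso C C (id_functor C) (comp_functor C F G) \<eta> \<and>
      natural_iso D D (comp_functor D G F) (id_functor D) \<epsilon>)"

section \<open>Normal categories\<close>

definition strict_preorder :: "('o, 'm, 'x) cat_scheme \<Rightarrow> bool" where
  "strict_preorder P \<longleftrightarrow> category P \<and>
    (\<forall>f\<in>Ar P. \<forall>g\<in>Ar P. src P f = src P g \<and> tgt P f = tgt P g \<longrightarrow> f = g) \<and>
    (\<forall>f\<in>Ar P. iso_arr P f \<longrightarrow> f = idn P (src P f))"

text \<open>The subcategory of inclusions has all the objects, so it is given by its morphisms.\<close>

record ('o, 'm) scat = "('o, 'm) cat" +
  Incl :: "'m set"

definition incl_cat :: "('o, 'm, 'x) scat_scheme \<Rightarrow> ('o, 'm) cat" where
  "incl_cat C = \<lparr>Ob = Ob C, Ar = Incl C, src = src C, tgt = tgt C, idn = idn C, cmp = cmp C\<rparr>"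

locale category_with_subobjects = category C
  for C :: "('o, 'm, 'x) scat_scheme" (structure) +
  assumes Incl_subset: "Incl C \<subseteq> Ar C"
    and Incl_strict_preorder: "strict_preorder (incl_cat C)"
    and Incl_mono: "f \<in> Incl C \<Longrightarrow> mono_arr C f"
    and Incl_factor: "\<lbrakk>f \<in> Incl C; g \<in> Incl C; h \<in> Ar C; tgt C h = src C g; f = h \<cdot> g\<rbrakk>
      \<Longrightarrow> h \<in> Incl C"

definition splits_by :: "('o, 'm, 'x) scat_scheme \<Rightarrow> 'm \<Rightarrow> 'm \<Rightarrow> bool" where
  "splits_by C j q \<longleftrightarrow> q \<in> Hom C (tgt C j) (src C j) \<and> j \<cdot>\<^bsub>C\<^esub> q = idn C (src C j)"

definition retraction :: "('o, 'm, 'x) scat_scheme \<Rightarrow> 'm \<Rightarrow> bool" where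
  "retraction C q \<longleftrightarrow> (\<exists>j\<in>Incl C. splits_by C j q)"

definition normal_factorisation ::
  "('o, 'm, 'x) scat_scheme \<Rightarrow> 'm \<Rightarrow> 'm \<Rightarrow> 'm \<Rightarrow> 'm \<Rightarrow> bool" where
  "normal_factorisation C f q u j \<longleftrightarrow>
    retraction C q \<and> iso_arr C u \<and> j \<in> Incl C \<and>
    tgt C q = src C u \<and> tgt C u = src C j \<and> f = q \<cdot>\<^bsub>C\<^esub> u \<cdot>\<^bsub>C\<^esub> j"

definition is_cone :: "('o, 'm, 'x) scat_scheme \<Rightarrow> 'o \<Rightarrow> ('o \<Rightarrow> 'm) \<Rightarrow> bool" where
  "is_cone C z \<gamma> \<longleftrightarrow> z \<in> Ob C \<and> \<gamma> \<in> extensional (Ob C) \<and>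
    (\<forall>c\<in>Ob C. \<gamma> c \<in> Hom C c z) \<and>
    (\<forall>j\<in>Incl C. j \<cdot>\<^bsub>C\<^esub> \<gamma> (tgt C j) = \<gamma> (src C j)) \<and>
    (\<exists>c\<in>Ob C. iso_arr C (\<gamma> c))"

locale normal_category = category_with_subobjects C
  for C :: "('o, 'm, 'x) scat_scheme" (structure) +
  assumes Incl_splits: "j \<in> Incl C \<Longrightarrow> \<exists>q. splits_by C j q"
    and normal_factorisation_ex: "f \<in> Ar C \<Longrightarrow> \<exists>q u j. normal_factorisation C f q u j"
    and cone_ex: "c \<in> Ob C \<Longrightarrow> \<exists>\<mu>. is_cone C c \<mu> \<and> \<mu> c = idn C c"

section \<open>Semigroups\<close>

record 'a sgrp =
  elems :: "'a set"
  mul :: "'a \<Rightarrow> 'a \<Rightarrow> 'a" (infixl "\<odot>\<index>" 70)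

definition regular_semigroup :: "'a sgrp \<Rightarrow> bool" where
  "regular_semigroup S \<longleftrightarrow>
    (\<forall>a\<in>elems S. \<forall>b\<in>elems S. a \<odot>\<^bsub>S\<^esub> b \<in> elems S) \<and>
    (\<forall>a\<in>elems S. \<forall>b\<in>elems S. \<forall>c\<in>elems S. a \<odot>\<^bsub>S\<^esub> b \<odot>\<^bsub>S\<^esub> c = a \<odot>\<^bsub>S\<^esub> (b \<odot>\<^bsub>S\<^esub> c)) \<and>
    (\<forall>a\<in>elems S. \<exists>x\<in>elems S. a \<odot>\<^bsub>S\<^esub> x \<odot>\<^bsub>S\<^esub> a = a)"

definition idems :: "'a sgrp \<Rightarrow> 'a set" where
  "idems S = {e \<in> elems S. e \<odot>\<^bsub>S\<^esub> e = e}"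

definition right_ideal :: "'a sgrp \<Rightarrow> 'a \<Rightarrow> 'a set" where
  "right_ideal S a = insert a {a \<odot>\<^bsub>S\<^esub> x | x. x \<in> elems S}"

definition R_class :: "'a sgrp \<Rightarrow> 'a \<Rightarrow> 'a set" where
  "R_class S a = {b \<in> elems S. right_ideal S b = right_ideal S a}"

definition R_classes :: "'a sgrp \<Rightarrow> 'a set set" where
  "R_classes S = R_class S ` elems S"

definition R_le :: "'a sgrp \<Rightarrow> 'a set \<Rightarrow> 'a set \<Rightarrow> bool" where
  "R_le S X Y \<longleftrightarrow> (\<exists>a\<in>elems S. \<exists>b\<in>elems S.
    X = R_class S a \<and> Y = R_class S b \<and> right_ideal S a \<subseteq> right_ideal S b)"

definition semigroup_hom :: "'a sgrp \<Rightarrow> 'b sgrp \<Rightarrow> ('a \<Rightarrow> 'b) \<Rightarrow> bool" where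
  "semigroup_hom S T \<phi> \<longleftrightarrow> \<phi> \<in> elems S \<rightarrow>\<^sub>E elems T \<and>
    (\<forall>x\<in>elems S. \<forall>y\<in>elems S. \<phi> (x \<odot>\<^bsub>S\<^esub> y) = \<phi> x \<odot>\<^bsub>T\<^esub> \<phi> y)"

definition isomorphic_semigroups :: "'a sgrp \<Rightarrow> 'b sgrp \<Rightarrow> bool" where
  "isomorphic_semigroups S T \<longleftrightarrow>
    (\<exists>\<phi>. semigroup_hom S T \<phi> \<and> bij_betw \<phi> (elems S) (elems T))"

section \<open>The semigroup of cones of a normal category\<close>

definition vertex :: "('o, 'm, 'x) scat_scheme \<Rightarrow> ('o \<Rightarrow> 'm) \<Rightarrow> 'o" where
  "vertex C \<gamma> = (THE z. is_cone C z \<gamma>)"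

definition epi_part :: "('o, 'm, 'x) scat_scheme \<Rightarrow> 'm \<Rightarrow> 'm" where
  "epi_part C f = (THE h. \<exists>q u j. normal_factorisation C f q u j \<and> h = q \<cdot>\<^bsub>C\<^esub> u)"

definition cone_ext :: "('o, 'm, 'x) scat_scheme \<Rightarrow> ('o \<Rightarrow> 'm) \<Rightarrow> 'm \<Rightarrow> ('o \<Rightarrow> 'm)" where
  "cone_ext C \<gamma> f = (\<lambda>c\<in>Ob C. \<gamma> c \<cdot>\<^bsub>C\<^esub> f)"

definition cone_semigroup :: "('o, 'm, 'x) scat_scheme \<Rightarrow> ('o \<Rightarrow> 'm) sgrp" where
  "cone_semigroup C =
    \<lparr>elems = {\<gamma>. \<exists>z. is_cone C z \<gamma>},
     mul = (\<lambda>\<gamma> \<delta>. cone_ext C \<gamma> (epi_part C (\<delta> (vertex C \<gamma>))))\<rparr>"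

section \<open>Connected categories and CC-morphisms\<close>

definition R_downset :: "'a sgrp \<Rightarrow> 'a set set \<Rightarrow> bool" where
  "R_downset S D \<longleftrightarrow> D \<subseteq> R_classes S \<and>
    (\<forall>d\<in>D. \<forall>d'\<in>R_classes S. R_le S d' d \<longrightarrow> d' \<in> D)"

definition connected_to :: "('o, 'm, 'x) scat_scheme \<Rightarrow> 'o \<Rightarrow> ('o \<Rightarrow> 'm) set \<Rightarrow> bool" where
  "connected_to C c d \<longleftrightarrow>
    (\<exists>\<gamma>\<in>d. \<gamma> \<in> idems (cone_semigroup C) \<and> vertex C \<gamma> = c)"

definition conn_idem :: "('o, 'm, 'x) scat_scheme \<Rightarrow> 'o \<Rightarrow> ('o \<Rightarrow> 'm) set \<Rightarrow> ('o \<Rightarrow> 'm)" where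
  "conn_idem C c d =
    (THE \<gamma>. \<gamma> \<in> d \<and> \<gamma> \<in> idems (cone_semigroup C) \<and> vertex C \<gamma> = c)"

definition connected_category ::
  "('o, 'm, 'x) scat_scheme \<Rightarrow> ('o \<Rightarrow> 'm) set set \<Rightarrow> bool" where
  "connected_category C D \<longleftrightarrow> normal_category C \<and> R_downset (cone_semigroup C) D \<and>
    (\<forall>c\<in>Ob C. \<exists>d\<in>D. connected_to C c d)"

type_synonym ('o, 'm, 'p, 'n) ccm =
  "('o, 'm, 'p, 'n) fctr \<times> (('o \<Rightarrow> 'm) set \<Rightarrow> ('p \<Rightarrow> 'n) set)"

definition cc_morphism ::
  "('o, 'm, 'x) scat_scheme \<Rightarrow> ('o \<Rightarrow> 'm) set set
    \<Rightarrow> ('p, 'n, 'y) scat_scheme \<Rightarrow> ('p \<Rightarrow> 'n) set set \<Rightarrow> ('o, 'm, 'p, 'n) ccm \<Rightarrow> bool" where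
  "cc_morphism C D C' D' FG \<longleftrightarrow>
    connected_category C D \<and> connected_category C' D' \<and>
    (case FG of (F, G) \<Rightarrow>
      is_functor C C' F \<and> snd F ` Incl C \<subseteq> Incl C' \<and>
      G \<in> D \<rightarrow>\<^sub>E D' \<and>
      (\<forall>d\<^sub>1\<in>D. \<forall>d\<^sub>2\<in>D. R_le (cone_semigroup C) d\<^sub>1 d\<^sub>2
        \<longrightarrow> R_le (cone_semigroup C') (G d\<^sub>1) (G d\<^sub>2)) \<and>
      (\<forall>c\<in>Ob C. \<forall>d\<in>D. connected_to C c d \<longrightarrow>
        connected_to C' (fst F c) (G d) \<and>
        (\<forall>c'\<in>Ob C. snd F (conn_idem C c d c') = conn_idem C' (fst F c) (G d) (fst F c'))))"

definition cc_id ::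
  "('o, 'm, 'x) scat_scheme \<Rightarrow> ('o \<Rightarrow> 'm) set set \<Rightarrow> ('o, 'm, 'o, 'm) ccm" where
  "cc_id C D = (id_functor C, (\<lambda>d\<in>D. d))"

definition cc_comp ::
  "('o, 'm, 'x) scat_scheme \<Rightarrow> ('o \<Rightarrow> 'm) set set
    \<Rightarrow> ('o, 'm, 'p, 'n) ccm \<Rightarrow> ('p, 'n, 'q, 'k) ccm \<Rightarrow> ('o, 'm, 'q, 'k) ccm" where
  "cc_comp C D FG FG' =
    (comp_functor C (fst FG) (fst FG'), (\<lambda>d\<in>D. snd FG' (snd FG d)))"

section \<open>Totally left reductive semigroups\<close>

definition left_ideal :: "'a sgrp \<Rightarrow> 'a \<Rightarrow> 'a set" where
  "left_ideal S e = {x \<odot>\<^bsub>S\<^esub> e | x. x \<in> elems S}"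

text \<open>A morphism is a mapping together with its domain and codomain.\<close>

type_synonym 'a lmap = "'a set \<times> ('a \<Rightarrow> 'a) \<times> 'a set"

definition r_map :: "'a sgrp \<Rightarrow> 'a \<Rightarrow> 'a \<Rightarrow> 'a \<Rightarrow> 'a lmap" where
  "r_map S e u f = (left_ideal S e, (\<lambda>x\<in>left_ideal S e. x \<odot>\<^bsub>S\<^esub> u), left_ideal S f)"

definition left_ideal_cat :: "'a sgrp \<Rightarrow> ('a set, 'a lmap) scat" where
  "left_ideal_cat S =
    \<lparr>Ob = left_ideal S ` idems S,
     Ar = {r_map S e u f | e u f. e \<in> idems S \<and> f \<in> idems S \<and>
             u \<in> {e \<odot>\<^bsub>S\<^esub> s \<odot>\<^bsub>S\<^esub> f | s. s \<in> elems S}},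
     src = fst,
     tgt = (\<lambda>m. snd (snd m)),
     idn = (\<lambda>A. (A, (\<lambda>x\<in>A. x), A)),
     cmp = (\<lambda>(A, f, B) (B', g, C). (A, compose A g f, C)),
     Incl = {r_map S e e f | e f. e \<in> idems S \<and> f \<in> idems S \<and>
               left_ideal S e \<subseteq> left_ideal S f}\<rparr>"

definition totally_left_reductive :: "'a sgrp \<Rightarrow> bool" where
  "totally_left_reductive S \<longleftrightarrow> regular_semigroup S \<and>
    isomorphic_semigroups S (cone_semigroup (left_ideal_cat S))"

section \<open>The two large categories\<close>

text \<open>
  The type \<open>'u\<close> serves as the universe of sets: the small sets are those of cardinality less
  than that of \<open>'u\<close>, and the structures forming the objects of the two categories below
  are the small ones with carriers in \<open>'u\<close>.  As in set theory, power sets of small sets are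
  meant to be small again.
\<close>

definition small :: "'u set \<Rightarrow> bool" where
  "small A \<longleftrightarrow> A \<prec> (UNIV :: 'u set)"

definition powerset_closed_universe :: "'u itself \<Rightarrow> bool" where
  "powerset_closed_universe _ \<longleftrightarrow>
    (\<forall>A :: 'u set. small A \<longrightarrow> Pow A \<prec> (UNIV :: 'u set))"

text \<open>
  Morphisms of the large categories carry their domain and codomain.  A normal category
  \<open>C\<close> is identified with the connected category given by all \<open>\<R>\<close>-classes of its cones.
\<close>

abbreviation all_R :: "('o, 'm, 'x) scat_scheme \<Rightarrow> ('o \<Rightarrow> 'm) set set" where
  "all_R C \<equiv> R_classes (cone_semigroup C)"

definition NormalCat ::
  "(('u, 'u) scat, ('u, 'u) scat \<times> ('u, 'u, 'u, 'u) ccm \<times> ('u, 'u) scat) cat" where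
  "NormalCat =
    (let Obs = {C. normal_category C \<and> small (Ob C) \<and> small (Ar C)} in
    \<lparr>Ob = Obs,
     Ar = {(C, FG, C'). C \<in> Obs \<and> C' \<in> Obs \<and> cc_morphism C (all_R C) C' (all_R C') FG},
     src = fst,
     tgt = (\<lambda>m. snd (snd m)),
     idn = (\<lambda>C. (C, cc_id C (all_R C), C)),
     cmp = (\<lambda>(C, FG, C') (B, FG', C''). (C, cc_comp C (all_R C) FG FG', C''))\<rparr>)"

definition TLRSemigroups :: "('u sgrp, 'u sgrp \<times> ('u \<Rightarrow> 'u) \<times> 'u sgrp) cat" where
  "TLRSemigroups =
    (let Obs = {S. totally_left_reductive S \<and> small (elems S)} in
    \<lparr>Ob = Obs,
     Ar = {(S, \<phi>, T). S \<in> Obs \<and> T \<in> Obs \<and> semigroup_hom S T \<phi>},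
     src = fst,
     tgt = (\<lambda>m. snd (snd m)),
     idn = (\<lambda>S. (S, (\<lambda>x\<in>elems S. x), S)),
     cmp = (\<lambda>(S, \<phi>, T) (T', \<psi>, U). (S, compose (elems S) \<psi> \<phi>, U))\<rparr>)"

end

theory Submission
  imports Defs
begin

text \<open>
  The functor sending a normal category to its semigroup of cones is full,
  faithful and essentially surjective.  A cone \<open>\<R>\<close>-below an idempotent cone
  \<open>\<epsilon>\<close> is determined by its component at the vertex of \<open>\<epsilon>\<close>.  Hence, for a
  CC-morphism \<open>(F, G)\<close>, there is only one cone in the class \<open>G R\<^sub>\<gamma>\<close> whose component
  at \<open>F c\<close> is \<open>F (\<gamma> c)\<close> for all \<open>c\<close>, and mapping \<open>\<gamma>\<close> to it is a homomorphism.

  For the converse, fix idempotent cones \<open>\<epsilon>\<^sub>c\<close> with vertex \<open>c\<close> and represent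
  \<open>f : a \<rightarrow> b\<close> by the cone \<open>\<epsilon>\<^sub>a \<star> f\<degree>\<close>, where \<open>f\<degree>\<close> is the epimorphic part; this
  turns composition into multiplication, and \<open>\<epsilon>\<^sub>c \<gamma>\<close> represents \<open>\<gamma> c\<close>.  A homomorphism
  \<open>\<phi>\<close> therefore determines \<open>F f\<close> as the component of \<open>\<phi> (\<epsilon>\<^sub>a \<star> f\<degree>)\<close> at \<open>F a\<close> followed
  by an inclusion.  The same representation identifies a normal category with the category of
  principal left ideals of its semigroup of cones, which gives that this semigroup is totally left
  reductive; conversely, the category of principal left ideals of any regular semigroup is normal.
\<close>

section \<open>Normal categories\<close>

text \<open>Green's relations on cones can be read off the category: the left order is the order of
  vertices (\<open>vertex_le_iff\<close>), and an \<open>\<R>\<close>-class has at most one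
  idempotent with a given vertex. An arrow cone keeps only the epimorphic part of its arrow and
  forgets the codomain, so an inclusion must be put back whenever an arrow is recovered from a cone.
  For a CC-morphism \<open>(F, G)\<close> the difficulty is that \<open>F\<close> may miss objects,
  so a cone is not obviously fixed by its components at the objects \<open>F c\<close>. The CC
  condition supplies an idempotent in \<open>G (R \<gamma>)\<close> whose vertex is of the form
  \<open>F c\<close>, and this one component is enough. Essential surjectivity is built into the
  definition of total left reductivity once the category of principal left ideals is normal. Since
  the equivalence comes from the criterion for fully faithful functors, only the object part of the
  passage from \<open>S\<close> to its left ideals is required. The last obstacle is size: cones are
  functions and left ideals are sets, but the objects of the large categories have carriers in
  \<open>'u\<close>. Both kinds of structure are copied along injections into \<open>'u\<close>;
  closure under power sets bounds the number of cones.\<close>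

context category
begin

lemma cmp_simps [simp]:
  assumes "f \<in> Ar C" "g \<in> Ar C" "tgt C f = src C g"
  shows "f \<cdot> g \<in> Ar C" "src C (f \<cdot> g) = src C f" "tgt C (f \<cdot> g) = tgt C g"
  using cmp_in_Hom[of f "src C f" "src C g" g "tgt C g"] assms by (auto simp: Hom_def)

lemma idn_simps [simp]:
  assumes "a \<in> Ob C"
  shows "idn C a \<in> Ar C" "src C (idn C a) = a" "tgt C (idn C a) = a"
  using idn_in_Hom[OF assms] by (auto simp: Hom_def)

lemma idn_cmp [simp]: "f \<in> Ar C \<Longrightarrow> src C f = a \<Longrightarrow> idn C a \<cdot> f = f"
  using idn_left[of f "src C f" "tgt C f"] by (auto simp: Hom_def)

lemma cmp_idn [simp]: "f \<in> Ar C \<Longrightarrow> tgt C f = a \<Longrightarrow> f \<cdot> idn C a = f"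
  using idn_right[of f "src C f" "tgt C f"] by (auto simp: Hom_def)

lemma assoc:
  "\<lbrakk>f \<in> Ar C; g \<in> Ar C; h \<in> Ar C; tgt C f = src C g; tgt C g = src C h\<rbrakk>
    \<Longrightarrow> f \<cdot> g \<cdot> h = f \<cdot> (g \<cdot> h)"
  using cmp_assoc[of f "src C f" "tgt C f" g "tgt C g" h "tgt C h"] by (auto simp: Hom_def)

lemma src_Ob [simp]: "f \<in> Ar C \<Longrightarrow> src C f \<in> Ob C"
  by (rule src_closed)

lemma tgt_Ob [simp]: "f \<in> Ar C \<Longrightarrow> tgt C f \<in> Ob C"
  by (rule tgt_closed)

lemma iso_arrE:
  assumes "iso_arr C f"
  obtains g where "g \<in> Ar C" "src C g = tgt C f" "tgt C g = src C f"
    "f \<cdot> g = idn C (src C f)" "g \<cdot> f = idn C (tgt C f)" "f \<in> Ar C"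
  using assms unfolding iso_arr_def Hom_def by blast

lemma iso_arrI:
  assumes "f \<in> Ar C" "g \<in> Ar C" "src C g = tgt C f" "tgt C g = src C f"
    "f \<cdot> g = idn C (src C f)" "g \<cdot> f = idn C (tgt C f)"
  shows "iso_arr C f"
  using assms unfolding iso_arr_def Hom_def by blast

lemma iso_arr_Ar [simp]: "iso_arr C f \<Longrightarrow> f \<in> Ar C"
  by (simp add: iso_arr_def)

lemma cancel_middle:
  assumes "f \<in> Ar C" "g \<in> Ar C" "h \<in> Ar C" "k \<in> Ar C" "tgt C f = src C g" "tgt C g = src C h"
    "tgt C h = src C k" "g \<cdot> h = idn C a" "src C g = a" "tgt C h = a"
  shows "f \<cdot> g \<cdot> (h \<cdot> k) = f \<cdot> k"
proof -
  have "f \<cdot> g \<cdot> (h \<cdot> k) = f \<cdot> (g \<cdot> h \<cdot> k)"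
    using assms(1-7) by (simp add: assoc del: assms(8))
  then show ?thesis using assms by simp
qed

lemma iso_arr_idn: "a \<in> Ob C \<Longrightarrow> iso_arr C (idn C a)"
  by (rule iso_arrI[of _ "idn C a"]) auto

lemma iso_arr_inverse:
  assumes "f \<in> Ar C" "g \<in> Ar C" "src C g = tgt C f" "tgt C g = src C f"
    "f \<cdot> g = idn C (src C f)" "iso_arr C f"
  shows "g \<cdot> f = idn C (tgt C f)" "iso_arr C g"
proof -
  obtain f' where f': "f' \<in> Ar C" "src C f' = tgt C f" "tgt C f' = src C f"
    "f \<cdot> f' = idn C (src C f)" "f' \<cdot> f = idn C (tgt C f)" "f \<in> Ar C"
    using assms(6) by (rule iso_arrE)
  have "g = f' \<cdot> f \<cdot> g" using f' assms by simp
  also have "\<dots> = f' \<cdot> (f \<cdot> g)" by (rule assoc) (use f' assms in simp_all)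
  also have "\<dots> = f'" using f' assms by simp
  finally show *: "g \<cdot> f = idn C (tgt C f)" using f' by simp
  show "iso_arr C g"
    by (rule iso_arrI[of _ f]) (use assms * in auto)
qed

text \<open>Epimorphic parts \<open>q \<cdot> u\<close> have this form. Unlike mere cancellability,
  a section is preserved by every functor and can be used in equations.\<close>

definition split_epi :: "'m \<Rightarrow> bool" where
  "split_epi e \<longleftrightarrow> e \<in> Ar C \<and>
    (\<exists>k\<in>Ar C. src C k = tgt C e \<and> tgt C k = src C e \<and> k \<cdot> e = idn C (tgt C e))"

lemma split_epiI:
  "\<lbrakk>e \<in> Ar C; k \<in> Ar C; src C k = tgt C e; tgt C k = src C e; k \<cdot> e = idn C (tgt C e)\<rbrakk>
    \<Longrightarrow> split_epi e"
  unfolding split_epi_def by blast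

lemma split_epiE:
  assumes "split_epi e"
  obtains k where "e \<in> Ar C" "k \<in> Ar C" "src C k = tgt C e" "tgt C k = src C e"
    "k \<cdot> e = idn C (tgt C e)"
  using assms unfolding split_epi_def by blast

lemma split_epi_Ar [simp]: "split_epi e \<Longrightarrow> e \<in> Ar C"
  by (simp add: split_epi_def)

lemma iso_split_epi: "iso_arr C u \<Longrightarrow> split_epi u"
  by (elim iso_arrE) (rule split_epiI)

lemma split_epi_idn [simp]: "a \<in> Ob C \<Longrightarrow> split_epi (idn C a)"
  by (simp add: iso_arr_idn iso_split_epi)

lemma split_epi_cmp:
  assumes "split_epi f" "split_epi g" "tgt C f = src C g"
  shows "split_epi (f \<cdot> g)"
proof -
  obtain f' where f': "f \<in> Ar C" "f' \<in> Ar C" "src C f' = tgt C f" "tgt C f' = src C f"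
    "f' \<cdot> f = idn C (tgt C f)"
    using assms(1) by (rule split_epiE)
  obtain g' where g': "g \<in> Ar C" "g' \<in> Ar C" "src C g' = tgt C g" "tgt C g' = src C g"
    "g' \<cdot> g = idn C (tgt C g)"
    using assms(2) by (rule split_epiE)
  show ?thesis
    by (rule split_epiI[of _ "g' \<cdot> f'"])
      (use f' g' assms(3) cancel_middle[of g' f' f g] in auto)
qed

lemma split_epi_cancel:
  assumes e: "split_epi e" and f: "f \<in> Ar C" "g \<in> Ar C" "src C f = tgt C e" "src C g = tgt C e"
    and eq: "e \<cdot> f = e \<cdot> g"
  shows "f = g"
proof -
  obtain k where k: "e \<in> Ar C" "k \<in> Ar C" "src C k = tgt C e" "tgt C k = src C e"
    "k \<cdot> e = idn C (tgt C e)"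
    using e by (rule split_epiE)
  have "f = k \<cdot> e \<cdot> f" using k f by simp
  also have "\<dots> = k \<cdot> (e \<cdot> f)" using k(1-4) f by (simp add: assoc)
  also have "\<dots> = k \<cdot> e \<cdot> g" unfolding eq using k(1-4) f by (simp add: assoc)
  finally show ?thesis using k f by simp
qed

end

section \<open>Inclusions and uniqueness of images\<close>

context category_with_subobjects
begin

definition le :: "'o \<Rightarrow> 'o \<Rightarrow> bool" (infix "\<preceq>" 50) where
  "a \<preceq> b \<longleftrightarrow> (\<exists>j\<in>Incl C. src C j = a \<and> tgt C j = b)"

definition inc :: "'o \<Rightarrow> 'o \<Rightarrow> 'm" where
  "inc a b = (THE j. j \<in> Incl C \<and> src C j = a \<and> tgt C j = b)"

lemma Incl_Ar [simp]: "j \<in> Incl C \<Longrightarrow> j \<in> Ar C"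
  using Incl_subset by blast

lemma Incl_unique:
  "\<lbrakk>i \<in> Incl C; j \<in> Incl C; src C i = src C j; tgt C i = tgt C j\<rbrakk> \<Longrightarrow> i = j"
  using Incl_strict_preorder unfolding strict_preorder_def incl_cat_def by auto

lemma idn_Incl [simp]: "a \<in> Ob C \<Longrightarrow> idn C a \<in> Incl C"
  using Incl_strict_preorder category.idn_in_Hom[of "incl_cat C" a]
  unfolding strict_preorder_def by (auto simp: incl_cat_def Hom_def)

lemma cmp_Incl: "\<lbrakk>i \<in> Incl C; j \<in> Incl C; tgt C i = src C j\<rbrakk> \<Longrightarrow> i \<cdot> j \<in> Incl C"
  using Incl_strict_preorder
    category.cmp_in_Hom[of "incl_cat C" i "src C i" "tgt C i" j "tgt C j"]
  unfolding strict_preorder_def by (auto simp: incl_cat_def Hom_def)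

lemma inc_src_tgt: "j \<in> Incl C \<Longrightarrow> inc (src C j) (tgt C j) = j"
  unfolding inc_def by (rule the_equality) (auto intro: Incl_unique)

lemma inc_eqI: "\<lbrakk>j \<in> Incl C; src C j = a; tgt C j = b\<rbrakk> \<Longrightarrow> inc a b = j"
  using inc_src_tgt by blast

lemma inc_simps [simp]:
  assumes "a \<preceq> b"
  shows "inc a b \<in> Incl C" "inc a b \<in> Ar C" "src C (inc a b) = a" "tgt C (inc a b) = b"
proof -
  obtain j where "j \<in> Incl C" "src C j = a" "tgt C j = b" using assms unfolding le_def by blast
  then show "inc a b \<in> Incl C" "inc a b \<in> Ar C" "src C (inc a b) = a" "tgt C (inc a b) = b"
    using inc_src_tgt[of j] by auto
qed

lemma leI: "\<lbrakk>j \<in> Incl C; src C j = a; tgt C j = b\<rbrakk> \<Longrightarrow> a \<preceq> b"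
  unfolding le_def by blast

lemma le_Ob: "a \<preceq> b \<Longrightarrow> a \<in> Ob C" "a \<preceq> b \<Longrightarrow> b \<in> Ob C"
  unfolding le_def by auto

lemma le_refl [simp]: "a \<in> Ob C \<Longrightarrow> a \<preceq> a"
  by (rule leI[of "idn C a"]) auto

lemma le_trans: "a \<preceq> b \<Longrightarrow> b \<preceq> c \<Longrightarrow> a \<preceq> c"
  by (rule leI[of "inc a b \<cdot> inc b c"]) (auto intro: cmp_Incl)

lemma inc_idn [simp]: "a \<in> Ob C \<Longrightarrow> inc a a = idn C a"
  by (rule inc_eqI) auto

lemma inc_cmp: "a \<preceq> b \<Longrightarrow> b \<preceq> c \<Longrightarrow> inc a b \<cdot> inc b c = inc a c"
  by (rule inc_eqI[symmetric]) (auto intro: cmp_Incl)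

text \<open>Inclusions in both directions are inverse to each other inside the preorder, where
  strictness leaves only identities.\<close>

lemma le_antisym: assumes "a \<preceq> b" "b \<preceq> a" shows "a = b"
proof -
  have "iso_arr (incl_cat C) (inc a b)"
    unfolding iso_arr_def incl_cat_def Hom_def
    using assms inc_cmp[OF assms] inc_cmp[OF assms(2,1)] le_Ob[OF assms(1)]
    by (auto intro!: exI[of _ "inc b a"])
  then have "inc a b = idn C a"
    using assms Incl_strict_preorder unfolding strict_preorder_def incl_cat_def by auto
  then have "tgt C (inc a b) = a" using le_Ob[OF assms(1)] by simp
  then show ?thesis using assms by simp
qed

lemma inc_mono:
  "\<lbrakk>a \<preceq> b; f \<in> Ar C; g \<in> Ar C; tgt C f = a; tgt C g = a; f \<cdot> inc a b = g \<cdot> inc a b\<rbrakk> \<Longrightarrow> f = g"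
  using Incl_mono[of "inc a b"] unfolding mono_arr_def by auto

text \<open>A section \<open>k\<close> of \<open>e\<close> writes the inclusion of the image of
  \<open>e\<close> as \<open>k \<cdot> e'\<close> followed by the inclusion of the image of
  \<open>e'\<close>. Then \<open>Incl_factor\<close> makes \<open>k \<cdot> e'\<close> itself an
  inclusion.\<close>

lemma image_le:
  assumes "split_epi e" "split_epi e'" "src C e = src C e'"
    "tgt C e \<preceq> b" "tgt C e' \<preceq> b" "e \<cdot> inc (tgt C e) b = e' \<cdot> inc (tgt C e') b"
  shows "tgt C e \<preceq> tgt C e'"
proof -
  obtain k where k: "e \<in> Ar C" "k \<in> Ar C" "src C k = tgt C e" "tgt C k = src C e"
    "k \<cdot> e = idn C (tgt C e)"
    using assms(1) by (rule split_epiE)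
  have e': "e' \<in> Ar C" using assms(2) by simp
  have "inc (tgt C e) b = k \<cdot> e \<cdot> inc (tgt C e) b" using k assms by simp
  also have "\<dots> = k \<cdot> (e \<cdot> inc (tgt C e) b)" using k(1-4) assms by (simp add: assoc)
  also have "\<dots> = (k \<cdot> e') \<cdot> inc (tgt C e') b" unfolding assms(6)
    using k(1-4) e' assms(2-5) by (simp add: assoc)
  finally have "inc (tgt C e) b = (k \<cdot> e') \<cdot> inc (tgt C e') b" .
  then have "k \<cdot> e' \<in> Incl C"
    by (rule Incl_factor[rotated 4]) (use assms(3-5) k(2-4) e' in simp_all)
  then show ?thesis by (rule leI) (use k e' assms(3) in auto)
qed

text \<open>Antisymmetry identifies the two images, and their common inclusion is cancelled as a
  monomorphism. This is why the epimorphic part does not depend on the factorisation.\<close>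

lemma image_unique:
  assumes "split_epi e" "split_epi e'" "src C e = src C e'"
    "tgt C e \<preceq> b" "tgt C e' \<preceq> b" "e \<cdot> inc (tgt C e) b = e' \<cdot> inc (tgt C e') b"
  shows "e = e'"
proof -
  have "tgt C e = tgt C e'"
    using image_le[OF assms(1-6)] image_le[OF assms(2,1) assms(3)[symmetric] assms(5,4)
      assms(6)[symmetric]]
    by (rule le_antisym)
  then have "e \<cdot> inc (tgt C e) b = e' \<cdot> inc (tgt C e) b" using assms(6) by metis
  with \<open>tgt C e = tgt C e'\<close> show ?thesis
    by (intro inc_mono[of "tgt C e" b e e']) (use assms(1,2,4) in simp_all)
qed

end

section \<open>Epimorphic parts in a normal category\<close>

context normal_category
begin

lemma inc_splits:
  assumes "a \<preceq> b"
  obtains q where "q \<in> Ar C" "src C q = b" "tgt C q = a" "inc a b \<cdot> q = idn C a"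
  using Incl_splits[of "inc a b"] assms unfolding splits_by_def Hom_def by auto

text \<open>The retraction \<open>q\<close> is split by the inclusion that it retracts, and the
  isomorphism \<open>u\<close> by its inverse.\<close>

lemma normal_factorisation_split_epi:
  assumes "normal_factorisation C f q u j"
  shows "split_epi (q \<cdot> u)" "tgt C (q \<cdot> u) = src C j" "j \<in> Incl C" "f = q \<cdot> u \<cdot> j"
    "src C (q \<cdot> u) = src C f"
proof -
  note a = assms[unfolded normal_factorisation_def]
  obtain i where i: "i \<in> Incl C" "splits_by C i q" using a unfolding retraction_def by blast
  then have q: "q \<in> Ar C" "src C q = tgt C i" "tgt C q = src C i" "i \<cdot> q = idn C (src C i)"
    unfolding splits_by_def Hom_def by auto
  have qe: "split_epi q" by (rule split_epiI[of _ i]) (use q i in auto)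
  show "split_epi (q \<cdot> u)" using split_epi_cmp[OF qe] a by (auto intro: iso_split_epi)
  show "tgt C (q \<cdot> u) = src C j" "j \<in> Incl C" "f = q \<cdot> u \<cdot> j" "src C (q \<cdot> u) = src C f"
    using a q by auto
qed

text \<open>By \<open>image_unique\<close>, any split epimorphism followed by an inclusion is as
  good as a normal factorisation. The later rules for \<open>epi_part\<close> rest on this criterion
  rather than on its description by \<open>THE\<close>.\<close>

lemma epi_part_eq:
  assumes "split_epi e" "tgt C e \<preceq> b" "f = e \<cdot> inc (tgt C e) b"
  shows "epi_part C f = e"
proof -
  have f: "f \<in> Ar C" "src C f = src C e" "tgt C f = b" using assms by auto
  have *: "h = e" if "normal_factorisation C f q u j" "h = q \<cdot> u" for h q u j
  proof -
    note nf = normal_factorisation_split_epi[OF that(1)]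
    have "tgt C j = tgt C f" using nf(1-3) unfolding nf(4) by simp
    then have j: "inc (tgt C h) b = j" "tgt C h \<preceq> b"
      using nf(2,3) that(2) f(3) inc_eqI[of j] leI[of j] by auto
    show ?thesis
    proof (rule image_unique)
      show "h \<cdot> inc (tgt C h) b = e \<cdot> inc (tgt C e) b"
        unfolding j(1) using nf(4) that(2) assms(3) by metis
    qed (use nf(1,5) that(2) assms(1,2) f(2) j(2) in simp_all)
  qed
  obtain q u j where "normal_factorisation C f q u j" using normal_factorisation_ex[OF f(1)]
      by blast
  then show ?thesis unfolding epi_part_def using * by (intro the_equality) blast+
qed

lemma epi_part_factor:
  assumes "f \<in> Ar C"
  shows "split_epi (epi_part C f)" "src C (epi_part C f) = src C f" "tgt C (epi_part C f) \<preceq> tgt C f"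
    "epi_part C f \<cdot> inc (tgt C (epi_part C f)) (tgt C f) = f"
proof -
  obtain q u j where nf: "normal_factorisation C f q u j" using normal_factorisation_ex[OF assms]
      by blast
  note nf = normal_factorisation_split_epi[OF nf]
  have "tgt C f = tgt C j" using nf(1-3) unfolding nf(4) by simp
  then have j: "inc (tgt C (q \<cdot> u)) (tgt C f) = j" "tgt C (q \<cdot> u) \<preceq> tgt C f"
    using nf(2,3) inc_eqI[of j] leI[of j] by auto
  have f: "q \<cdot> u \<cdot> inc (tgt C (q \<cdot> u)) (tgt C f) = f" unfolding j(1) by (rule nf(4)[symmetric])
  have e: "epi_part C f = q \<cdot> u" by (rule epi_part_eq[OF nf(1) j(2) f[symmetric]])
  show "split_epi (epi_part C f)" "src C (epi_part C f) = src C f" "tgt C (epi_part C f) \<preceq> tgt C f"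
    "epi_part C f \<cdot> inc (tgt C (epi_part C f)) (tgt C f) = f" unfolding e
        by (fact nf(1) nf(5) j(2) f)+
qed

lemma epi_part_Ar [simp]: "f \<in> Ar C \<Longrightarrow> epi_part C f \<in> Ar C"
  using epi_part_factor(1) by auto

declare epi_part_factor(1,2) [simp]

lemma epi_part_split_epi [simp]: "split_epi e \<Longrightarrow> epi_part C e = e"
  by (rule epi_part_eq[of _ "tgt C e"]) auto

lemma epi_part_inc [simp]: "a \<preceq> b \<Longrightarrow> epi_part C (inc a b) = idn C a"
  using le_Ob(1)[of a b] by (intro epi_part_eq[of _ b]) auto

lemma epi_part_cmp_inc:
  assumes "f \<in> Ar C" "tgt C f = a" "a \<preceq> b"
  shows "epi_part C (f \<cdot> inc a b) = epi_part C f"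
proof (rule epi_part_eq[of _ b])
  note e = epi_part_factor[OF assms(1)]
  show "split_epi (epi_part C f)" by (rule e)
  show "tgt C (epi_part C f) \<preceq> b" using e assms le_trans by blast
  have "f \<cdot> inc a b = epi_part C f \<cdot> inc (tgt C (epi_part C f)) a \<cdot> inc a b"
    using e assms by simp
  also have "\<dots> = epi_part C f \<cdot> (inc (tgt C (epi_part C f)) a \<cdot> inc a b)"
    by (rule assoc) (use assms e in simp_all)
  also have "\<dots> = epi_part C f \<cdot> inc (tgt C (epi_part C f)) b"
    using assms e by (simp add: inc_cmp)
  finally show "f \<cdot> inc a b = epi_part C f \<cdot> inc (tgt C (epi_part C f)) b" .
qed

text \<open>Prefixing a split epimorphism leaves the image unchanged, so the same inclusion
  completes the factorisation.\<close>

lemma epi_part_epi_cmp: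
  assumes "split_epi e" "f \<in> Ar C" "tgt C e = src C f"
  shows "epi_part C (e \<cdot> f) = e \<cdot> epi_part C f"
proof (rule epi_part_eq[of _ "tgt C f"])
  note p = epi_part_factor[OF assms(2)]
  show "split_epi (e \<cdot> epi_part C f)" using assms by (intro split_epi_cmp) auto
  have "e \<cdot> epi_part C f \<cdot> inc (tgt C (epi_part C f)) (tgt C f)
      = e \<cdot> (epi_part C f \<cdot> inc (tgt C (epi_part C f)) (tgt C f))"
    using assms p by (intro assoc) auto
  then show "e \<cdot> f = (e \<cdot> epi_part C f) \<cdot> inc (tgt C (e \<cdot> epi_part C f)) (tgt C f)"
    using assms p by auto
  show "tgt C (e \<cdot> epi_part C f) \<preceq> tgt C f" using assms p by auto
qed

text \<open>The epimorphic part of \<open>m\<close> inherits a right inverse from \<open>m\<close>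
  and has a left inverse of its own; the two coincide, so it is an isomorphism.\<close>

lemma split_mono_factor:
  assumes "m \<in> Ar C" "r \<in> Ar C" "src C r = tgt C m" "tgt C r = src C m" "m \<cdot> r = idn C (src C m)"
  obtains w where "iso_arr C w" "src C w = src C m" "tgt C w \<preceq> tgt C m"
      "w \<cdot> inc (tgt C w) (tgt C m) = m"
proof
  let ?w = "epi_part C m"
  note e = epi_part_factor[OF assms(1)]
  let ?r = "inc (tgt C ?w) (tgt C m) \<cdot> r"
  have r: "?r \<in> Ar C" "src C ?r = tgt C ?w" "tgt C ?r = src C ?w" using e assms by auto
  have 1: "?w \<cdot> ?r = idn C (src C ?w)"
    using assms(1-4) assms(5)[folded e(2)] e assoc[of ?w "inc (tgt C ?w) (tgt C m)" r] by simp
  obtain k where k: "?w \<in> Ar C" "k \<in> Ar C" "src C k = tgt C ?w" "tgt C k = src C ?w"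
    "k \<cdot> ?w = idn C (tgt C ?w)"
    using e(1) by (rule split_epiE)
  have "k = k \<cdot> (?w \<cdot> ?r)" using k 1 by simp
  also have "\<dots> = ?r" using k r assoc[of k ?w ?r] by simp
  finally have "k = ?r" .
  then show "iso_arr C ?w" using 1 k by (intro iso_arrI[of _ k]) auto
qed (use epi_part_factor[OF assms(1)] in auto)

end

section \<open>Regular semigroups\<close>

locale regular_sgrp =
  fixes S :: "'a sgrp" (structure)
  assumes regular_semigroup: "regular_semigroup S"
begin

lemma mul_closed [simp]: "a \<in> elems S \<Longrightarrow> b \<in> elems S \<Longrightarrow> a \<odot> b \<in> elems S"
  using regular_semigroup unfolding regular_semigroup_def by blast

lemma mul_assoc:
  "a \<in> elems S \<Longrightarrow> b \<in> elems S \<Longrightarrow> c \<in> elems S \<Longrightarrow> a \<odot> b \<odot> c = a \<odot> (b \<odot> c)"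
  using regular_semigroup unfolding regular_semigroup_def by blast

lemma regularE:
  assumes "a \<in> elems S"
  obtains x where "x \<in> elems S" "a \<odot> x \<odot> a = a"
  using assms regular_semigroup unfolding regular_semigroup_def by blast

lemma idems_elems [simp]: "e \<in> idems S \<Longrightarrow> e \<in> elems S"
  unfolding idems_def by blast

lemma idems_mul [simp]: "e \<in> idems S \<Longrightarrow> e \<odot> e = e"
  unfolding idems_def by blast

lemma idemsI: "e \<in> elems S \<Longrightarrow> e \<odot> e = e \<Longrightarrow> e \<in> idems S"
  unfolding idems_def by blast

text \<open>In a regular semigroup \<open>a = a \<odot> (x \<odot> a)\<close>, so inclusion of
  principal right ideals can be expressed without adjoining \<open>a\<close> itself.\<close>

definition rle :: "'a \<Rightarrow> 'a \<Rightarrow> bool" where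
  "rle a b \<longleftrightarrow> (\<exists>x\<in>elems S. a = b \<odot> x)"

lemma rle_refl: assumes "a \<in> elems S" shows "rle a a"
proof -
  obtain x where "x \<in> elems S" "a \<odot> x \<odot> a = a" using assms by (rule regularE)
  then have "x \<odot> a \<in> elems S" "a = a \<odot> (x \<odot> a)" using assms mul_assoc[of a x a] by simp_all
  then show ?thesis unfolding rle_def by blast
qed

lemma rle_mul: "\<lbrakk>a \<in> elems S; x \<in> elems S\<rbrakk> \<Longrightarrow> rle (a \<odot> x) a"
  unfolding rle_def by blast

lemma rle_trans: assumes "rle a b" "rle b c" "c \<in> elems S" shows "rle a c"
proof -
  obtain x y where "x \<in> elems S" "y \<in> elems S" "a = b \<odot> x" "b = c \<odot> y"
    using assms unfolding rle_def by blast
  then have "y \<odot> x \<in> elems S" "a = c \<odot> (y \<odot> x)" using assms(3) by (auto simp: mul_assoc)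
  then show ?thesis unfolding rle_def by blast
qed

lemma right_ideal_eq: "a \<in> elems S \<Longrightarrow> right_ideal S a = {b. rle b a}"
  using rle_refl[of a] unfolding right_ideal_def rle_def by auto

lemma right_ideal_subset_iff:
  "a \<in> elems S \<Longrightarrow> b \<in> elems S \<Longrightarrow> right_ideal S a \<subseteq> right_ideal S b \<longleftrightarrow> rle a b"
  by (simp add: right_ideal_eq) (blast intro: rle_refl rle_trans)

lemma in_R_class_iff: "a \<in> elems S \<Longrightarrow> b \<in> R_class S a \<longleftrightarrow> b \<in> elems S \<and> rle a b \<and> rle b a"
  unfolding R_class_def using right_ideal_subset_iff by auto

lemma R_class_self: "a \<in> elems S \<Longrightarrow> a \<in> R_class S a"
  by (simp add: R_class_def)

lemma R_class_in [simp]: "a \<in> elems S \<Longrightarrow> R_class S a \<in> R_classes S"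
  by (simp add: R_classes_def)

lemma R_classesE:
  assumes "d \<in> R_classes S"
  obtains a where "a \<in> elems S" "d = R_class S a"
  using assms unfolding R_classes_def by blast

lemma R_class_eq: "d \<in> R_classes S \<Longrightarrow> a \<in> d \<Longrightarrow> R_class S a = d"
  unfolding R_classes_def R_class_def by auto

lemma R_classes_elems: "d \<in> R_classes S \<Longrightarrow> a \<in> d \<Longrightarrow> a \<in> elems S"
  unfolding R_classes_def R_class_def by auto

lemma R_class_eq_iff:
  "a \<in> elems S \<Longrightarrow> b \<in> elems S \<Longrightarrow> R_class S a = R_class S b \<longleftrightarrow> rle a b \<and> rle b a"
  using in_R_class_iff[of a b] in_R_class_iff[of b a] R_class_self[of a] R_class_eq[of
    "R_class S a" b]
  by auto

lemma R_le_iff: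
  assumes "a \<in> elems S" "b \<in> elems S"
  shows "R_le S (R_class S a) (R_class S b) \<longleftrightarrow> rle a b"
proof
  assume "R_le S (R_class S a) (R_class S b)"
  then obtain a' b' where "a' \<in> elems S" "b' \<in> elems S" "R_class S a = R_class S a'"
    "R_class S b = R_class S b'" "rle a' b'"
    unfolding R_le_def using right_ideal_subset_iff by blast
  then show "rle a b" using assms R_class_eq_iff rle_trans by meson
next
  assume "rle a b"
  then show "R_le S (R_class S a) (R_class S b)"
    unfolding R_le_def using assms right_ideal_subset_iff by blast
qed

lemma rle_idem_iff:
  assumes "e \<in> idems S" "a \<in> elems S" shows "rle a e \<longleftrightarrow> e \<odot> a = a"
proof
  assume "rle a e"
  then obtain x where x: "x \<in> elems S" "a = e \<odot> x" unfolding rle_def by blast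
  then have "e \<odot> a = e \<odot> e \<odot> x" using assms by (simp add: mul_assoc del: idems_mul)
  then show "e \<odot> a = a" using x assms by simp
next
  assume "e \<odot> a = a"
  then show "rle a e" unfolding rle_def using assms by metis
qed

text \<open>If \<open>a \<odot> x \<odot> a = a\<close>, then \<open>a \<odot> x\<close> is
  idempotent and generates the same right ideal as \<open>a\<close>.\<close>

lemma R_class_idem:
  assumes "a \<in> elems S"
  obtains e where "e \<in> idems S" "e \<in> R_class S a"
proof -
  obtain x where x: "x \<in> elems S" "a \<odot> x \<odot> a = a" using assms by (rule regularE)
  have "a \<odot> x \<odot> (a \<odot> x) = a \<odot> x \<odot> a \<odot> x" using x(1) assms by (simp add: mul_assoc)
  then have e: "a \<odot> x \<in> idems S" using x assms by (intro idemsI) simp_all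
  have "rle a (a \<odot> x)" "rle (a \<odot> x) a"
    using x assms e rle_idem_iff rle_mul by auto
  then have "a \<odot> x \<in> R_class S a" using in_R_class_iff x assms by simp
  with e show ?thesis by (rule that)
qed

lemma downset_R_classes: "R_downset S (R_classes S)"
  unfolding R_downset_def by blast

end

section \<open>Homomorphisms and isomorphisms of semigroups\<close>

lemma semigroup_hom_closed: "semigroup_hom S T \<phi> \<Longrightarrow> a \<in> elems S \<Longrightarrow> \<phi> a \<in> elems T"
  unfolding semigroup_hom_def by (blast dest: PiE_mem)

lemma semigroup_hom_mul:
  "\<lbrakk>semigroup_hom S T \<phi>; a \<in> elems S; b \<in> elems S\<rbrakk> \<Longrightarrow> \<phi> (a \<odot>\<^bsub>S\<^esub> b) = \<phi> a \<odot>\<^bsub>T\<^esub> \<phi> b"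
  unfolding semigroup_hom_def by blast

lemma semigroup_hom_idems:
  assumes "semigroup_hom S T \<phi>" "e \<in> idems S"
  shows "\<phi> e \<in> idems T"
proof -
  have e: "e \<in> elems S" "e \<odot>\<^bsub>S\<^esub> e = e" using assms(2) unfolding idems_def by auto
  show ?thesis
    unfolding idems_def
    using semigroup_hom_closed[OF assms(1) e(1)] semigroup_hom_mul[OF assms(1) e(1,1)] e(2) by simp
qed

lemma semigroup_hom_compose:
  assumes "semigroup_hom S T \<phi>" "semigroup_hom T U \<psi>"
    "\<And>a b. a \<in> elems S \<Longrightarrow> b \<in> elems S \<Longrightarrow> a \<odot>\<^bsub>S\<^esub> b \<in> elems S"
  shows "semigroup_hom S U (compose (elems S) \<psi> \<phi>)"
  using semigroup_hom_closed[OF assms(1)] semigroup_hom_closed[OF assms(2)]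
    semigroup_hom_mul[OF assms(1)] semigroup_hom_mul[OF assms(2)] assms(3)
  unfolding semigroup_hom_def[of S U] by (auto simp: compose_def)

lemma semigroup_hom_id:
  "(\<And>a b. a \<in> elems S \<Longrightarrow> b \<in> elems S \<Longrightarrow> a \<odot>\<^bsub>S\<^esub> b \<in> elems S)
    \<Longrightarrow> semigroup_hom S S (\<lambda>x\<in>elems S. x)"
  by (auto simp: semigroup_hom_def)

lemma semigroup_hom_inverse:
  assumes "semigroup_hom S T \<phi>" "bij_betw \<phi> (elems S) (elems T)"
    "\<And>a b. a \<in> elems S \<Longrightarrow> b \<in> elems S \<Longrightarrow> a \<odot>\<^bsub>S\<^esub> b \<in> elems S"
  shows "semigroup_hom T S (restrict (inv_into (elems S) \<phi>) (elems T))"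
    "bij_betw (restrict (inv_into (elems S) \<phi>) (elems T)) (elems T) (elems S)"
proof -
  let ?\<psi> = "inv_into (elems S) \<phi>"
  have \<psi>: "bij_betw ?\<psi> (elems T) (elems S)" using assms(2) by (rule bij_betw_inv_into)
  have closed: "?\<psi> x \<in> elems S" if "x \<in> elems T" for x using \<psi> that by (rule bij_betw_apply)
  have right: "\<phi> (?\<psi> x) = x" if "x \<in> elems T" for x
    using assms(2) that by (rule bij_betw_inv_into_right)
  have left: "?\<psi> (\<phi> a) = a" if "a \<in> elems S" for a
    using assms(2) that by (rule bij_betw_inv_into_left)
  have "?\<psi> (x \<odot>\<^bsub>T\<^esub> y) = ?\<psi> x \<odot>\<^bsub>S\<^esub> ?\<psi> y \<and> x \<odot>\<^bsub>T\<^esub> y \<in> elems T" if "x \<in> elems T" "y \<in> elems T" for x y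
  proof -
    have "\<phi> (?\<psi> x \<odot>\<^bsub>S\<^esub> ?\<psi> y) = x \<odot>\<^bsub>T\<^esub> y"
      using that closed right semigroup_hom_mul[OF assms(1)] by simp
    moreover have "?\<psi> x \<odot>\<^bsub>S\<^esub> ?\<psi> y \<in> elems S" using that closed assms(3) by simp
    ultimately show ?thesis using left semigroup_hom_closed[OF assms(1)] by metis
  qed
  then show "semigroup_hom T S (restrict ?\<psi> (elems T))"
    using closed unfolding semigroup_hom_def by auto
  show "bij_betw (restrict ?\<psi> (elems T)) (elems T) (elems S)"
    using \<psi> by (simp add: bij_betw_restrict_eq)
qed

lemma isomorphic_semigroups_trans:
  assumes "isomorphic_semigroups S T" "isomorphic_semigroups T U"
    "\<And>a b. a \<in> elems S \<Longrightarrow> b \<in> elems S \<Longrightarrow> a \<odot>\<^bsub>S\<^esub> b \<in> elems S"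
  shows "isomorphic_semigroups S U"
proof -
  obtain \<phi> \<psi> where "semigroup_hom S T \<phi>" "bij_betw \<phi> (elems S) (elems T)"
    "semigroup_hom T U \<psi>" "bij_betw \<psi> (elems T) (elems U)"
    using assms(1,2) unfolding isomorphic_semigroups_def by blast
  then show ?thesis
    unfolding isomorphic_semigroups_def using assms(3)
    by (intro exI[of _ "compose (elems S) \<psi> \<phi>"] conjI semigroup_hom_compose bij_betw_compose)
qed

lemma isomorphic_semigroups_sym:
  assumes "isomorphic_semigroups S T"
    "\<And>a b. a \<in> elems S \<Longrightarrow> b \<in> elems S \<Longrightarrow> a \<odot>\<^bsub>S\<^esub> b \<in> elems S"
  shows "isomorphic_semigroups T S"
  using assms(1) semigroup_hom_inverse[OF _ _ assms(2)] unfolding isomorphic_semigroups_def by blast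

lemma regular_semigroup_image:
  assumes "regular_semigroup S" "semigroup_hom S T \<phi>" "\<phi> ` elems S = elems T"
  shows "regular_semigroup T"
proof -
  interpret S: regular_sgrp S by unfold_locales fact
  note hom = semigroup_hom_mul[OF assms(2), symmetric]
  show ?thesis
    unfolding regular_semigroup_def assms(3)[symmetric]
  proof (intro conjI)
    show "\<forall>a\<in>\<phi> ` elems S. \<exists>x\<in>\<phi> ` elems S. a \<odot>\<^bsub>T\<^esub> x \<odot>\<^bsub>T\<^esub> a = a"
    proof
      fix a assume "a \<in> \<phi> ` elems S"
      then obtain b where b: "b \<in> elems S" "a = \<phi> b" by blast
      then obtain x where "x \<in> elems S" "b \<odot>\<^bsub>S\<^esub> x \<odot>\<^bsub>S\<^esub> b = b" using S.regularE by metis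
      then show "\<exists>x\<in>\<phi> ` elems S. a \<odot>\<^bsub>T\<^esub> x \<odot>\<^bsub>T\<^esub> a = a"
        using b by (intro bexI[of _ "\<phi> x"]) (auto simp: hom)
    qed
  qed (auto simp: hom S.mul_assoc)
qed

section \<open>The semigroup of cones\<close>

abbreviation cones :: "('o, 'm, 'x) scat_scheme \<Rightarrow> ('o \<Rightarrow> 'm) set" where
  "cones C \<equiv> elems (cone_semigroup C)"

context normal_category
begin

abbreviation cone_mul (infixl "\<star>" 70) where
  "\<gamma> \<star> \<delta> \<equiv> \<gamma> \<odot>\<^bsub>cone_semigroup C\<^esub> \<delta>"

lemma vertex_eq: assumes "is_cone C z \<gamma>" shows "vertex C \<gamma> = z"
  unfolding vertex_def
proof (rule the_equality)
  fix z' assume "is_cone C z' \<gamma>"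
  then show "z' = z" using assms unfolding is_cone_def Hom_def by fastforce
qed fact

lemma cones_iff: "\<gamma> \<in> cones C \<longleftrightarrow> is_cone C (vertex C \<gamma>) \<gamma>"
  unfolding cone_semigroup_def using vertex_eq by auto

lemma is_cone_cones: "is_cone C z \<gamma> \<Longrightarrow> \<gamma> \<in> cones C"
  using vertex_eq cones_iff by blast

lemma vertex_Ob [simp]: "\<gamma> \<in> cones C \<Longrightarrow> vertex C \<gamma> \<in> Ob C"
  unfolding cones_iff is_cone_def by blast

lemma cone_apply [simp]:
  assumes "\<gamma> \<in> cones C" "c \<in> Ob C"
  shows "\<gamma> c \<in> Ar C" "src C (\<gamma> c) = c" "tgt C (\<gamma> c) = vertex C \<gamma>"
  using assms unfolding cones_iff is_cone_def Hom_def by auto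

lemma cone_inc: "\<gamma> \<in> cones C \<Longrightarrow> a \<preceq> b \<Longrightarrow> inc a b \<cdot> \<gamma> b = \<gamma> a"
  unfolding cones_iff is_cone_def using inc_simps[of a b] by metis

lemma cone_iso:
  assumes "\<gamma> \<in> cones C"
  obtains c where "c \<in> Ob C" "iso_arr C (\<gamma> c)"
  using assms unfolding cones_iff is_cone_def by blast

lemma cone_eqI: "\<lbrakk>\<gamma> \<in> cones C; \<delta> \<in> cones C; \<And>c. c \<in> Ob C \<Longrightarrow> \<gamma> c = \<delta> c\<rbrakk> \<Longrightarrow> \<gamma> = \<delta>"
  unfolding cones_iff is_cone_def by (blast intro: extensionalityI)

lemma is_coneI:
  assumes "z \<in> Ob C" "\<gamma> \<in> extensional (Ob C)"
    and "\<And>c. c \<in> Ob C \<Longrightarrow> \<gamma> c \<in> Ar C \<and> src C (\<gamma> c) = c \<and> tgt C (\<gamma> c) = z"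
    and "\<And>a b. a \<preceq> b \<Longrightarrow> inc a b \<cdot> \<gamma> b = \<gamma> a"
    and "d \<in> Ob C" "iso_arr C (\<gamma> d)"
  shows "is_cone C z \<gamma>"
proof -
  have "j \<cdot> \<gamma> (tgt C j) = \<gamma> (src C j)" if "j \<in> Incl C" for j
    using assms(4)[of "src C j" "tgt C j"] that inc_src_tgt leI by force
  then show ?thesis unfolding is_cone_def Hom_def using assms by blast
qed

text \<open>Every split subobject of the vertex is seen by some component of
  \<open>\<gamma>\<close>. Compose \<open>m\<close> with the inverse of an isomorphism component
  \<open>\<gamma> d\<close>; the result is a split monomorphism into \<open>d\<close>, hence an
  isomorphism \<open>w\<close> onto a subobject of \<open>d\<close>, and the cone condition relates
  \<open>\<gamma>\<close> at that subobject to \<open>\<gamma> d\<close>.\<close>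

lemma cone_split_mono:
  assumes \<gamma>: "\<gamma> \<in> cones C" and m: "m \<in> Ar C" "r \<in> Ar C" "src C r = tgt C m" "tgt C r = src C m"
    "m \<cdot> r = idn C (src C m)" "tgt C m = vertex C \<gamma>"
  obtains w where "iso_arr C w" "src C w = src C m" "w \<cdot> \<gamma> (tgt C w) = m"
proof -
  obtain d where d: "d \<in> Ob C" "iso_arr C (\<gamma> d)" using \<gamma> by (rule cone_iso)
  obtain v where v: "v \<in> Ar C" "src C v = vertex C \<gamma>" "tgt C v = d"
    "\<gamma> d \<cdot> v = idn C d" "v \<cdot> \<gamma> d = idn C (vertex C \<gamma>)"
    using d(2) by (rule iso_arrE) (use d \<gamma> in auto)
  have mv: "m \<cdot> v \<cdot> (\<gamma> d \<cdot> r) = idn C (src C m)"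
    using cancel_middle[of m v "\<gamma> d" r "vertex C \<gamma>"] m v d \<gamma> by simp
  obtain w where w: "iso_arr C w" "src C w = src C m" "tgt C w \<preceq> d" "w \<cdot> inc (tgt C w) d = m \<cdot> v"
    by (rule split_mono_factor[of "m \<cdot> v" "\<gamma> d \<cdot> r"]) (use mv m v d \<gamma> in auto)
  have "w \<cdot> \<gamma> (tgt C w) = w \<cdot> (inc (tgt C w) d \<cdot> \<gamma> d)" using w \<gamma> by (simp add: cone_inc)
  also have "\<dots> = w \<cdot> inc (tgt C w) d \<cdot> \<gamma> d" by (rule assoc[symmetric]) (use w d \<gamma> in auto)
  also have "\<dots> = m \<cdot> (v \<cdot> \<gamma> d)" unfolding w(4) by (rule assoc) (use m v d \<gamma> in auto)
  also have "\<dots> = m" using m v by simp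
  finally show thesis using w that by blast
qed

lemma cone_ext_apply [simp]: "c \<in> Ob C \<Longrightarrow> cone_ext C \<gamma> f c = \<gamma> c \<cdot> f"
  by (simp add: cone_ext_def)

text \<open>Only the existence of an isomorphism component is delicate. A section \<open>k\<close>
  of \<open>e\<close> is a split monomorphism into the vertex, so \<open>cone_split_mono\<close>
  provides an object at which \<open>\<gamma>\<close> followed by \<open>e\<close> is inverse to an
  isomorphism.\<close>

lemma is_cone_ext:
  assumes \<gamma>: "\<gamma> \<in> cones C" and e: "split_epi e" "src C e = vertex C \<gamma>"
  shows "is_cone C (tgt C e) (cone_ext C \<gamma> e)"
proof -
  obtain k where k: "e \<in> Ar C" "k \<in> Ar C" "src C k = tgt C e" "tgt C k = src C e"
    "k \<cdot> e = idn C (tgt C e)"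
    using e(1) by (rule split_epiE)
  obtain w where w: "iso_arr C w" "src C w = src C k" "w \<cdot> \<gamma> (tgt C w) = k"
    by (rule cone_split_mono[of \<gamma> k e]) (use k \<gamma> e in auto)
  have wk: "w \<cdot> (\<gamma> (tgt C w) \<cdot> e) = k \<cdot> e"
    using assoc[of w "\<gamma> (tgt C w)" e] w \<gamma> e k by simp
  have iso: "iso_arr C (\<gamma> (tgt C w) \<cdot> e)"
    by (rule iso_arr_inverse(2)[of w, rotated 4]) (use wk k w \<gamma> e in auto)
  show ?thesis
  proof (rule is_coneI)
    show "iso_arr C (cone_ext C \<gamma> e (tgt C w))" using iso w by simp
    show "inc a b \<cdot> cone_ext C \<gamma> e b = cone_ext C \<gamma> e a" if "a \<preceq> b" for a b
      using that le_Ob[OF that] assoc[of "inc a b" "\<gamma> b" e] cone_inc[of \<gamma> a b] \<gamma> e by simp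
  qed (use \<gamma> e w in \<open>auto simp: cone_ext_def\<close>)
qed

lemma cone_ext_cones [simp]:
  assumes "\<gamma> \<in> cones C" "split_epi e" "src C e = vertex C \<gamma>"
  shows "cone_ext C \<gamma> e \<in> cones C" "vertex C (cone_ext C \<gamma> e) = tgt C e"
  using is_cone_ext[OF assms] is_cone_cones vertex_eq by blast+

lemma cone_mul_eq: "\<gamma> \<star> \<delta> = cone_ext C \<gamma> (epi_part C (\<delta> (vertex C \<gamma>)))"
  by (simp add: cone_semigroup_def)

lemma cone_mul [simp]:
  assumes "\<gamma> \<in> cones C" "\<delta> \<in> cones C"
  shows cone_mul_closed: "\<gamma> \<star> \<delta> \<in> cones C"
    and vertex_cone_mul: "vertex C (\<gamma> \<star> \<delta>) = tgt C (epi_part C (\<delta> (vertex C \<gamma>)))"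
    and cone_mul_apply: "c \<in> Ob C \<Longrightarrow> (\<gamma> \<star> \<delta>) c = \<gamma> c \<cdot> epi_part C (\<delta> (vertex C \<gamma>))"
  using assms by (auto simp: cone_mul_eq)

lemma vertex_cone_mul_le: "\<lbrakk>\<gamma> \<in> cones C; \<delta> \<in> cones C\<rbrakk> \<Longrightarrow> vertex C (\<gamma> \<star> \<delta>) \<preceq> vertex C \<delta>"
  using epi_part_factor(3)[of "\<delta> (vertex C \<gamma>)"] by simp

text \<open>The inclusion part of \<open>f\<close> is absorbed by the cone \<open>\<delta>\<close>,
  which moves from \<open>b\<close> to the image \<open>a\<close>; only the epimorphic part of
  \<open>f\<close> remains in front.\<close>

lemma epi_part_cone_mul:
  assumes f: "f \<in> Ar C" and \<delta>: "\<delta> \<in> cones C" and b: "b = tgt C f" "a = tgt C (epi_part C f)"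
  shows "epi_part C (f \<cdot> \<delta> b) = epi_part C f \<cdot> epi_part C (\<delta> a)"
proof -
  note e = epi_part_factor[OF f]
  have "f \<cdot> \<delta> b = epi_part C f \<cdot> inc a b \<cdot> \<delta> b" using e b by simp
  also have "\<dots> = epi_part C f \<cdot> (inc a b \<cdot> \<delta> b)" by (rule assoc) (use e b f \<delta> in auto)
  also have "\<dots> = epi_part C f \<cdot> \<delta> a" using e b \<delta> by (simp add: cone_inc)
  finally show ?thesis using e b f \<delta> by (simp add: epi_part_epi_cmp)
qed

text \<open>At \<open>c\<close> both sides are \<open>\<alpha> c\<close> followed by the epimorphic
  part of \<open>\<beta> (vertex C \<alpha>) \<cdot> \<gamma> (vertex C \<beta>)\<close>, computed
  in two ways: dropping the final inclusion, or applying \<open>epi_part_cone_mul\<close>.\<close>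

lemma cone_mul_assoc:
  assumes "\<alpha> \<in> cones C" "\<beta> \<in> cones C" "\<gamma> \<in> cones C"
  shows "\<alpha> \<star> \<beta> \<star> \<gamma> = \<alpha> \<star> (\<beta> \<star> \<gamma>)"
proof (rule cone_eqI)
  fix c assume c: "c \<in> Ob C"
  let ?f = "\<beta> (vertex C \<alpha>)" and ?e = "epi_part C (\<gamma> (vertex C \<beta>))"
  note e = epi_part_factor[of "\<gamma> (vertex C \<beta>)"]
  have g: "\<gamma> (vertex C \<beta>) = ?e \<cdot> inc (tgt C ?e) (vertex C \<gamma>)"
    using e assms by simp
  have "?f \<cdot> \<gamma> (vertex C \<beta>) = ?f \<cdot> ?e \<cdot> inc (tgt C ?e) (vertex C \<gamma>)"
    by (subst g, rule assoc[symmetric]) (use e assms in auto)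
  then have "epi_part C (?f \<cdot> \<gamma> (vertex C \<beta>)) = epi_part C (?f \<cdot> ?e)"
    using epi_part_cmp_inc[of "?f \<cdot> ?e"] e assms by simp
  then have "epi_part C (?f \<cdot> ?e) = epi_part C ?f \<cdot> epi_part C (\<gamma> (tgt C (epi_part C ?f)))"
    using epi_part_cone_mul[of ?f \<gamma>] assms by simp
  then show "(\<alpha> \<star> \<beta> \<star> \<gamma>) c = (\<alpha> \<star> (\<beta> \<star> \<gamma>)) c"
    using c assms by (simp add: assoc)
qed (use assms in simp_all)

text \<open>Idempotency is automatic: multiplying such a cone by itself extends it by an
  identity.\<close>

lemma unit_coneE:
  assumes "c \<in> Ob C"
  obtains \<mu> where "\<mu> \<in> idems (cone_semigroup C)" "\<mu> \<in> cones C" "vertex C \<mu> = c" "\<mu> c = idn C c"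
proof -
  obtain \<mu> where "is_cone C c \<mu>" and *: "\<mu> c = idn C c" using cone_ex[OF assms] by blast
  then have \<mu>: "\<mu> \<in> cones C" "vertex C \<mu> = c" using is_cone_cones vertex_eq by auto
  then have "\<mu> \<star> \<mu> = \<mu>" using * assms by (intro cone_eqI) auto
  with \<mu> * show thesis by (intro that[of \<mu>]) (auto simp: idems_def)
qed

text \<open>Invert one isomorphism component \<open>\<gamma> d\<close> to get \<open>v\<close> and
  extend a unit cone at the vertex of \<open>\<gamma>\<close> by \<open>v\<close>. The resulting
  \<open>\<delta>\<close> has vertex \<open>d\<close>, so
  \<open>\<gamma> \<star> \<delta> \<star> \<gamma>\<close> is \<open>\<gamma>\<close> extended by
  \<open>v \<cdot> \<gamma> d\<close>, an identity.\<close>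

lemma cone_mul_regular:
  assumes \<gamma>: "\<gamma> \<in> cones C"
  obtains \<delta> where "\<delta> \<in> cones C" "\<gamma> \<star> \<delta> \<star> \<gamma> = \<gamma>"
proof -
  obtain d where d: "d \<in> Ob C" "iso_arr C (\<gamma> d)" using \<gamma> by (rule cone_iso)
  obtain v where v: "v \<in> Ar C" "src C v = vertex C \<gamma>" "tgt C v = d"
    "\<gamma> d \<cdot> v = idn C d" "v \<cdot> \<gamma> d = idn C (vertex C \<gamma>)"
    using d(2) by (rule iso_arrE) (use d \<gamma> in auto)
  have e: "split_epi v" "split_epi (\<gamma> d)"
    using v d \<gamma> by (auto intro: iso_split_epi split_epiI[of v "\<gamma> d"])
  obtain \<mu> where \<mu>: "\<mu> \<in> cones C" "vertex C \<mu> = vertex C \<gamma>" "\<mu> (vertex C \<gamma>) = idn C (vertex C \<gamma>)"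
    using unit_coneE[of "vertex C \<gamma>"] \<gamma> by auto
  let ?\<delta> = "cone_ext C \<mu> v"
  have \<delta>: "?\<delta> \<in> cones C" "vertex C ?\<delta> = d" "?\<delta> (vertex C \<gamma>) = v" using e v \<mu> \<gamma> by auto
  have "\<gamma> \<star> ?\<delta> \<star> \<gamma> = \<gamma>"
    using e v \<delta> \<gamma> assoc[of _ v "\<gamma> d"] d by (intro cone_eqI) auto
  with \<delta>(1) show thesis by (rule that)
qed

lemma regular_cone_semigroup: "regular_semigroup (cone_semigroup C)"
  unfolding regular_semigroup_def
  using cone_mul_regular cone_mul_assoc cone_mul_closed by metis

end

sublocale normal_category \<subseteq> cone: regular_sgrp "cone_semigroup C"
  by unfold_locales (rule regular_cone_semigroup)

section \<open>Idempotent cones and Green's relations\<close>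

context normal_category
begin

text \<open>Idempotency says that following any component by the epimorphic part of the vertex
  component changes nothing. Cancelling an isomorphism component turns that epimorphic part into an
  identity.\<close>

lemma idem_cone_iff:
  "\<gamma> \<in> idems (cone_semigroup C) \<longleftrightarrow> \<gamma> \<in> cones C \<and> \<gamma> (vertex C \<gamma>) = idn C (vertex C \<gamma>)"
proof
  assume *: "\<gamma> \<in> idems (cone_semigroup C)"
  then have \<gamma>: "\<gamma> \<in> cones C" "\<gamma> \<star> \<gamma> = \<gamma>" by simp_all
  let ?z = "vertex C \<gamma>" let ?e = "epi_part C (\<gamma> ?z)"
  obtain c where c: "c \<in> Ob C" "iso_arr C (\<gamma> c)" using \<gamma>(1) by (rule cone_iso)
  have "?z = tgt C ?e" using vertex_cone_mul[OF \<gamma>(1,1)] \<gamma>(2) by simp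
  then have z: "tgt C ?e = ?z" by simp
  have ce: "\<gamma> c \<cdot> ?e = \<gamma> c" using cone_mul_apply[OF \<gamma>(1,1) c(1)] \<gamma>(2) by simp
  have "?e = idn C ?z"
    by (rule split_epi_cancel[of "\<gamma> c", rotated 5]) (use ce c \<gamma> z iso_split_epi in auto)
  then have "\<gamma> ?z = idn C ?z" using epi_part_factor(4)[of "\<gamma> ?z"] \<gamma> by simp
  with \<gamma> show "\<gamma> \<in> cones C \<and> \<gamma> ?z = idn C ?z" by simp
next
  assume \<gamma>: "\<gamma> \<in> cones C \<and> \<gamma> (vertex C \<gamma>) = idn C (vertex C \<gamma>)"
  then have "\<gamma> \<star> \<gamma> = \<gamma>" by (intro cone_eqI) auto
  with \<gamma> show "\<gamma> \<in> idems (cone_semigroup C)" by (intro cone.idemsI) simp_all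
qed

lemma idem_vertex [simp]: "\<epsilon> \<in> idems (cone_semigroup C) \<Longrightarrow> \<epsilon> (vertex C \<epsilon>) = idn C (vertex C \<epsilon>)"
  by (simp add: idem_cone_iff)

text \<open>Here \<open>\<gamma> = \<epsilon> \<star> \<gamma>\<close>, and the product mentions
  \<open>\<gamma>\<close> only through its component at the vertex of
  \<open>\<epsilon>\<close>.\<close>

lemma cone_eq_below_idem:
  assumes "\<epsilon> \<in> idems (cone_semigroup C)" "cone.rle \<gamma> \<epsilon>" "cone.rle \<delta> \<epsilon>" "\<gamma> \<in> cones C" "\<delta> \<in> cones C"
    "\<gamma> (vertex C \<epsilon>) = \<delta> (vertex C \<epsilon>)"
  shows "\<gamma> = \<delta>"
  using assms cone.rle_idem_iff[of \<epsilon> \<gamma>] cone.rle_idem_iff[of \<epsilon> \<delta>] by (metis cone_mul_eq)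

text \<open>Extending a cone by an epimorphism is a right multiplication, so it moves down in the
  order of right ideals.\<close>

lemma cone_ext_eq_mul:
  assumes "\<gamma> \<in> cones C" "split_epi e" "src C e = vertex C \<gamma>"
    "\<mu> \<in> cones C" "vertex C \<mu> = vertex C \<gamma>" "\<mu> (vertex C \<gamma>) = idn C (vertex C \<gamma>)"
  shows "\<gamma> \<star> cone_ext C \<mu> e = cone_ext C \<gamma> e"
  using assms by (auto simp: cone_mul_eq)

lemma rle_cone_ext:
  assumes "\<gamma> \<in> cones C" "split_epi e" "src C e = vertex C \<gamma>"
  shows "cone.rle (cone_ext C \<gamma> e) \<gamma>"
proof -
  obtain \<mu> where \<mu>: "\<mu> \<in> cones C" "vertex C \<mu> = vertex C \<gamma>" "\<mu> (vertex C \<gamma>) = idn C (vertex C \<gamma>)"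
    using unit_coneE[OF vertex_Ob[OF assms(1)]] by metis
  have "cone.rle (\<gamma> \<star> cone_ext C \<mu> e) \<gamma>" using assms \<mu> by (intro cone.rle_mul) auto
  then show ?thesis using cone_ext_eq_mul[OF assms \<mu>] by simp
qed

text \<open>Evaluate \<open>\<epsilon> \<star> \<gamma> = \<gamma>\<close> at the vertex of
  \<open>\<epsilon>\<close>: since \<open>\<epsilon>\<close> is an identity there, the component of
  \<open>\<gamma>\<close> equals its own epimorphic part.\<close>

lemma cone_below_idem:
  assumes "\<epsilon> \<in> idems (cone_semigroup C)" "\<gamma> \<in> cones C" "cone.rle \<gamma> \<epsilon>"
  shows "split_epi (\<gamma> (vertex C \<epsilon>))" "\<gamma> = cone_ext C \<epsilon> (\<gamma> (vertex C \<epsilon>))"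
proof -
  let ?z = "vertex C \<epsilon>"
  have *: "\<epsilon> \<star> \<gamma> = \<gamma>" using assms cone.rle_idem_iff by blast
  have t: "tgt C (epi_part C (\<gamma> ?z)) = vertex C \<gamma>"
    using vertex_cone_mul[of \<epsilon> \<gamma>] assms * by simp
  have "\<gamma> ?z = (\<epsilon> \<star> \<gamma>) ?z" using * by simp
  also have "\<dots> = epi_part C (\<gamma> ?z)"
    using assms by simp
  finally have e: "\<gamma> ?z = epi_part C (\<gamma> ?z)" .
  show "split_epi (\<gamma> ?z)" by (subst e) (use assms in simp)
  show "\<gamma> = cone_ext C \<epsilon> (\<gamma> ?z)" by (subst e, subst *[symmetric]) (simp only: cone_mul_eq)
qed

text \<open>From \<open>\<epsilon> = \<gamma> \<star> x\<close> the component \<open>?u\<close> gets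
  a right inverse; lying below \<open>\<epsilon>\<close> makes it a split epimorphism, which gives a
  left inverse too.\<close>

lemma cone_R_idem_iso:
  assumes "\<epsilon> \<in> idems (cone_semigroup C)" "\<gamma> \<in> cones C" "cone.rle \<gamma> \<epsilon>" "cone.rle \<epsilon> \<gamma>"
  shows "iso_arr C (\<gamma> (vertex C \<epsilon>))"
proof -
  let ?u = "\<gamma> (vertex C \<epsilon>)"
  obtain x where x: "x \<in> cones C" "\<epsilon> = \<gamma> \<star> x" using assms(4) unfolding cone.rle_def by blast
  let ?v = "epi_part C (x (vertex C \<gamma>))"
  have \<epsilon>: "\<epsilon> \<in> cones C" using assms(1) by simp
  have "\<epsilon> (vertex C \<epsilon>) = ?u \<cdot> ?v" using cone_mul_apply[OF assms(2) x(1), of "vertex C \<epsilon>"] x(2) \<epsilon>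
      by simp
  then have uv: "?u \<cdot> ?v = idn C (vertex C \<epsilon>)" using assms(1) by simp
  have v: "?v \<in> Ar C" "src C ?v = vertex C \<gamma>" "tgt C ?v = vertex C \<epsilon>" "split_epi ?v"
    using vertex_cone_mul[OF assms(2) x(1)] x assms(2) by auto
  have u: "?u \<in> Ar C" "src C ?u = vertex C \<epsilon>" "tgt C ?u = vertex C \<gamma>" "split_epi ?u"
    using \<epsilon> assms cone_below_idem by auto
  obtain k where k: "k \<in> Ar C" "src C k = tgt C ?u" "tgt C k = src C ?u" "k \<cdot> ?u = idn C (tgt C ?u)"
    using u(4) by (rule split_epiE)
  have "k = k \<cdot> (?u \<cdot> ?v)" using k uv u by simp
  also have "\<dots> = ?v" using k u v assoc[of k ?u ?v] by simp
  finally show ?thesis using k uv u v by (intro iso_arrI[of _ ?v]) auto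
qed

text \<open>Both cones are identities at the common vertex. This justifies the definite description
  \<open>conn_idem\<close>.\<close>

lemma R_idem_unique:
  assumes "\<epsilon> \<in> idems (cone_semigroup C)" "\<epsilon>' \<in> idems (cone_semigroup C)"
    "cone.rle \<epsilon>' \<epsilon>" "vertex C \<epsilon> = vertex C \<epsilon>'"
  shows "\<epsilon> = \<epsilon>'"
proof (rule cone_eq_below_idem[OF assms(1) cone.rle_refl assms(3)])
  show "\<epsilon> (vertex C \<epsilon>) = \<epsilon>' (vertex C \<epsilon>)" using assms(1,2,4) idem_vertex by metis
qed (use assms in auto)

text \<open>The left order of Green is the order of vertices. For the witness,
  \<open>cone_split_mono\<close> writes the inclusion of vertices as an isomorphism \<open>w\<close>
  followed by a component of \<open>\<delta>\<close>; extending \<open>\<gamma>\<close> by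
  \<open>w\<close> gives a cone that right multiplication by \<open>\<delta>\<close> takes back to
  \<open>\<gamma>\<close>.\<close>

lemma vertex_le_iff:
  assumes "\<gamma> \<in> cones C" "\<delta> \<in> cones C"
  shows "vertex C \<gamma> \<preceq> vertex C \<delta> \<longleftrightarrow> (\<exists>x\<in>cones C. \<gamma> = x \<star> \<delta>)"
proof
  assume le: "vertex C \<gamma> \<preceq> vertex C \<delta>"
  let ?m = "inc (vertex C \<gamma>) (vertex C \<delta>)"
  obtain q where q: "q \<in> Ar C" "src C q = vertex C \<delta>" "tgt C q = vertex C \<gamma>"
      "?m \<cdot> q = idn C (vertex C \<gamma>)"
    using le by (rule inc_splits)
  obtain w where w: "iso_arr C w" "src C w = src C ?m" "w \<cdot> \<delta> (tgt C w) = ?m"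
    by (rule cone_split_mono[of \<delta> ?m q]) (use assms q le in auto)
  have sw: "split_epi w" "w \<in> Ar C" "tgt C w \<in> Ob C" using w iso_split_epi by auto
  have *: "w \<cdot> epi_part C (\<delta> (tgt C w)) = idn C (vertex C \<gamma>)"
    using epi_part_epi_cmp[of w "\<delta> (tgt C w)"] w sw le assms by simp
  have t: "tgt C (epi_part C (\<delta> (tgt C w))) = vertex C \<gamma>"
    using arg_cong[OF *, of "tgt C"] w sw assms by simp
  let ?x = "cone_ext C \<gamma> w"
  have x: "?x \<in> cones C" "vertex C ?x = tgt C w" using w sw le assms by auto
  have "\<gamma> = ?x \<star> \<delta>"
    using * t x assms w sw le assoc[of _ w "epi_part C (\<delta> (tgt C w))"] by (intro cone_eqI) auto
  with x show "\<exists>x\<in>cones C. \<gamma> = x \<star> \<delta>" by blast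
next
  assume "\<exists>x\<in>cones C. \<gamma> = x \<star> \<delta>"
  then show "vertex C \<gamma> \<preceq> vertex C \<delta>" using vertex_cone_mul_le assms by blast
qed

lemma cone_mul_idem_iff:
  assumes "\<gamma> \<in> cones C" "\<epsilon> \<in> idems (cone_semigroup C)"
  shows "\<gamma> \<star> \<epsilon> = \<gamma> \<longleftrightarrow> vertex C \<gamma> \<preceq> vertex C \<epsilon>"
proof
  assume *: "\<gamma> \<star> \<epsilon> = \<gamma>"
  show "vertex C \<gamma> \<preceq> vertex C \<epsilon>"
      by (subst *[symmetric], rule vertex_cone_mul_le) (use assms in auto)
next
  assume "vertex C \<gamma> \<preceq> vertex C \<epsilon>"
  then obtain x where x: "x \<in> cones C" "\<gamma> = x \<star> \<epsilon>" using vertex_le_iff[of \<gamma> \<epsilon>] assms by auto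
  then have "\<gamma> \<star> \<epsilon> = x \<star> (\<epsilon> \<star> \<epsilon>)" using assms cone_mul_assoc[of x \<epsilon> \<epsilon>] by simp
  then show "\<gamma> \<star> \<epsilon> = \<gamma>" using x assms by simp
qed

end

section \<open>Arrows represented by cones\<close>

context normal_category
begin

definition unit_cone :: "'o \<Rightarrow> 'o \<Rightarrow> 'm" where
  "unit_cone c = (SOME \<mu>. \<mu> \<in> idems (cone_semigroup C) \<and> vertex C \<mu> = c)"

definition arrow_cone :: "'m \<Rightarrow> 'o \<Rightarrow> 'm" where
  "arrow_cone f = cone_ext C (unit_cone (src C f)) (epi_part C f)"

lemma unit_cone [simp]:
  assumes "c \<in> Ob C"
  shows unit_cone_idems: "unit_cone c \<in> idems (cone_semigroup C)"
      and vertex_unit_cone: "vertex C (unit_cone c) = c"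
proof -
  have "\<exists>\<mu>. \<mu> \<in> idems (cone_semigroup C) \<and> vertex C \<mu> = c" using assms unit_coneE by metis
  then have "unit_cone c \<in> idems (cone_semigroup C) \<and> vertex C (unit_cone c) = c"
    unfolding unit_cone_def by (rule someI_ex)
  then show "unit_cone c \<in> idems (cone_semigroup C)" "vertex C (unit_cone c) = c" by auto
qed

lemma unit_cone_cones [simp]: "c \<in> Ob C \<Longrightarrow> unit_cone c \<in> cones C"
  using unit_cone_idems by (rule cone.idems_elems)

lemma unit_cone_below: "a \<preceq> c \<Longrightarrow> unit_cone c a = inc a c"
  using cone_inc[of "unit_cone c" a c] idem_vertex[of "unit_cone c"] le_Ob[of a c] by simp

lemma unit_cone_self [simp]: "c \<in> Ob C \<Longrightarrow> unit_cone c c = idn C c"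
  by (simp add: unit_cone_below)

lemma unit_cone_mul: "c \<in> Ob C \<Longrightarrow> \<gamma> \<in> cones C \<Longrightarrow> unit_cone c \<star> \<gamma> = arrow_cone (\<gamma> c)"
  by (simp add: arrow_cone_def cone_mul_eq)

lemma arrow_cone [simp]:
  assumes "f \<in> Ar C"
  shows arrow_cone_cones: "arrow_cone f \<in> cones C"
    and vertex_arrow_cone: "vertex C (arrow_cone f) = tgt C (epi_part C f)"
    and arrow_cone_src: "arrow_cone f (src C f) = epi_part C f"
  using assms by (simp_all add: arrow_cone_def)

lemma unit_cone_arrow_cone: "f \<in> Ar C \<Longrightarrow> src C f = a \<Longrightarrow> unit_cone a \<star> arrow_cone f = arrow_cone f"
  by (auto simp: arrow_cone_def cone_mul_eq)

lemma arrow_cone_inc: "a \<preceq> b \<Longrightarrow> arrow_cone (inc a b) = unit_cone a"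
  using le_Ob[of a b] by (intro cone_eqI) (auto simp: arrow_cone_def)

text \<open>The product reads \<open>arrow_cone g\<close> at the image of \<open>f\<close>, whereas
  its known component is the one at \<open>src C g\<close>. \<open>epi_part_cone_mul\<close> passes
  from one to the other, and replacing \<open>g\<close> by its epimorphic part does not change the
  epimorphic part of \<open>f \<cdot> g\<close>.\<close>

lemma arrow_cone_cmp:
  assumes "f \<in> Ar C" "g \<in> Ar C" "tgt C f = src C g"
  shows "arrow_cone (f \<cdot> g) = arrow_cone f \<star> arrow_cone g"
proof (rule cone_eqI)
  fix c assume c: "c \<in> Ob C"
  let ?b = "src C g"
  have fg: "epi_part C (f \<cdot> epi_part C g) = epi_part C (f \<cdot> g)"
  proof -
    note e = epi_part_factor[OF assms(2)]
    have "f \<cdot> g = f \<cdot> (epi_part C g \<cdot> inc (tgt C (epi_part C g)) (tgt C g))" using e by simp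
    also have "\<dots> = f \<cdot> epi_part C g \<cdot> inc (tgt C (epi_part C g)) (tgt C g)"
      by (rule assoc[symmetric]) (use e assms in auto)
    finally show ?thesis using epi_part_cmp_inc[of "f \<cdot> epi_part C g"] e assms by simp
  qed
  have "epi_part C (f \<cdot> arrow_cone g ?b)
      = epi_part C f \<cdot> epi_part C (arrow_cone g (tgt C (epi_part C f)))"
    by (rule epi_part_cone_mul) (use assms in auto)
  then have "epi_part C (f \<cdot> g) = epi_part C f \<cdot> epi_part C (arrow_cone g (tgt C (epi_part C f)))"
    using fg assms by simp
  moreover have "(arrow_cone f \<star> arrow_cone g) c
      = unit_cone (src C f) c \<cdot> epi_part C f \<cdot> epi_part C (arrow_cone g (tgt C (epi_part C f)))"
    using c assms by (simp add: arrow_cone_def[of f])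
  ultimately show "arrow_cone (f \<cdot> g) c = (arrow_cone f \<star> arrow_cone g) c"
    using c assms by (simp add: arrow_cone_def[of "f \<cdot> g"] assoc)
qed (use assms in auto)

text \<open>The component at the source is the epimorphic part; the prescribed codomain then
  determines the inclusion that completes the arrow.\<close>

lemma arrow_cone_inj:
  assumes "arrow_cone f = arrow_cone g" "f \<in> Ar C" "g \<in> Ar C" "src C f = src C g"
      "tgt C f = tgt C g"
  shows "f = g"
proof -
  have "epi_part C f = epi_part C g" using arrow_cone_src assms(1-4) by metis
  then show ?thesis using epi_part_factor(4) assms(2,3,5) by metis
qed

text \<open>Under these conditions \<open>\<gamma>\<close> is the arrow cone of its own component at
  \<open>a\<close>, and appending an inclusion to reach \<open>b\<close> leaves the arrow cone
  unchanged.\<close>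

lemma arrow_coneE:
  assumes "\<gamma> \<in> cones C" "a \<in> Ob C" "unit_cone a \<star> \<gamma> = \<gamma>" "vertex C \<gamma> \<preceq> b"
  obtains f where "f \<in> Ar C" "src C f = a" "tgt C f = b" "\<gamma> = arrow_cone f"
proof
  let ?f = "\<gamma> a \<cdot> inc (vertex C \<gamma>) b"
  show "\<gamma> = arrow_cone ?f"
    using unit_cone_mul[of a \<gamma>] assms epi_part_cmp_inc[of "\<gamma> a" "vertex C \<gamma>" b]
    by (simp add: arrow_cone_def)
qed (use assms in auto)

end

section \<open>The category of principal left ideals of a regular semigroup\<close>

context regular_sgrp
begin

abbreviation LC where "LC \<equiv> left_ideal_cat S"

lemma left_ideal_iff: "e \<in> idems S \<Longrightarrow> x \<in> left_ideal S e \<longleftrightarrow> x \<in> elems S \<and> x \<odot> e = x"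
proof
  assume e: "e \<in> idems S" and "x \<in> left_ideal S e"
  then obtain y where y: "y \<in> elems S" "x = y \<odot> e" unfolding left_ideal_def by blast
  then show "x \<in> elems S \<and> x \<odot> e = x" using e mul_assoc[of y e e] by simp
next
  assume "x \<in> elems S \<and> x \<odot> e = x"
  then show "x \<in> left_ideal S e" unfolding left_ideal_def by force
qed

lemma idem_in_left_ideal: "e \<in> idems S \<Longrightarrow> e \<in> left_ideal S e"
  by (simp add: left_ideal_iff)

lemma left_ideal_mul: "e \<in> idems S \<Longrightarrow> x \<in> elems S \<Longrightarrow> y \<in> left_ideal S e \<Longrightarrow> x \<odot> y \<in> left_ideal S e"
  by (simp add: left_ideal_iff mul_assoc)

lemma LC_Ob: "A \<in> Ob LC \<longleftrightarrow> (\<exists>e\<in>idems S. A = left_ideal S e)"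
  by (auto simp: left_ideal_cat_def)

lemma LC_simps [simp]:
  "src LC = fst" "tgt LC = (\<lambda>m. snd (snd m))" "idn LC A = (A, (\<lambda>x\<in>A. x), A)"
  "cmp LC (A, f, B) (B', g, D) = (A, compose A g f, D)"
  by (auto simp: left_ideal_cat_def)

lemma LC_Ob_elems: "A \<in> Ob LC \<Longrightarrow> x \<in> A \<Longrightarrow> x \<in> elems S"
  by (auto simp: LC_Ob left_ideal_iff)

lemma LC_Ob_mul: "A \<in> Ob LC \<Longrightarrow> x \<in> elems S \<Longrightarrow> y \<in> A \<Longrightarrow> x \<odot> y \<in> A"
  by (auto simp: LC_Ob left_ideal_mul)

text \<open>The morphisms \<open>x \<mapsto> x u\<close> are exactly the maps commuting with all left translations.\<close>

lemma LC_Ar_iff: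
  "(A, \<phi>, B) \<in> Ar LC \<longleftrightarrow> A \<in> Ob LC \<and> B \<in> Ob LC \<and> \<phi> \<in> A \<rightarrow>\<^sub>E B \<and>
    (\<forall>x\<in>elems S. \<forall>y\<in>A. \<phi> (x \<odot> y) = x \<odot> \<phi> y)"
proof
  assume "(A, \<phi>, B) \<in> Ar LC"
  then obtain e f s where e: "e \<in> idems S" "f \<in> idems S" "s \<in> elems S"
    and A: "A = left_ideal S e" "B = left_ideal S f"
    and \<phi>: "\<phi> = (\<lambda>x\<in>left_ideal S e. x \<odot> (e \<odot> s \<odot> f))"
    unfolding left_ideal_cat_def r_map_def by auto
  have "x \<odot> (e \<odot> s \<odot> f) \<in> left_ideal S f" if "x \<in> left_ideal S e" for x
    using that e by (simp add: left_ideal_iff mul_assoc)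
  then show "A \<in> Ob LC \<and> B \<in> Ob LC \<and> \<phi> \<in> A \<rightarrow>\<^sub>E B \<and> (\<forall>x\<in>elems S. \<forall>y\<in>A. \<phi> (x \<odot> y) = x \<odot> \<phi> y)"
    using e by (auto simp: LC_Ob A \<phi> left_ideal_mul) (auto simp: left_ideal_iff mul_assoc)
next
  assume *: "A \<in> Ob LC \<and> B \<in> Ob LC \<and> \<phi> \<in> A \<rightarrow>\<^sub>E B \<and> (\<forall>x\<in>elems S. \<forall>y\<in>A. \<phi> (x \<odot> y) = x \<odot> \<phi> y)"
  then obtain e f where e: "e \<in> idems S" "f \<in> idems S"
      and A: "A = left_ideal S e" "B = left_ideal S f"
    unfolding LC_Ob by blast
  \<comment> \<open>The generator determines the map: \<open>x = x \<odot> e\<close> on the ideal,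
    so left linearity gives \<open>\<phi> x = x \<odot> \<phi> e\<close>.\<close>
  let ?u = "\<phi> e"
  have lin: "\<phi> (x \<odot> y) = x \<odot> \<phi> y" if "x \<in> elems S" "y \<in> left_ideal S e" for x y using * A that
      by blast
  have u: "?u \<in> elems S" "?u \<odot> f = ?u" using * A idem_in_left_ideal[OF e(1)] e(2) left_ideal_iff
    by (auto simp: PiE_iff)
  have eu: "e \<odot> ?u = ?u" using lin[of e e] e(1) idem_in_left_ideal by simp
  have "\<phi> = (\<lambda>x\<in>left_ideal S e. x \<odot> ?u)"
  proof (rule extensionalityI)
    show "\<phi> \<in> extensional (left_ideal S e)" using * A by (simp add: PiE_iff)
    fix x assume x: "x \<in> left_ideal S e"
    then show "\<phi> x = (\<lambda>x\<in>left_ideal S e. x \<odot> ?u) x"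
      using lin[of x e] e idem_in_left_ideal left_ideal_iff by simp
  qed simp
  moreover have "?u = e \<odot> ?u \<odot> f" using u eu by simp
  ultimately have "(A, \<phi>, B) = r_map S e ?u f" "?u \<in> {e \<odot> s \<odot> f |s. s \<in> elems S}"
    using A u by (auto simp: r_map_def)
  then show "(A, \<phi>, B) \<in> Ar LC" using e unfolding left_ideal_cat_def by auto
qed

lemma LC_Hom_iff:
  "m \<in> Hom LC A B \<longleftrightarrow> (\<exists>\<phi>. m = (A, \<phi>, B) \<and> A \<in> Ob LC \<and> B \<in> Ob LC \<and> \<phi> \<in> A \<rightarrow>\<^sub>E B \<and>
    (\<forall>x\<in>elems S. \<forall>y\<in>A. \<phi> (x \<odot> y) = x \<odot> \<phi> y))"
  by (cases m) (auto simp: Hom_def LC_Ar_iff)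

lemma LC_Incl_iff:
  "(A, \<phi>, B) \<in> Incl LC \<longleftrightarrow> A \<in> Ob LC \<and> B \<in> Ob LC \<and> A \<subseteq> B \<and> \<phi> = (\<lambda>x\<in>A. x)"
proof -
  have "r_map S e e f = (left_ideal S e, (\<lambda>x\<in>left_ideal S e. x), left_ideal S f)"
      if "e \<in> idems S" for e f
    unfolding r_map_def using that by (auto simp: left_ideal_iff intro!: restrict_ext)
  then have "(A, \<phi>, B) \<in> Incl LC \<longleftrightarrow> (\<exists>e\<in>idems S. \<exists>f\<in>idems S. A = left_ideal S e \<and> B
      = left_ideal S f \<and>
      A \<subseteq> B \<and> \<phi> = (\<lambda>x\<in>A. x))"
    unfolding left_ideal_cat_def by auto metis
  then show ?thesis unfolding LC_Ob by blast
qed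

lemma category_LC: "category LC"
proof
  fix m n k A B D E
  show "m \<in> Ar LC \<Longrightarrow> src LC m \<in> Ob LC" "m \<in> Ar LC \<Longrightarrow> tgt LC m \<in> Ob LC"
    by (cases m; simp add: LC_Ar_iff)+
  show "A \<in> Ob LC \<Longrightarrow> idn LC A \<in> Hom LC A A"
    by (auto simp: LC_Hom_iff LC_Ob_mul)
  show "cmp LC m n \<in> Hom LC A D" if "m \<in> Hom LC A B" "n \<in> Hom LC B D"
    using that by (auto simp: LC_Hom_iff compose_def LC_Ob_mul PiE_iff)
  show "cmp LC (idn LC A) m = m" "cmp LC m (idn LC B) = m" if "m \<in> Hom LC A B"
    using that by (auto simp: LC_Hom_iff compose_def fun_eq_iff PiE_iff extensional_def) metis+
  show "cmp LC (cmp LC m n) k = cmp LC m (cmp LC n k)"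
    if "m \<in> Hom LC A B" "n \<in> Hom LC B D" "k \<in> Hom LC D E"
    using that by (auto simp: LC_Hom_iff compose_def fun_eq_iff PiE_iff)
qed

lemma strict_preorder_LC: "strict_preorder (incl_cat LC)"
proof -
  have simps: "Ob (incl_cat LC) = Ob LC" "Ar (incl_cat LC) = Incl LC" "src (incl_cat LC) = fst"
    "tgt (incl_cat LC) = tgt LC" "idn (incl_cat LC) = idn LC" "cmp (incl_cat LC) = cmp LC"
    by (auto simp: incl_cat_def)
  have hom: "m \<in> Hom (incl_cat LC) A B \<longleftrightarrow> m = (A, (\<lambda>x\<in>A. x), B) \<and> A \<in> Ob LC \<and> B \<in> Ob LC \<and> A \<subseteq> B"
    for m A B by (cases m) (auto simp: Hom_def simps LC_Incl_iff)
  have comp: "compose A (\<lambda>x\<in>B. x) (\<lambda>x\<in>A. x) = (\<lambda>x\<in>A. x)" if "A \<subseteq> B" for A B :: "'a set"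
    using that by (auto simp: compose_def fun_eq_iff)
  have "category (incl_cat LC)"
    by unfold_locales (auto simp: hom simps comp LC_Incl_iff; fail)+
  moreover have "m = idn LC (fst m)" if m: "m \<in> Incl LC" "iso_arr (incl_cat LC) m" for m
  proof -
    obtain A \<phi> B where AB: "m = (A, \<phi>, B)" by (cases m)
    have "A \<subseteq> B" "B \<subseteq> A" "\<phi> = (\<lambda>x\<in>A. x)"
      using m AB by (auto simp: iso_arr_def hom simps LC_Incl_iff)
    then show ?thesis using AB by simp
  qed
  ultimately show ?thesis
    unfolding strict_preorder_def simps by (auto simp: LC_Incl_iff)
qed

lemma LC_factorisation:
  assumes "(A, \<phi>, B) \<in> Ar LC"
  shows "\<exists>q u j. normal_factorisation LC (A, \<phi>, B) q u j"
proof -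
  obtain e f where e: "e \<in> idems S" "f \<in> idems S" and A: "A = left_ideal S e" "B = left_ideal S f"
    and \<phi>: "\<phi> \<in> A \<rightarrow>\<^sub>E B" and lin: "\<And>x y. x \<in> elems S \<Longrightarrow> y \<in> A \<Longrightarrow> \<phi> (x \<odot> y) = x \<odot> \<phi> y"
    using assms unfolding LC_Ar_iff LC_Ob by blast
  define u where "u = \<phi> e"
  have eA: "e \<in> A" using e A idem_in_left_ideal by simp
  have u: "u \<in> elems S" "u \<odot> f = u"
    using \<phi> eA A e left_ideal_iff[of f u] by (auto simp: u_def PiE_iff)
  have eu: "e \<odot> u = u" using lin[of e e] e eA by (simp add: u_def)
  have \<phi>u: "\<phi> x = x \<odot> u" if "x \<in> A" for x
    using lin[of x e] that e eA A left_ideal_iff[of e x] by (simp add: u_def)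
  obtain v where v: "v \<in> elems S" "u \<odot> v \<odot> u = u" using u(1) by (rule regularE)
  \<comment> \<open>Right-nested forms of \<open>u \<odot> v \<odot> u = u\<close>, so that the
    simplifier still recognises it after \<open>mul_assoc\<close> has moved all brackets to the
    right.\<close>
  have uvu: "u \<odot> (v \<odot> u) = u" and uvu': "\<And>x. x \<in> elems S \<Longrightarrow> u \<odot> (v \<odot> (u \<odot> x)) = u \<odot> x"
    using v u mul_assoc[of u v u] mul_assoc[of "u \<odot> v" u] mul_assoc[of u v] by simp_all
  have eu': "e \<odot> (u \<odot> x) = u \<odot> x" if "x \<in> elems S" for x
    using that eu e u mul_assoc[of e u x] by simp
  txt \<open>The map \<open>x \<mapsto> x u\<close> factors as \<open>S e \<rightarrow> S h \<rightarrow> S g \<subseteq> S f\<close>, the first two maps being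
    multiplication by \<open>h\<close> and by \<open>u\<close>; the latter has the inverse \<open>x \<mapsto> x v e\<close>.\<close>
  define g h where "g = v \<odot> u" and "h = u \<odot> v \<odot> e"
  have g: "g \<in> idems S" and h: "h \<in> idems S"
    using u v e by (auto intro!: idemsI simp: g_def h_def mul_assoc uvu' eu')
  define G H where "G = left_ideal S g" and "H = left_ideal S h"
  have G: "x \<in> G \<longleftrightarrow> x \<in> elems S \<and> x \<odot> (v \<odot> u) = x" for x
    using left_ideal_iff[OF g] u v by (simp add: G_def g_def mul_assoc)
  have H: "x \<in> H \<longleftrightarrow> x \<in> elems S \<and> x \<odot> (u \<odot> (v \<odot> e)) = x" for x
    using left_ideal_iff[OF h] u v e by (simp add: H_def h_def mul_assoc)
  have A': "x \<in> A \<longleftrightarrow> x \<in> elems S \<and> x \<odot> e = x" for x using A e left_ideal_iff by simp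
  have B': "x \<in> B \<longleftrightarrow> x \<in> elems S \<and> x \<odot> f = x" for x using A e left_ideal_iff by simp
  have Ob: "A \<in> Ob LC" "B \<in> Ob LC" "G \<in> Ob LC" "H \<in> Ob LC"
    using e g h A G_def H_def unfolding LC_Ob by auto
  have HA: "H \<subseteq> A" and GB: "G \<subseteq> B"
  proof -
    show "H \<subseteq> A"
    proof
      fix x assume x: "x \<in> H"
      then have "x \<in> elems S" using H by blast
      then have "x \<odot> (u \<odot> (v \<odot> e)) \<odot> e = x \<odot> (u \<odot> (v \<odot> e))" using u v e by (simp add: mul_assoc)
      then show "x \<in> A" using x H A' by metis
    qed
    show "G \<subseteq> B"
    proof
      fix x assume x: "x \<in> G"
      then have "x \<in> elems S" using G by blast
      then have "x \<odot> (v \<odot> u) \<odot> f = x \<odot> (v \<odot> u)" using u v e by (simp add: mul_assoc)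
      then show "x \<in> B" using x G B' by metis
    qed
  qed
  let ?q = "(A, (\<lambda>x\<in>A. x \<odot> h), H)" and ?u = "(H, (\<lambda>x\<in>H. x \<odot> u), G)"
    and ?u' = "(G, (\<lambda>x\<in>G. x \<odot> (v \<odot> e)), H)" and ?j = "(G, (\<lambda>x\<in>G. x), B)"
  have xh: "x \<odot> h \<in> H" if "x \<in> elems S" for x
    using that u v e by (simp add: H h_def mul_assoc uvu' eu')
  have xu: "x \<odot> u \<in> G" if "x \<in> elems S" for x
    using that u v e by (simp add: G mul_assoc uvu)
  have xv: "x \<odot> (v \<odot> e) \<in> H \<and> x \<odot> (v \<odot> e) \<odot> u = x" if "x \<in> G" for x
  proof -
    have x: "x \<in> elems S" "x \<odot> (v \<odot> u) = x" using that G by auto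
    have "x \<odot> (v \<odot> (e \<odot> (u \<odot> (v \<odot> e)))) = x \<odot> (v \<odot> u) \<odot> (v \<odot> e)"
      using x(1) u v e by (simp add: mul_assoc eu')
    then have "x \<odot> (v \<odot> (e \<odot> (u \<odot> (v \<odot> e)))) = x \<odot> (v \<odot> e)" using x by simp
    then show ?thesis using x u v e by (simp add: H mul_assoc eu)
  qed
  have qHom: "?q \<in> Hom LC A H"
    using Ob xh h LC_Ob_mul[OF Ob(1)] LC_Ob_elems[OF Ob(1)] by (auto simp: LC_Hom_iff mul_assoc)
  have uHom: "?u \<in> Hom LC H G"
    using Ob xu u LC_Ob_mul[OF Ob(4)] LC_Ob_elems[OF Ob(4)] by (auto simp: LC_Hom_iff mul_assoc)
  have u'Hom: "?u' \<in> Hom LC G H"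
    using Ob xv v e LC_Ob_mul[OF Ob(3)] LC_Ob_elems[OF Ob(3)] by (auto simp: LC_Hom_iff mul_assoc)
  have retr: "retraction LC ?q"
  proof -
    have "x \<odot> h = x" if "x \<in> H" for x using that H u v e by (simp add: h_def mul_assoc)
    then have "splits_by LC (H, (\<lambda>x\<in>H. x), A) ?q"
      using qHom HA by (auto simp: splits_by_def compose_def fun_eq_iff)
    moreover have "(H, (\<lambda>x\<in>H. x), A) \<in> Incl LC" using Ob HA by (simp add: LC_Incl_iff)
    ultimately show ?thesis unfolding retraction_def by blast
  qed
  have "x \<odot> u \<odot> (v \<odot> e) = x" if "x \<in> H" for x using that H u v e by (simp add: mul_assoc)
  then have "cmp LC ?u ?u' = idn LC H" "cmp LC ?u' ?u = idn LC G"
    using xv xu LC_Ob_elems[OF Ob(4)] by (auto simp: compose_def fun_eq_iff)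
  then have iso: "iso_arr LC ?u"
    unfolding iso_arr_def using uHom u'Hom by (auto simp: Hom_def)
  have hu: "x \<odot> h \<odot> u = \<phi> x" if "x \<in> A" for x
    using that \<phi>u LC_Ob_elems[OF Ob(1) that] u v e by (simp add: h_def mul_assoc eu uvu)
  then have "\<phi> x \<in> G" if "x \<in> A" for x
    using that xu[of "x \<odot> h"] LC_Ob_elems[OF Ob(1) that] h by simp
  with hu have "(A, \<phi>, B) = cmp LC (cmp LC ?q ?u) ?j"
    using xh xu LC_Ob_elems[OF Ob(1)] LC_Ob_elems[OF Ob(4)] \<phi>
    by (auto simp: compose_def fun_eq_iff PiE_iff extensional_def)
  moreover have "?j \<in> Incl LC" using Ob GB by (simp add: LC_Incl_iff)
  ultimately have "normal_factorisation LC (A, \<phi>, B) ?q ?u ?j"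
    unfolding normal_factorisation_def using retr iso by simp
  then show ?thesis by blast
qed

text \<open>All components are right multiplication by one idempotent generator \<open>e\<close> of
  \<open>A\<close>. Hence they are compatible with inclusions, and \<open>e\<close> acts on
  \<open>A\<close> as a right identity.\<close>

lemma LC_cone:
  assumes "A \<in> Ob LC"
  shows "\<exists>\<mu>. is_cone LC A \<mu> \<and> \<mu> A = idn LC A"
proof -
  obtain e where e: "e \<in> idems S" "A = left_ideal S e" using assms LC_Ob by blast
  define \<mu> where "\<mu> = (\<lambda>B\<in>Ob LC. (B, (\<lambda>x\<in>B. x \<odot> e), A))"
  have hom: "\<mu> B \<in> Hom LC B A" if "B \<in> Ob LC" for B
    using that assms e LC_Ob_mul[OF that] LC_Ob_elems[OF that]
    by (auto simp: LC_Hom_iff \<mu>_def mul_assoc left_ideal_iff)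
  have idA: "\<mu> A = idn LC A"
    using assms e by (auto simp: \<mu>_def left_ideal_iff intro!: restrict_ext)
  have "iso_arr LC (\<mu> A)"
    unfolding idA using category.iso_arr_idn[OF category_LC assms] .
  moreover have "cmp LC j (\<mu> (tgt LC j)) = \<mu> (src LC j)" if "j \<in> Incl LC" for j
    using that by (cases j) (auto simp: LC_Incl_iff \<mu>_def compose_def fun_eq_iff)
  ultimately have "is_cone LC A \<mu>"
    unfolding is_cone_def using assms hom by (auto simp: \<mu>_def)
  with idA show ?thesis by blast
qed

theorem normal_category_LC: "normal_category LC"
proof -
  interpret category LC by (rule category_LC)
  have Incl_Ar: "Incl LC \<subseteq> Ar LC"
    by (auto simp: LC_Incl_iff LC_Ar_iff LC_Ob_mul)
  show ?thesis
  proof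
    show "Incl LC \<subseteq> Ar LC" "strict_preorder (incl_cat LC)" by (rule Incl_Ar strict_preorder_LC)+
    show "mono_arr LC j" if "j \<in> Incl LC" for j
    proof -
      obtain A B where j: "j = (A, (\<lambda>x\<in>A. x), B)" "A \<in> Ob LC" "A \<subseteq> B"
        using \<open>j \<in> Incl LC\<close> by (cases j) (auto simp: LC_Incl_iff)
      have c: "compose D (\<lambda>x\<in>A. x) \<phi> = \<phi>" if "\<phi> \<in> D \<rightarrow>\<^sub>E A" for D \<phi>
        using that by (auto simp: compose_def fun_eq_iff PiE_iff extensional_def)
      have gj: "cmp LC g j = (fst g, fst (snd g), B)" if "g \<in> Ar LC" "tgt LC g = A" for g
        using that c j by (cases g) (auto simp: LC_Ar_iff)
      show ?thesis
        unfolding mono_arr_def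
      proof (intro conjI ballI impI)
        show "j \<in> Ar LC" using that Incl_Ar by blast
        fix g h assume *: "g \<in> Ar LC" "h \<in> Ar LC"
          "tgt LC g = src LC j \<and> tgt LC h = src LC j \<and> cmp LC g j = cmp LC h j"
        then have "tgt LC g = A" "tgt LC h = A" by (simp_all add: j(1))
        with * gj[of g] gj[of h] show "g = h" by (simp add: prod_eq_iff)
      qed
    qed
    show "h \<in> Incl LC"
        if fgh: "f \<in> Incl LC" "g \<in> Incl LC" "h \<in> Ar LC" "tgt LC h = src LC g" "f = cmp LC h g"
      for f g h
    proof -
      obtain A \<phi> B where h: "h = (A, \<phi>, B)" by (cases h)
      obtain D where g: "g = (B, (\<lambda>x\<in>B. x), D)"
        using fgh(2,4) h by (cases g) (auto simp: LC_Incl_iff)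
      have \<phi>: "\<phi> \<in> A \<rightarrow>\<^sub>E B" "A \<in> Ob LC" "B \<in> Ob LC" using that(3) h by (auto simp: LC_Ar_iff)
      have "compose A (\<lambda>x\<in>B. x) \<phi> = (\<lambda>x\<in>A. x)"
        using that(1,5) g h by (auto simp: LC_Incl_iff)
      moreover have "compose A (\<lambda>x\<in>B. x) \<phi> = \<phi>"
        using \<phi> by (auto simp: compose_def fun_eq_iff PiE_iff extensional_def)
      ultimately have "\<phi> = (\<lambda>x\<in>A. x)" by simp
      then show ?thesis using h \<phi> by (auto simp: LC_Incl_iff PiE_iff)
    qed
    show "\<exists>q. splits_by LC j q" if "j \<in> Incl LC" for j
    proof -
      obtain A B where j: "j = (A, (\<lambda>x\<in>A. x), B)" "A \<in> Ob LC" "B \<in> Ob LC" "A \<subseteq> B"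
        using \<open>j \<in> Incl LC\<close> by (cases j) (auto simp: LC_Incl_iff)
      obtain e where e: "e \<in> idems S" "A = left_ideal S e" using j LC_Ob by blast
      \<comment> \<open>Right multiplication by the generator of \<open>A\<close> maps
        \<open>B\<close> into \<open>A\<close> and fixes \<open>A\<close> pointwise.\<close>
      let ?q = "(B, (\<lambda>x\<in>B. x \<odot> e), A)"
      have "?q \<in> Hom LC B A"
        using j e LC_Ob_mul[OF j(3)] LC_Ob_elems[OF j(3)]
        by (auto simp: LC_Hom_iff mul_assoc left_ideal_iff)
      then have "splits_by LC j ?q"
        using j e by (auto simp: splits_by_def compose_def fun_eq_iff left_ideal_iff)
      then show ?thesis by blast
    qed
    show "\<exists>q u j. normal_factorisation LC f q u j" if "f \<in> Ar LC" for f
      using that LC_factorisation by (cases f) auto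
    show "\<exists>\<mu>. is_cone LC A \<mu> \<and> \<mu> A = idn LC A" if "A \<in> Ob LC" for A
      using that by (rule LC_cone)
  qed
qed

end

section \<open>Inclusion preserving functors and isomorphisms\<close>

lemma functor_simps:
  assumes "is_functor C D F"
  shows functor_Ob: "a \<in> Ob C \<Longrightarrow> fst F a \<in> Ob D"
    and functor_Ar: "f \<in> Ar C \<Longrightarrow> snd F f \<in> Ar D"
    and functor_src: "f \<in> Ar C \<Longrightarrow> src D (snd F f) = fst F (src C f)"
    and functor_tgt: "f \<in> Ar C \<Longrightarrow> tgt D (snd F f) = fst F (tgt C f)"
    and functor_idn: "a \<in> Ob C \<Longrightarrow> snd F (idn C a) = idn D (fst F a)"
    and functor_cmp: "\<lbrakk>f \<in> Ar C; g \<in> Ar C; tgt C f = src C g\<rbrakk>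
      \<Longrightarrow> snd F (f \<cdot>\<^bsub>C\<^esub> g) = snd F f \<cdot>\<^bsub>D\<^esub> snd F g"
  using assms unfolding is_functor_def by (auto simp: PiE_iff)

locale normal_functor = C: normal_category C + D: normal_category D
  for C :: "('o, 'm, 'x) scat_scheme" and D :: "('p, 'n, 'y) scat_scheme" +
  fixes F :: "('o, 'm, 'p, 'n) fctr"
  assumes is_functor: "is_functor C D F"
    and Incl_image: "snd F ` Incl C \<subseteq> Incl D"
begin

declare functor_simps[OF is_functor, simp]

lemma map_le: "C.le a b \<Longrightarrow> D.le (fst F a) (fst F b)"
  using Incl_image by (intro D.leI[of "snd F (C.inc a b)"]) auto

lemma map_inc: "C.le a b \<Longrightarrow> snd F (C.inc a b) = D.inc (fst F a) (fst F b)"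
  using Incl_image by (intro D.inc_eqI[symmetric]) auto

lemma map_split_epi: assumes "C.split_epi e" shows "D.split_epi (snd F e)"
proof -
  obtain k where "e \<in> Ar C" "k \<in> Ar C" "src C k = tgt C e" "tgt C k = src C e"
    "k \<cdot>\<^bsub>C\<^esub> e = idn C (tgt C e)"
    using assms by (rule C.split_epiE)
  then show ?thesis
    using functor_cmp[OF is_functor, of k e] by (intro D.split_epiI[of _ "snd F k"]) auto
qed

lemma map_iso: assumes "iso_arr C f" shows "iso_arr D (snd F f)"
proof -
  obtain g where "g \<in> Ar C" "src C g = tgt C f" "tgt C g = src C f"
    "f \<cdot>\<^bsub>C\<^esub> g = idn C (src C f)" "g \<cdot>\<^bsub>C\<^esub> f = idn C (tgt C f)" "f \<in> Ar C"
    using assms by (rule C.iso_arrE)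
  then show ?thesis
    using functor_cmp[OF is_functor, of f g] functor_cmp[OF is_functor, of g f]
    by (intro D.iso_arrI[of _ "snd F g"]) auto
qed

text \<open>Sections and inclusions are both preserved, so the image of a factorisation is again
  one. Consequently products of cones can be computed before or after applying the functor.\<close>

lemma map_epi_part: assumes "f \<in> Ar C" shows "epi_part D (snd F f) = snd F (epi_part C f)"
proof (rule D.epi_part_eq)
  note e = C.epi_part_factor[OF assms]
  show "D.split_epi (snd F (epi_part C f))" using e by (simp add: map_split_epi)
  show "D.le (tgt D (snd F (epi_part C f))) (fst F (tgt C f))" using e assms by (simp add: map_le)
  have "snd F f = snd F (epi_part C f \<cdot>\<^bsub>C\<^esub> C.inc (tgt C (epi_part C f)) (tgt C f))"
    unfolding e(4) ..
  also have "\<dots> = snd F (epi_part C f) \<cdot>\<^bsub>D\<^esub> snd F (C.inc (tgt C (epi_part C f)) (tgt C f))"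
    using e assms by (intro functor_cmp[OF is_functor]) auto
  finally show "snd F f = snd F (epi_part C f) \<cdot>\<^bsub>D\<^esub>
      D.inc (tgt D (snd F (epi_part C f))) (fst F (tgt C f))"
    using e assms by (simp add: map_inc)
qed

end

section \<open>Transport of normality and of cones along an isomorphism\<close>

definition scat_iso ::
  "('o, 'm, 'x) scat_scheme \<Rightarrow> ('p, 'n, 'y) scat_scheme \<Rightarrow> ('o, 'm, 'p, 'n) fctr \<Rightarrow> bool" where
  "scat_iso C D H \<longleftrightarrow> is_functor C D H \<and> bij_betw (fst H) (Ob C) (Ob D) \<and>
    bij_betw (snd H) (Ar C) (Ar D) \<and> snd H ` Incl C = Incl D"

text \<open>Normality is assumed of \<open>C\<close> and carried over to \<open>D\<close>, because
  \<open>D\<close> may be a bare relabelling of \<open>C\<close> on a set of codes.\<close>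

locale normal_iso = C: normal_category C
  for C :: "('o, 'm, 'x) scat_scheme" and D :: "('p, 'n, 'y) scat_scheme"
    and H :: "('o, 'm, 'p, 'n) fctr" +
  assumes scat_iso: "scat_iso C D H"
begin

abbreviation h where "h \<equiv> fst H"
abbreviation k where "k \<equiv> snd H"

lemma is_functor: "is_functor C D H"
  using scat_iso unfolding scat_iso_def by blast

declare functor_simps[OF is_functor, simp]

lemma k_cmp: "\<lbrakk>f \<in> Ar C; g \<in> Ar C; tgt C f = src C g\<rbrakk> \<Longrightarrow> k f \<cdot>\<^bsub>D\<^esub> k g = k (f \<cdot>\<^bsub>C\<^esub> g)"
  by simp

lemma ObE: assumes "b \<in> Ob D" obtains a where "a \<in> Ob C" "b = h a"
  using assms scat_iso unfolding scat_iso_def bij_betw_def by blast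

lemma ArE: assumes "g \<in> Ar D" obtains f where "f \<in> Ar C" "g = k f"
  using assms scat_iso unfolding scat_iso_def bij_betw_def by blast

lemma InclE: assumes "g \<in> Incl D" obtains f where "f \<in> Incl C" "f \<in> Ar C" "g = k f"
  using assms scat_iso C.Incl_Ar unfolding scat_iso_def by blast

lemma h_eq [simp]: "a \<in> Ob C \<Longrightarrow> b \<in> Ob C \<Longrightarrow> h a = h b \<longleftrightarrow> a = b"
  using scat_iso unfolding scat_iso_def bij_betw_def by (blast dest: inj_onD)

lemma k_eq [simp]: "f \<in> Ar C \<Longrightarrow> g \<in> Ar C \<Longrightarrow> k f = k g \<longleftrightarrow> f = g"
  using scat_iso unfolding scat_iso_def bij_betw_def by (blast dest: inj_onD)

lemma k_Incl [simp]: "f \<in> Ar C \<Longrightarrow> k f \<in> Incl D \<longleftrightarrow> f \<in> Incl C"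
  using scat_iso k_eq C.Incl_Ar unfolding scat_iso_def by blast

lemma HomE:
  assumes "g \<in> Hom D (h a) (h b)" "a \<in> Ob C" "b \<in> Ob C"
  obtains f where "f \<in> Ar C" "src C f = a" "tgt C f = b" "g = k f"
proof -
  obtain f where f: "f \<in> Ar C" "g = k f" using assms ArE unfolding Hom_def by blast
  then have "h (src C f) = h a" "h (tgt C f) = h b" using assms by (auto simp: Hom_def)
  then show thesis using that[of f] f assms by simp
qed

lemma Hom_Ob:
  assumes "g \<in> Hom D a' b'"
  obtains f where "f \<in> Ar C" "g = k f" "a' = h (src C f)" "b' = h (tgt C f)"
proof -
  obtain f where "f \<in> Ar C" "g = k f" using assms ArE unfolding Hom_def by blast
  then show thesis using assms that by (auto simp: Hom_def)
qed

lemma category_image: "category D"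
proof
  fix f g l a b c d
  show "src D f \<in> Ob D" "tgt D f \<in> Ob D" if "f \<in> Ar D"
    using that by (auto elim!: ArE)
  show "idn D a \<in> Hom D a a" if a: "a \<in> Ob D"
  proof -
    obtain b where "b \<in> Ob C" "a = h b" using a by (rule ObE)
    then show ?thesis
      using functor_Ar[OF is_functor, of "idn C b"] functor_src[OF is_functor, of "idn C b"]
        functor_tgt[OF is_functor, of "idn C b"] by (simp add: Hom_def)
  qed
  show "f \<cdot>\<^bsub>D\<^esub> g \<in> Hom D a c" if f: "f \<in> Hom D a b" and g: "g \<in> Hom D b c"
  proof -
    obtain f' g' where "f' \<in> Ar C" "f = k f'" "a = h (src C f')" "b = h (tgt C f')"
      "g' \<in> Ar C" "g = k g'" "b = h (src C g')" "c = h (tgt C g')"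
      using f g by (metis Hom_Ob)
    then show ?thesis by (simp add: k_cmp Hom_def del: functor_cmp[OF is_functor])
  qed
  show "idn D a \<cdot>\<^bsub>D\<^esub> f = f" "f \<cdot>\<^bsub>D\<^esub> idn D b = f" if f: "f \<in> Hom D a b"
  proof -
    obtain f' where f': "f' \<in> Ar C" "f = k f'" "a = h (src C f')" "b = h (tgt C f')"
      using f by (rule Hom_Ob)
    then show "idn D a \<cdot>\<^bsub>D\<^esub> f = f" "f \<cdot>\<^bsub>D\<^esub> idn D b = f"
      using functor_cmp[OF is_functor, of "idn C (src C f')" f']
        functor_cmp[OF is_functor, of f' "idn C (tgt C f')"] by simp_all
  qed
  show "f \<cdot>\<^bsub>D\<^esub> g \<cdot>\<^bsub>D\<^esub> l = f \<cdot>\<^bsub>D\<^esub> (g \<cdot>\<^bsub>D\<^esub> l)"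
    if f: "f \<in> Hom D a b" and g: "g \<in> Hom D b c" and l: "l \<in> Hom D c d"
  proof -
    obtain f' g' l' where "f' \<in> Ar C" "f = k f'" "b = h (tgt C f')"
      "g' \<in> Ar C" "g = k g'" "b = h (src C g')" "c = h (tgt C g')"
      "l' \<in> Ar C" "l = k l'" "c = h (src C l')"
      using f g l by (metis Hom_Ob)
    then show ?thesis by (simp add: k_cmp C.assoc del: functor_cmp[OF is_functor])
  qed
qed

lemma iso_arr_k: "f \<in> Ar C \<Longrightarrow> iso_arr D (k f) \<longleftrightarrow> iso_arr C f"
proof
  assume f: "f \<in> Ar C" and iso: "iso_arr D (k f)"
  interpret D: category D by (rule category_image)
  obtain g' where g': "g' \<in> Ar D" "src D g' = tgt D (k f)" "tgt D g' = src D (k f)"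
    "k f \<cdot>\<^bsub>D\<^esub> g' = idn D (src D (k f))" "g' \<cdot>\<^bsub>D\<^esub> k f = idn D (tgt D (k f))"
    using iso by (rule D.iso_arrE)
  then have "g' \<in> Hom D (h (tgt C f)) (h (src C f))" using f by (simp add: Hom_def)
  then obtain g where g: "g \<in> Ar C" "src C g = tgt C f" "tgt C g = src C f" "g' = k g"
    using f by (auto elim: HomE)
  have "k (f \<cdot>\<^bsub>C\<^esub> g) = k (idn C (src C f))" "k (g \<cdot>\<^bsub>C\<^esub> f) = k (idn C (tgt C f))"
    using g' f g by simp_all
  then have "f \<cdot>\<^bsub>C\<^esub> g = idn C (src C f)" "g \<cdot>\<^bsub>C\<^esub> f = idn C (tgt C f)"
    using f g by (simp_all del: functor_cmp[OF is_functor] functor_idn[OF is_functor])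
  then show "iso_arr C f" using f g by (intro C.iso_arrI[of _ g]) auto
next
  assume f: "f \<in> Ar C" and iso: "iso_arr C f"
  interpret D: category D by (rule category_image)
  obtain g where "g \<in> Ar C" "src C g = tgt C f" "tgt C g = src C f"
    "f \<cdot>\<^bsub>C\<^esub> g = idn C (src C f)" "g \<cdot>\<^bsub>C\<^esub> f = idn C (tgt C f)"
    using iso by (rule C.iso_arrE)
  then show "iso_arr D (k f)"
    using f functor_cmp[OF is_functor, of f g] functor_cmp[OF is_functor, of g f]
    by (intro D.iso_arrI[of _ "k g"]) auto
qed

lemma strict_preorder_image: "strict_preorder (incl_cat D)"
proof -
  interpret D: category D by (rule category_image)
  have simps: "Ob (incl_cat X) = Ob X" "Ar (incl_cat X) = Incl X" "src (incl_cat X) = src X"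
    "tgt (incl_cat X) = tgt X" "idn (incl_cat X) = idn X" "cmp (incl_cat X) = cmp X"
    for X :: "('a, 'b, 'c) scat_scheme"
    by (auto simp: incl_cat_def)
  have sub: "f \<in> Ar D" if "f \<in> Incl D" for f using that by (auto elim!: InclE)
  have hom: "f \<in> Hom (incl_cat D) a b \<longleftrightarrow> f \<in> Incl D \<and> src D f = a \<and> tgt D f = b" for f a b
    by (auto simp: Hom_def simps)
  have idn: "idn D a \<in> Incl D" if "a \<in> Ob D" for a
    using that functor_idn[OF is_functor, symmetric] C.idn_simps(1)
    by (auto elim!: ObE simp del: functor_idn[OF is_functor])
  have cmp: "f \<cdot>\<^bsub>D\<^esub> g \<in> Incl D" if "f \<in> Incl D" "g \<in> Incl D" "tgt D f = src D g" for f g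
    using that C.cmp_Incl by (auto elim!: InclE simp: k_cmp simp del: functor_cmp[OF is_functor])
  have "category (incl_cat D)"
    by unfold_locales (use idn cmp sub in \<open>auto simp: hom simps D.assoc\<close>)
  moreover have "f = g" if "f \<in> Incl D" "g \<in> Incl D" "src D f = src D g" "tgt D f = tgt D g" for f g
    using that by (auto elim!: InclE intro: C.Incl_unique)
  moreover have "f = idn D (src D f)" if f: "f \<in> Incl D" "iso_arr (incl_cat D) f" for f
  proof -
    obtain g where g: "g \<in> Incl D" "src D g = tgt D f" "tgt D g = src D f"
      using f by (auto simp: iso_arr_def hom simps)
    obtain f' where f': "f' \<in> Incl C" "f' \<in> Ar C" "f = k f'" using f(1) by (rule InclE)
    obtain g' where g': "g' \<in> Incl C" "g' \<in> Ar C" "g = k g'" using g(1) by (rule InclE)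
    have st: "src C g' = tgt C f'" "tgt C g' = src C f'" using g f' g' by auto
    then have "src C f' = tgt C f'"
      using f' g' by (intro C.le_antisym) (auto intro: C.leI[of f'] C.leI[of g'])
    then have "f' = idn C (src C f')" using f' by (intro C.Incl_unique) auto
    then show ?thesis using f' functor_idn[OF is_functor, of "src C f'"] by simp
  qed
  ultimately show ?thesis unfolding strict_preorder_def simps by blast
qed

lemma is_cone_image:
  assumes \<gamma>: "is_cone C z \<gamma>"
  defines "\<delta> \<equiv> (\<lambda>b\<in>Ob D. k (\<gamma> (inv_into (Ob C) h b)))"
  shows "is_cone D (h z) \<delta>" "c \<in> Ob C \<Longrightarrow> \<delta> (h c) = k (\<gamma> c)"
proof -
  have "inj_on h (Ob C)" using scat_iso unfolding scat_iso_def bij_betw_def by blast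
  then have \<delta>: "\<delta> (h c) = k (\<gamma> c)" if "c \<in> Ob C" for c using that by (simp add: \<delta>_def)
  then show "c \<in> Ob C \<Longrightarrow> \<delta> (h c) = k (\<gamma> c)" .
  have c: "\<gamma> \<in> cones C" "vertex C \<gamma> = z" using \<gamma> C.is_cone_cones C.vertex_eq by auto
  obtain d where d: "d \<in> Ob C" "iso_arr C (\<gamma> d)" using c(1) by (rule C.cone_iso)
  have "j \<cdot>\<^bsub>D\<^esub> \<delta> (tgt D j) = \<delta> (src D j)" if j: "j \<in> Incl D" for j
  proof -
    obtain i where i: "i \<in> Incl C" "i \<in> Ar C" "j = k i" using j by (rule InclE)
    then have "i \<cdot>\<^bsub>C\<^esub> \<gamma> (tgt C i) = \<gamma> (src C i)" using \<gamma> unfolding is_cone_def by blast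
    then show ?thesis using i c \<delta> k_cmp[of i "\<gamma> (tgt C i)"] by simp
  qed
  moreover have "\<delta> b \<in> Hom D b (h z)" if "b \<in> Ob D" for b
    using that c \<delta> by (auto elim!: ObE simp: Hom_def)
  moreover have "iso_arr D (\<delta> (h d))" using d c \<delta> iso_arr_k by simp
  ultimately show "is_cone D (h z) \<delta>"
    unfolding is_cone_def using c d by (auto simp: \<delta>_def)
qed

lemma normal_category_image: "normal_category D"
proof -
  interpret D: category D by (rule category_image)
  have Incl_Ar: "f \<in> Ar D" if "f \<in> Incl D" for f using that by (auto elim!: InclE)
  show ?thesis
  proof
    show "Incl D \<subseteq> Ar D" "strict_preorder (incl_cat D)" using Incl_Ar strict_preorder_image by auto
    show "mono_arr D j" if j: "j \<in> Incl D" for j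
    proof -
      obtain i where i: "i \<in> Incl C" "i \<in> Ar C" "j = k i" using j by (rule InclE)
      have "f = g" if fg: "f \<in> Ar D" "g \<in> Ar D" "tgt D f = src D j" "tgt D g = src D j"
        "f \<cdot>\<^bsub>D\<^esub> j = g \<cdot>\<^bsub>D\<^esub> j" for f g
      proof -
        obtain f' g' where f': "f' \<in> Ar C" "f = k f'" and g': "g' \<in> Ar C" "g = k g'"
          using fg(1,2) by (metis ArE)
        have t: "tgt C f' = src C i" "tgt C g' = src C i" using fg f' g' i by auto
        then have "k (f' \<cdot>\<^bsub>C\<^esub> i) = k (g' \<cdot>\<^bsub>C\<^esub> i)" using fg f' g' i by simp
        then have "f' \<cdot>\<^bsub>C\<^esub> i = g' \<cdot>\<^bsub>C\<^esub> i" using t f' g' i by (simp del: functor_cmp[OF is_functor])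
        then show ?thesis using C.Incl_mono[OF i(1)] f' g' t unfolding mono_arr_def by auto
      qed
      then show ?thesis unfolding mono_arr_def using j Incl_Ar by blast
    qed
    show "l \<in> Incl D"
      if fgl: "f \<in> Incl D" "g \<in> Incl D" "l \<in> Ar D" "tgt D l = src D g" "f = l \<cdot>\<^bsub>D\<^esub> g" for f g l
    proof -
      obtain f' where f': "f' \<in> Incl C" "f' \<in> Ar C" "f = k f'" using fgl(1) by (rule InclE)
      obtain g' where g': "g' \<in> Incl C" "g' \<in> Ar C" "g = k g'" using fgl(2) by (rule InclE)
      obtain l' where l': "l' \<in> Ar C" "l = k l'" using fgl(3) by (rule ArE)
      have t: "tgt C l' = src C g'" using fgl g' l' by simp
      then have "k f' = k (l' \<cdot>\<^bsub>C\<^esub> g')" using fgl f' g' l' by simp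
      then have "f' = l' \<cdot>\<^bsub>C\<^esub> g'" using t f' g' l' by (simp del: functor_cmp[OF is_functor])
      then show ?thesis using C.Incl_factor[of f' g' l'] t f' g' l' by simp
    qed
    have splits: "splits_by D (k i) (k q)" if "i \<in> Ar C" "splits_by C i q" for i q
      using that functor_cmp[OF is_functor, of i q] unfolding splits_by_def Hom_def by auto
    show "\<exists>q. splits_by D j q" if j: "j \<in> Incl D" for j
    proof -
      obtain i where i: "i \<in> Incl C" "i \<in> Ar C" "j = k i" using j by (rule InclE)
      then show ?thesis using C.Incl_splits[of i] splits by blast
    qed
    show "\<exists>q u j. normal_factorisation D f q u j" if f: "f \<in> Ar D" for f
    proof -
      obtain f' where f': "f' \<in> Ar C" "f = k f'" using f by (rule ArE)
      obtain q u j where nf: "normal_factorisation C f' q u j"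
        using C.normal_factorisation_ex f' by blast
      note nf' = nf[unfolded normal_factorisation_def]
      obtain i where i: "i \<in> Incl C" "splits_by C i q" using nf' unfolding retraction_def by blast
      then have q: "q \<in> Ar C" unfolding splits_by_def Hom_def by blast
      have "retraction D (k q)"
        unfolding retraction_def using i splits C.Incl_Ar k_Incl by blast
      moreover have "f = k q \<cdot>\<^bsub>D\<^esub> k u \<cdot>\<^bsub>D\<^esub> k j"
        using nf' q f' by simp
      ultimately have "normal_factorisation D f (k q) (k u) (k j)"
        unfolding normal_factorisation_def using nf' q iso_arr_k by auto
      then show ?thesis by blast
    qed
    show "\<exists>\<mu>. is_cone D b \<mu> \<and> \<mu> b = idn D b" if b: "b \<in> Ob D" for b
    proof -
      obtain c where c: "c \<in> Ob C" "b = h c" using b by (rule ObE)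
      then obtain \<mu> where "is_cone C c \<mu>" "\<mu> c = idn C c" using C.cone_ex by blast
      then show ?thesis using is_cone_image[of c \<mu>] c by auto
    qed
  qed
qed

end

sublocale normal_iso \<subseteq> D: normal_category D
  by (rule normal_category_image)

sublocale normal_iso \<subseteq> normal_functor C D H
  by unfold_locales (use scat_iso[unfolded scat_iso_def] in auto)

context normal_iso
begin

definition cone_map :: "('o \<Rightarrow> 'm) \<Rightarrow> 'p \<Rightarrow> 'n" where
  "cone_map = (\<lambda>\<gamma>\<in>cones C. \<lambda>b\<in>Ob D. k (\<gamma> (inv_into (Ob C) h b)))"

lemma cone_map:
  assumes "\<gamma> \<in> cones C"
  shows "cone_map \<gamma> \<in> cones D" "vertex D (cone_map \<gamma>) = h (vertex C \<gamma>)"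
    "c \<in> Ob C \<Longrightarrow> cone_map \<gamma> (h c) = k (\<gamma> c)"
proof -
  have *: "is_cone C (vertex C \<gamma>) \<gamma>" using assms C.cones_iff by blast
  note i = is_cone_image[OF *]
  show "cone_map \<gamma> \<in> cones D" "vertex D (cone_map \<gamma>) = h (vertex C \<gamma>)"
    using D.is_cone_cones[OF i(1)] D.vertex_eq[OF i(1)] assms by (simp_all add: cone_map_def)
  show "c \<in> Ob C \<Longrightarrow> cone_map \<gamma> (h c) = k (\<gamma> c)"
    using i(2) assms by (simp add: cone_map_def)
qed

lemma cone_map_mul:
  assumes \<gamma>: "\<gamma> \<in> cones C" "\<delta> \<in> cones C"
  shows "cone_map (\<gamma> \<odot>\<^bsub>cone_semigroup C\<^esub> \<delta>) = cone_map \<gamma> \<odot>\<^bsub>cone_semigroup D\<^esub> cone_map \<delta>"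
proof (rule D.cone_eqI)
  fix b assume "b \<in> Ob D"
  then obtain c where c: "c \<in> Ob C" "b = h c" by (rule ObE)
  have "cone_map (\<gamma> \<odot>\<^bsub>cone_semigroup C\<^esub> \<delta>) b = k (\<gamma> c \<cdot>\<^bsub>C\<^esub> epi_part C (\<delta> (vertex C \<gamma>)))"
    using c \<gamma> cone_map(3)[of "\<gamma> \<odot>\<^bsub>cone_semigroup C\<^esub> \<delta>" c] by simp
  also have "\<dots> = k (\<gamma> c) \<cdot>\<^bsub>D\<^esub> epi_part D (k (\<delta> (vertex C \<gamma>)))"
    using c \<gamma> by (simp add: map_epi_part)
  also have "\<dots> = (cone_map \<gamma> \<odot>\<^bsub>cone_semigroup D\<^esub> cone_map \<delta>) b"
    using c \<gamma> by (simp add: cone_map)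
  finally show "cone_map (\<gamma> \<odot>\<^bsub>cone_semigroup C\<^esub> \<delta>) b
    = (cone_map \<gamma> \<odot>\<^bsub>cone_semigroup D\<^esub> cone_map \<delta>) b" .
qed (use \<gamma> cone_map in auto)

lemma cone_map_surj:
  assumes \<delta>: "\<delta> \<in> cones D"
  obtains \<gamma> where "\<gamma> \<in> cones C" "cone_map \<gamma> = \<delta>"
proof -
  have "vertex D \<delta> \<in> Ob D" using \<delta> by simp
  then obtain z where z: "z \<in> Ob C" "vertex D \<delta> = h z" by (rule ObE)
  \<comment> \<open>The functor is bijective on each hom-set, so each component has exactly one
    preimage with these ends and \<open>SOME\<close> merely names it.\<close>
  define \<gamma> where "\<gamma> = (\<lambda>c\<in>Ob C. SOME f. f \<in> Ar C \<and> src C f = c \<and> tgt C f = z \<and> k f = \<delta> (h c))"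
  have \<gamma>: "\<gamma> c \<in> Ar C \<and> src C (\<gamma> c) = c \<and> tgt C (\<gamma> c) = z \<and> k (\<gamma> c) = \<delta> (h c)"
      if c: "c \<in> Ob C" for c
  proof -
    have "\<delta> (h c) \<in> Hom D (h c) (h z)" using c \<delta> z by (simp add: Hom_def)
    then have "\<exists>f. f \<in> Ar C \<and> src C f = c \<and> tgt C f = z \<and> k f = \<delta> (h c)"
      using c z by (metis HomE)
    from someI_ex[OF this] show ?thesis using c by (simp only: \<gamma>_def restrict_apply if_True)
  qed
  obtain d' where d': "d' \<in> Ob D" "iso_arr D (\<delta> d')" using \<delta> by (rule D.cone_iso)
  obtain d where d: "d \<in> Ob C" "d' = h d" using d'(1) by (rule ObE)
  have "is_cone C z \<gamma>"
  proof (rule C.is_coneI)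
    show "iso_arr C (\<gamma> d)" using \<gamma> d d' iso_arr_k by metis
    show "C.inc a b \<cdot>\<^bsub>C\<^esub> \<gamma> b = \<gamma> a" if ab: "C.le a b" for a b
    proof -
      have Ob: "a \<in> Ob C" "b \<in> Ob C" using C.le_Ob ab by auto
      have "k (C.inc a b \<cdot>\<^bsub>C\<^esub> \<gamma> b) = D.inc (h a) (h b) \<cdot>\<^bsub>D\<^esub> \<delta> (h b)"
        using ab Ob \<gamma> by (simp add: map_inc)
      also have "\<dots> = \<delta> (h a)" using D.cone_inc[OF \<delta> map_le[OF ab]] .
      also have "\<dots> = k (\<gamma> a)" using \<gamma> Ob by simp
      finally show ?thesis using Ob \<gamma> ab by (subst (asm) k_eq) auto
    qed
  qed (use z d \<gamma> in \<open>auto simp: \<gamma>_def\<close>)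
  then have c: "\<gamma> \<in> cones C" by (rule C.is_cone_cones)
  have "cone_map \<gamma> = \<delta>"
    using cone_map[OF c] \<delta> \<gamma> by (intro D.cone_eqI) (auto elim!: ObE)
  with c show thesis by (rule that)
qed

theorem cone_semigroup_iso: "isomorphic_semigroups (cone_semigroup C) (cone_semigroup D)"
  unfolding isomorphic_semigroups_def
proof (intro exI[of _ cone_map] conjI)
  show "semigroup_hom (cone_semigroup C) (cone_semigroup D) cone_map"
    unfolding semigroup_hom_def using cone_map(1) cone_map_mul by (auto simp: cone_map_def)
  have "inj_on cone_map (cones C)"
  proof (rule inj_onI)
    fix \<gamma> \<delta> assume *: "\<gamma> \<in> cones C" "\<delta> \<in> cones C" "cone_map \<gamma> = cone_map \<delta>"
    show "\<gamma> = \<delta>"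
    proof (rule C.cone_eqI)
      fix c assume c: "c \<in> Ob C"
      then have "k (\<gamma> c) = k (\<delta> c)" using * cone_map(3) by metis
      then show "\<gamma> c = \<delta> c" using c * by simp
    qed (use * in auto)
  qed
  then show "bij_betw cone_map (cones C) (cones D)"
    unfolding bij_betw_def using cone_map(1) cone_map_surj by blast
qed

end

section \<open>Recovering a normal category from its semigroup of cones\<close>

text \<open>The semigroup \<open>S\<close> is an arbitrary isomorphic copy of the semigroup of
  cones; its elements may be codes for cones instead of functions.\<close>

locale cone_coordinates = C: normal_category C + S: regular_sgrp S
  for C :: "('o, 'm, 'x) scat_scheme" and S :: "'a sgrp" +
  fixes \<eta> :: "('o \<Rightarrow> 'm) \<Rightarrow> 'a"
  assumes hom: "semigroup_hom (cone_semigroup C) S \<eta>"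
    and bij: "bij_betw \<eta> (cones C) (elems S)"
begin

lemma \<eta>_elems [simp]: "\<gamma> \<in> cones C \<Longrightarrow> \<eta> \<gamma> \<in> elems S"
  by (rule semigroup_hom_closed[OF hom])

lemma \<eta>_mul [simp]:
  "\<gamma> \<in> cones C \<Longrightarrow> \<delta> \<in> cones C \<Longrightarrow> \<eta> \<gamma> \<odot>\<^bsub>S\<^esub> \<eta> \<delta> = \<eta> (\<gamma> \<odot>\<^bsub>cone_semigroup C\<^esub> \<delta>)"
  using semigroup_hom_mul[OF hom] by simp

lemma \<eta>_eq [simp]: "\<gamma> \<in> cones C \<Longrightarrow> \<delta> \<in> cones C \<Longrightarrow> \<eta> \<gamma> = \<eta> \<delta> \<longleftrightarrow> \<gamma> = \<delta>"
  using bij unfolding bij_betw_def by (blast dest: inj_onD)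

lemma \<eta>E: assumes "x \<in> elems S" obtains \<gamma> where "\<gamma> \<in> cones C" "x = \<eta> \<gamma>"
  using assms bij unfolding bij_betw_def by blast

lemma \<eta>_idems: "\<gamma> \<in> cones C \<Longrightarrow> \<eta> \<gamma> \<in> idems S \<longleftrightarrow> \<gamma> \<in> idems (cone_semigroup C)"
  unfolding idems_def by auto

lemma \<eta>_left_ideal:
  assumes "\<gamma> \<in> cones C" "\<epsilon> \<in> idems (cone_semigroup C)"
  shows "\<eta> \<gamma> \<in> left_ideal S (\<eta> \<epsilon>) \<longleftrightarrow> C.le (vertex C \<gamma>) (vertex C \<epsilon>)"
  using assms S.left_ideal_iff[of "\<eta> \<epsilon>" "\<eta> \<gamma>"] C.cone_mul_idem_iff[of \<gamma> \<epsilon>] \<eta>_idems by simp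

text \<open>By \<open>\<eta>_left_ideal\<close>, the left ideal of an idempotent cone depends only
  on the vertex, so the choice made in \<open>unit_cone\<close> has no influence.\<close>

definition L :: "'o \<Rightarrow> 'a set" where
  "L c = left_ideal S (\<eta> (C.unit_cone c))"

lemma L_iff: "\<gamma> \<in> cones C \<Longrightarrow> c \<in> Ob C \<Longrightarrow> \<eta> \<gamma> \<in> L c \<longleftrightarrow> C.le (vertex C \<gamma>) c"
  by (simp add: L_def \<eta>_left_ideal)

lemma unit_idems [simp]: "c \<in> Ob C \<Longrightarrow> \<eta> (C.unit_cone c) \<in> idems S"
  by (simp add: \<eta>_idems)

lemma L_elems: "c \<in> Ob C \<Longrightarrow> x \<in> L c \<Longrightarrow> x \<in> elems S"
  by (simp add: L_def S.left_ideal_iff)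

lemma LE:
  assumes "x \<in> L c" "c \<in> Ob C"
  obtains \<gamma> where "\<gamma> \<in> cones C" "x = \<eta> \<gamma>" "C.le (vertex C \<gamma>) c"
  using assms by (metis \<eta>E L_iff L_elems)

lemma unit_in_L: "c \<in> Ob C \<Longrightarrow> \<eta> (C.unit_cone c) \<in> L c"
  by (simp add: L_iff)

lemma L_mul_unit: "c \<in> Ob C \<Longrightarrow> x \<in> L c \<Longrightarrow> x \<odot>\<^bsub>S\<^esub> \<eta> (C.unit_cone c) = x"
  by (simp add: L_def S.left_ideal_iff)

lemma L_subset_iff: "a \<in> Ob C \<Longrightarrow> b \<in> Ob C \<Longrightarrow> L a \<subseteq> L b \<longleftrightarrow> C.le a b"
proof
  assume "a \<in> Ob C" "b \<in> Ob C" "L a \<subseteq> L b"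
  then show "C.le a b" using unit_in_L[of a] L_iff[of "C.unit_cone a" b] by auto
next
  assume "a \<in> Ob C" "b \<in> Ob C" "C.le a b"
  then show "L a \<subseteq> L b" using C.le_trans by (auto elim!: LE simp: L_iff)
qed

lemma L_eq_iff: "a \<in> Ob C \<Longrightarrow> b \<in> Ob C \<Longrightarrow> L a = L b \<longleftrightarrow> a = b"
  using L_subset_iff[of a b] L_subset_iff[of b a] C.le_antisym by auto

lemma L_Ob: "Ob S.LC = L ` Ob C"
proof -
  have "left_ideal S (\<eta> \<epsilon>) = L (vertex C \<epsilon>)" if \<epsilon>: "\<epsilon> \<in> idems (cone_semigroup C)" for \<epsilon>
  proof -
    have "\<epsilon> \<in> cones C" using \<epsilon> by simp
    then have "x \<in> left_ideal S (\<eta> \<epsilon>) \<longleftrightarrow> x \<in> L (vertex C \<epsilon>)" if "x \<in> elems S" for x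
      using \<epsilon> that by (elim \<eta>E) (simp add: \<eta>_left_ideal L_iff)
    moreover have "x \<in> elems S" if "x \<in> left_ideal S (\<eta> \<epsilon>)" for x
      using that \<epsilon> \<eta>_idems S.left_ideal_iff by auto
    moreover have "x \<in> elems S" if "x \<in> L (vertex C \<epsilon>)" for x
      using that \<epsilon> L_elems[of "vertex C \<epsilon>"] by simp
    ultimately show ?thesis by blast
  qed
  moreover have "\<exists>\<epsilon>\<in>idems (cone_semigroup C). e = \<eta> \<epsilon>" if e: "e \<in> idems S" for e
  proof -
    obtain \<epsilon> where "\<epsilon> \<in> cones C" "e = \<eta> \<epsilon>" using S.idems_elems[OF e] by (rule \<eta>E)
    then show ?thesis using e \<eta>_idems by blast
  qed
  ultimately have 1: "\<exists>c\<in>Ob C. left_ideal S e = L c" if "e \<in> idems S" for e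
    using that C.vertex_Ob C.cone.idems_elems by metis
  have 2: "L c \<in> Ob S.LC" if "c \<in> Ob C" for c
    using unit_idems[OF that] unfolding L_def S.LC_Ob by blast
  show ?thesis
  proof
    show "Ob S.LC \<subseteq> L ` Ob C"
    proof
      fix A assume "A \<in> Ob S.LC"
      then show "A \<in> L ` Ob C" using 1 unfolding S.LC_Ob by fastforce
    qed
    show "L ` Ob C \<subseteq> Ob S.LC" using 2 by blast
  qed
qed

definition LA :: "'m \<Rightarrow> 'a lmap" where
  "LA f = (L (src C f), (\<lambda>x\<in>L (src C f). x \<odot>\<^bsub>S\<^esub> \<eta> (C.arrow_cone f)), L (tgt C f))"

lemma LA_Ar: assumes f: "f \<in> Ar C" shows "LA f \<in> Ar S.LC"
proof -
  let ?a = "src C f" and ?b = "tgt C f"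
  have "x \<odot>\<^bsub>S\<^esub> \<eta> (C.arrow_cone f) \<in> L ?b" if x: "x \<in> L ?a" for x
  proof -
    obtain \<gamma> where \<gamma>: "\<gamma> \<in> cones C" "x = \<eta> \<gamma>" using LE[OF x C.src_Ob[OF f]] by blast
    have "C.le (vertex C (\<gamma> \<odot>\<^bsub>cone_semigroup C\<^esub> C.arrow_cone f)) (vertex C (C.arrow_cone f))"
      using \<gamma> f by (intro C.vertex_cone_mul_le) auto
    then have "C.le (vertex C (\<gamma> \<odot>\<^bsub>cone_semigroup C\<^esub> C.arrow_cone f)) ?b"
      using C.le_trans C.epi_part_factor(3)[OF f] f by simp
    then show ?thesis using \<gamma> f by (simp add: L_iff)
  qed
  moreover have "L ?a \<in> Ob S.LC" "L ?b \<in> Ob S.LC" using f L_Ob by auto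
  ultimately show ?thesis
    using f S.LC_Ob_mul S.LC_Ob_elems unfolding LA_def S.LC_Ar_iff by (auto simp: S.mul_assoc)
qed

text \<open>The ideals recover source and target, and evaluation at the generator recovers the arrow
  cone.\<close>

lemma LA_inj: assumes "f \<in> Ar C" "g \<in> Ar C" "LA f = LA g" shows "f = g"
proof -
  have st: "src C f = src C g" "tgt C f = tgt C g" using assms L_eq_iff by (auto simp: LA_def)
  let ?e = "\<eta> (C.unit_cone (src C f))"
  have "fst (snd (LA f)) ?e = fst (snd (LA g)) ?e" using assms by simp
  then have "?e \<odot>\<^bsub>S\<^esub> \<eta> (C.arrow_cone f) = ?e \<odot>\<^bsub>S\<^esub> \<eta> (C.arrow_cone g)"
    using st unit_in_L[OF C.src_Ob[OF assms(1)]] by (simp add: LA_def)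
  then have "C.arrow_cone f = C.arrow_cone g"
    using assms st C.unit_cone_arrow_cone[of f "src C f"] C.unit_cone_arrow_cone[of g "src C f"]
      by simp
  then show ?thesis using assms st by (intro C.arrow_cone_inj)
qed

text \<open>The image of the generator of \<open>L a\<close> is a cone fixed by
  \<open>unit_cone a\<close> on the left and with vertex below \<open>b\<close>. By
  \<open>arrow_coneE\<close> such cones are exactly arrow cones of arrows from \<open>a\<close> to
  \<open>b\<close>.\<close>

lemma LA_surj: assumes "m \<in> Ar S.LC" shows "m \<in> LA ` Ar C"
proof -
  obtain A \<phi> B where m: "m = (A, \<phi>, B)" by (cases m)
  then have "A \<in> Ob S.LC" "B \<in> Ob S.LC" and \<phi>: "\<phi> \<in> A \<rightarrow>\<^sub>E B"
    "\<And>x y. x \<in> elems S \<Longrightarrow> y \<in> A \<Longrightarrow> \<phi> (x \<odot>\<^bsub>S\<^esub> y) = x \<odot>\<^bsub>S\<^esub> \<phi> y"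
    using assms unfolding m S.LC_Ar_iff by blast+
  then obtain a b where ab: "a \<in> Ob C" "A = L a" "b \<in> Ob C" "B = L b" using L_Ob by auto
  let ?e = "\<eta> (C.unit_cone a)"
  have eA: "?e \<in> A" "?e \<in> elems S" using ab unit_in_L by auto
  have "\<phi> ?e \<in> L b" using eA \<phi>(1) ab by auto
  then obtain \<gamma> where \<gamma>: "\<gamma> \<in> cones C" "\<phi> ?e = \<eta> \<gamma>" "C.le (vertex C \<gamma>) b" using ab(3) by (rule LE)
  have "?e \<odot>\<^bsub>S\<^esub> \<eta> \<gamma> = \<eta> \<gamma>" using \<phi>(2)[OF eA(2,1)] \<gamma> ab by simp
  then have "C.unit_cone a \<odot>\<^bsub>cone_semigroup C\<^esub> \<gamma> = \<gamma>" using ab \<gamma> by simp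
  then obtain f where f: "f \<in> Ar C" "src C f = a" "tgt C f = b" "\<gamma> = C.arrow_cone f"
    using \<gamma> ab C.arrow_coneE by metis
  have "\<phi> x = x \<odot>\<^bsub>S\<^esub> \<eta> \<gamma>" if "x \<in> A" for x
    using \<phi>(2)[of x ?e] that eA ab L_elems L_mul_unit \<gamma> by simp
  then have "\<phi> = (\<lambda>x\<in>A. x \<odot>\<^bsub>S\<^esub> \<eta> \<gamma>)" using \<phi>(1) by (auto simp: fun_eq_iff PiE_iff extensional_def)
  then have "m = LA f" using m ab f by (simp add: LA_def)
  with f show ?thesis by blast
qed

lemma LA_inc: assumes "C.le a b" shows "LA (C.inc a b) = (L a, (\<lambda>x\<in>L a. x), L b)"
  using assms L_mul_unit[OF C.le_Ob(1)[OF assms]]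
  by (auto simp: LA_def C.arrow_cone_inc intro!: restrict_ext)

theorem scat_iso_LC: "scat_iso C S.LC (restrict L (Ob C), restrict LA (Ar C))"
  unfolding scat_iso_def
proof (intro conjI)
  show "is_functor C S.LC (restrict L (Ob C), restrict LA (Ar C))"
    unfolding is_functor_def
  proof (intro conjI ballI impI)
    show "fst (restrict L (Ob C), restrict LA (Ar C)) \<in> Ob C \<rightarrow>\<^sub>E Ob S.LC" using L_Ob by auto
    show "snd (restrict L (Ob C), restrict LA (Ar C)) \<in> Ar C \<rightarrow>\<^sub>E Ar S.LC" using LA_Ar by auto
  next
    fix a assume "a \<in> Ob C"
    then show "snd (restrict L (Ob C), restrict LA (Ar C)) (idn C a)
        = idn S.LC (fst (restrict L (Ob C), restrict LA (Ar C)) a)"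
      using LA_inc[of a a] by simp
  next
    fix f g assume fg: "f \<in> Ar C" "g \<in> Ar C" "tgt C f = src C g"
    have "x \<odot>\<^bsub>S\<^esub> \<eta> (C.arrow_cone f) \<in> L (tgt C f)" if "x \<in> L (src C f)" for x
      using LA_Ar[OF fg(1)] that by (auto simp: LA_def S.LC_Ar_iff)
    then show "snd (restrict L (Ob C), restrict LA (Ar C)) (f \<cdot>\<^bsub>C\<^esub> g)
      = cmp S.LC (snd (restrict L (Ob C), restrict LA (Ar C)) f) (snd (restrict L (Ob C), restrict
          LA (Ar C)) g)"
      using fg L_elems[OF C.src_Ob[OF fg(1)]]
      by (auto simp: LA_def compose_def C.arrow_cone_cmp S.mul_assoc simp flip: \<eta>_mul intro!:
        restrict_ext)
  qed (auto simp: LA_def)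
  show "bij_betw (fst (restrict L (Ob C), restrict LA (Ar C))) (Ob C) (Ob S.LC)"
    unfolding bij_betw_def using L_Ob L_eq_iff by (auto simp: inj_on_def)
  show "bij_betw (snd (restrict L (Ob C), restrict LA (Ar C))) (Ar C) (Ar S.LC)"
    unfolding bij_betw_def using LA_Ar LA_surj LA_inj by (auto simp: inj_on_def)
  have "LA f \<in> Incl S.LC" if "f \<in> Incl C" for f
  proof -
    have le: "C.le (src C f) (tgt C f)" "f = C.inc (src C f) (tgt C f)"
      using that C.leI C.inc_src_tgt by auto
    show ?thesis
      using LA_inc[OF le(1)] le that L_subset_iff[of "src C f" "tgt C f"] L_Ob
      by (auto simp: S.LC_Incl_iff)
  qed
  moreover have "m \<in> LA ` Incl C" if incl: "m \<in> Incl S.LC" for m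
  proof -
    obtain A \<phi> B where m: "m = (A, \<phi>, B)" by (cases m)
    then obtain a b where ab: "a \<in> Ob C" "A = L a" "b \<in> Ob C" "B = L b" "A \<subseteq> B" "\<phi> = (\<lambda>x\<in>A. x)"
      using incl L_Ob by (auto simp: S.LC_Incl_iff)
    then have "C.le a b" using L_subset_iff by auto
    then have "m = LA (C.inc a b)" "C.inc a b \<in> Incl C" using m ab LA_inc by auto
    then show ?thesis by blast
  qed
  ultimately show "snd (restrict L (Ob C), restrict LA (Ar C)) ` Incl C = Incl S.LC"
    by (auto simp: image_iff)
qed

text \<open>The isomorphism from \<open>C\<close> to the left ideal category of \<open>S\<close>
  induces one between their semigroups of cones, and \<open>S\<close> is a copy of the first of
  these.\<close>

theorem totally_left_reductive: "totally_left_reductive S"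
proof -
  interpret normal_iso C S.LC "(restrict L (Ob C), restrict LA (Ar C))"
    by unfold_locales (rule scat_iso_LC)
  have "isomorphic_semigroups (cone_semigroup C) S"
    unfolding isomorphic_semigroups_def using hom bij by blast
  then have "isomorphic_semigroups S (cone_semigroup C)"
    by (rule isomorphic_semigroups_sym) (rule C.cone.mul_closed)
  then show ?thesis
    unfolding totally_left_reductive_def
    using cone_semigroup_iso isomorphic_semigroups_trans S.regular_semigroup S.mul_closed by blast
qed

end

section \<open>CC-morphisms and semigroup homomorphisms\<close>

context normal_category
begin

abbreviation R where "R \<gamma> \<equiv> R_class (cone_semigroup C) \<gamma>"

lemma connected_toI:
  "\<epsilon> \<in> idems (cone_semigroup C) \<Longrightarrow> vertex C \<epsilon> = c \<Longrightarrow> \<epsilon> \<in> d \<Longrightarrow> connected_to C c d"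
  unfolding connected_to_def by blast

lemma conn_idem_eq:
  assumes "\<epsilon> \<in> idems (cone_semigroup C)" "\<epsilon> \<in> d" "d \<in> all_R C" "vertex C \<epsilon> = c"
  shows "conn_idem C c d = \<epsilon>"
  unfolding conn_idem_def
proof (rule the_equality)
  fix \<delta> assume \<delta>: "\<delta> \<in> d \<and> \<delta> \<in> idems (cone_semigroup C) \<and> vertex C \<delta> = c"
  then have "\<delta> \<in> R \<epsilon>" using assms cone.R_class_eq by metis
  then have "cone.rle \<delta> \<epsilon>" using cone.in_R_class_iff assms(1) by simp
  then show "\<delta> = \<epsilon>" using R_idem_unique[of \<epsilon> \<delta>] assms \<delta> by simp
qed (use assms in simp)

lemma connected_toE:
  assumes "connected_to C c d" "d \<in> all_R C"
  obtains "conn_idem C c d \<in> d" "conn_idem C c d \<in> idems (cone_semigroup C)"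
    "vertex C (conn_idem C c d) = c" "R (conn_idem C c d) = d" "c \<in> Ob C"
proof -
  obtain \<epsilon> where \<epsilon>: "\<epsilon> \<in> d" "\<epsilon> \<in> idems (cone_semigroup C)" "vertex C \<epsilon> = c"
    using assms(1) unfolding connected_to_def by blast
  then have "conn_idem C c d = \<epsilon>" using conn_idem_eq assms(2) by blast
  moreover have "R \<epsilon> = d" using cone.R_class_eq assms(2) \<epsilon>(1) by blast
  moreover have "c \<in> Ob C" using \<epsilon> vertex_Ob cone.idems_elems by blast
  ultimately show thesis using that \<epsilon> by simp
qed

lemma connected_category_all_R: "connected_category C (all_R C)"
proof -
  have "\<exists>d\<in>all_R C. connected_to C c d" if "c \<in> Ob C" for c
    using that connected_toI[of "unit_cone c" c "R (unit_cone c)"] cone.R_class_self[of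
      "unit_cone c"]
      cone.R_class_in[of "unit_cone c"] by auto
  then show ?thesis
    unfolding connected_category_def
    using cone.downset_R_classes normal_category_axioms by blast
qed

end

section \<open>The homomorphism induced by a CC-morphism, and faithfulness\<close>

definition cc_hom ::
  "('o, 'm, 'x) scat_scheme \<Rightarrow> ('o, 'm, 'p, 'n) ccm \<Rightarrow> ('o \<Rightarrow> 'm) \<Rightarrow> ('p \<Rightarrow> 'n)" where
  "cc_hom C FG = (\<lambda>\<gamma>\<in>cones C. THE \<delta>. \<delta> \<in> snd FG (R_class (cone_semigroup C) \<gamma>) \<and>
    (\<forall>c\<in>Ob C. \<delta> (fst (fst FG) c) = snd (fst FG) (\<gamma> c)))"

locale cc_map = C: normal_category C + D: normal_category D
  for C :: "('o, 'm, 'x) scat_scheme" and D :: "('p, 'n, 'y) scat_scheme"  +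
  fixes FG :: "('o, 'm, 'p, 'n) ccm"
  assumes cc: "cc_morphism C (all_R C) D (all_R D) FG"

sublocale cc_map \<subseteq> normal_functor C D "fst FG"
  by unfold_locales (use cc in \<open>auto simp: cc_morphism_def\<close>)

context cc_map
begin

abbreviation F0 where "F0 \<equiv> fst (fst FG)"
abbreviation F1 where "F1 \<equiv> snd (fst FG)"
abbreviation G where "G \<equiv> snd FG"

lemma G_closed: "d \<in> all_R C \<Longrightarrow> G d \<in> all_R D"
  using cc unfolding cc_morphism_def by (auto simp: PiE_iff)

lemma G_mono:
  assumes "\<gamma> \<in> cones C" "\<delta> \<in> cones C" "C.cone.rle \<gamma> \<delta>" "x \<in> G (C.R \<gamma>)" "y \<in> G (C.R \<delta>)"
  shows "D.cone.rle x y"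
proof -
  have cl: "G (C.R \<gamma>) \<in> all_R D" "G (C.R \<delta>) \<in> all_R D" using assms by (auto intro: G_closed)
  have "R_le (cone_semigroup C) (C.R \<gamma>) (C.R \<delta>)" using C.cone.R_le_iff assms by blast
  then have "R_le (cone_semigroup D) (G (C.R \<gamma>)) (G (C.R \<delta>))"
    using cc assms unfolding cc_morphism_def by (auto split: prod.splits)
  then have "R_le (cone_semigroup D) (D.R x) (D.R y)"
    using D.cone.R_class_eq cl assms by simp
  then show ?thesis using D.cone.R_le_iff D.cone.R_classes_elems cl assms by blast
qed

lemma conn_cond:
  assumes "d \<in> all_R C" "connected_to C c d"
  shows "connected_to D (F0 c) (G d)"
    "c' \<in> Ob C \<Longrightarrow> F1 (conn_idem C c d c') = conn_idem D (F0 c) (G d) (F0 c')"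
proof -
  have "c \<in> Ob C" using C.connected_toE[OF assms(2,1)] by blast
  then show "connected_to D (F0 c) (G d)"
    "c' \<in> Ob C \<Longrightarrow> F1 (conn_idem C c d c') = conn_idem D (F0 c) (G d) (F0 c')"
    using cc assms unfolding cc_morphism_def by (auto split: prod.splits)
qed

text \<open>The CC condition restated for cones: \<open>\<epsilon>\<close> is the idempotent
  connecting its vertex to its class, and its image is the connecting idempotent on the other
  side.\<close>

lemma idem_image:
  assumes \<epsilon>: "\<epsilon> \<in> idems (cone_semigroup C)" "\<epsilon> \<in> C.R \<gamma>" "\<gamma> \<in> cones C"
  obtains \<epsilon>' where "\<epsilon>' \<in> idems (cone_semigroup D)" "\<epsilon>' \<in> G (C.R \<gamma>)" "vertex D \<epsilon>' = F0 (vertex C \<epsilon>)"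
    "\<And>c. c \<in> Ob C \<Longrightarrow> \<epsilon>' (F0 c) = F1 (\<epsilon> c)"
proof -
  let ?d = "C.R \<gamma>" and ?c = "vertex C \<epsilon>"
  have d: "?d \<in> all_R C" using \<epsilon> by simp
  have con: "connected_to C ?c ?d" using \<epsilon> by (intro C.connected_toI) auto
  have "conn_idem C ?c ?d = \<epsilon>" using \<epsilon> d by (intro C.conn_idem_eq) auto
  then show thesis
    using that[of "conn_idem D (F0 ?c) (G ?d)"] conn_cond[OF d con]
      D.connected_toE[OF conn_cond(1)[OF d con] G_closed[OF d]] by metis
qed

text \<open>An idempotent of \<open>C.R \<gamma>\<close> has an image in
  \<open>G (C.R \<gamma>)\<close> whose vertex lies in the range of \<open>F0\<close>. Both cones
  lie below this image, so agreement at that single object already forces equality.\<close>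

lemma below_unique:
  assumes "\<gamma> \<in> cones C" "y \<in> G (C.R \<gamma>)" "D.cone.rle \<delta> y" "D.cone.rle \<delta>' y"
    "\<delta> \<in> cones D" "\<delta>' \<in> cones D" "\<And>c. c \<in> Ob C \<Longrightarrow> \<delta> (F0 c) = \<delta>' (F0 c)"
  shows "\<delta> = \<delta>'"
proof -
  obtain \<epsilon> where \<epsilon>: "\<epsilon> \<in> idems (cone_semigroup C)" "\<epsilon> \<in> C.R \<gamma>"
    using C.cone.R_class_idem[OF assms(1)] by blast
  obtain \<epsilon>' where \<epsilon>': "\<epsilon>' \<in> idems (cone_semigroup D)" "\<epsilon>' \<in> G (C.R \<gamma>)"
      "vertex D \<epsilon>' = F0 (vertex C \<epsilon>)"
    using idem_image[OF \<epsilon> assms(1)] by metis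
  have "D.cone.rle y \<epsilon>'"
    using G_mono[OF assms(1,1) C.cone.rle_refl[OF assms(1)] assms(2) \<epsilon>'(2)] .
  then have "D.cone.rle \<delta> \<epsilon>'" "D.cone.rle \<delta>' \<epsilon>'"
    using assms \<epsilon>' D.cone.rle_trans by simp_all
  then show ?thesis using D.cone_eq_below_idem[OF \<epsilon>'(1), of \<delta> \<delta>'] assms \<epsilon>'(3) \<epsilon>(1) by simp
qed

lemma cc_hom_unique:
  assumes "\<gamma> \<in> cones C" "\<delta> \<in> G (C.R \<gamma>)" "\<delta>' \<in> G (C.R \<gamma>)"
    "\<And>c. c \<in> Ob C \<Longrightarrow> \<delta> (F0 c) = F1 (\<gamma> c)" "\<And>c. c \<in> Ob C \<Longrightarrow> \<delta>' (F0 c) = F1 (\<gamma> c)"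
  shows "\<delta> = \<delta>'"
proof (rule below_unique[OF assms(1,2)])
  have "G (C.R \<gamma>) \<in> all_R D" using assms(1) by (simp add: G_closed)
  then show *: "\<delta> \<in> cones D" "\<delta>' \<in> cones D" using assms D.cone.R_classes_elems by blast+
  show "D.cone.rle \<delta> \<delta>" using * D.cone.rle_refl by simp
  show "D.cone.rle \<delta>' \<delta>" using G_mono[OF assms(1,1) C.cone.rle_refl[OF assms(1)] assms(3,2)] .
qed (use assms in simp)

text \<open>Inside its class, \<open>\<gamma>\<close> is an idempotent \<open>\<epsilon>\<close>
  extended by an isomorphism \<open>?u\<close>. The required cone is the image
  \<open>\<epsilon>'\<close> of this idempotent extended by \<open>F1 ?u\<close>.\<close>

lemma cc_hom_ex:
  assumes \<gamma>: "\<gamma> \<in> cones C"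
  shows "\<exists>\<delta>. \<delta> \<in> G (C.R \<gamma>) \<and> (\<forall>c\<in>Ob C. \<delta> (F0 c) = F1 (\<gamma> c))"
proof -
  obtain \<epsilon> where \<epsilon>: "\<epsilon> \<in> idems (cone_semigroup C)" "\<epsilon> \<in> C.R \<gamma>"
    using C.cone.R_class_idem[OF \<gamma>] by blast
  obtain \<epsilon>' where \<epsilon>': "\<epsilon>' \<in> idems (cone_semigroup D)" "\<epsilon>' \<in> G (C.R \<gamma>)"
      "vertex D \<epsilon>' = F0 (vertex C \<epsilon>)"
    "\<And>c. c \<in> Ob C \<Longrightarrow> \<epsilon>' (F0 c) = F1 (\<epsilon> c)"
    using idem_image[OF \<epsilon> \<gamma>] by metis
  let ?u = "\<gamma> (vertex C \<epsilon>)"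
  have rle: "C.cone.rle \<gamma> \<epsilon>" "C.cone.rle \<epsilon> \<gamma>" using \<epsilon> \<gamma> C.cone.in_R_class_iff by auto
  have z: "vertex C \<epsilon> \<in> Ob C" using \<epsilon> by simp
  have iso: "iso_arr C ?u" by (rule C.cone_R_idem_iso[OF \<epsilon>(1) \<gamma> rle])
  have ext: "\<gamma> c = \<epsilon> c \<cdot>\<^bsub>C\<^esub> ?u" if "c \<in> Ob C" for c
    using C.cone_below_idem(2)[OF \<epsilon>(1) \<gamma> rle(1)] C.cone_ext_apply that by metis
  have isoF: "iso_arr D (F1 ?u)" using iso by (rule map_iso)
  have u: "F1 ?u \<in> Ar D" "src D (F1 ?u) = vertex D \<epsilon>'" "D.split_epi (F1 ?u)"
    using isoF \<epsilon>' \<gamma> z D.iso_split_epi by auto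
  define \<delta> where "\<delta> = cone_ext D \<epsilon>' (F1 ?u)"
  have \<delta>: "\<delta> \<in> cones D" "vertex D \<delta> = tgt D (F1 ?u)" using u \<epsilon>' by (auto simp: \<delta>_def)
  obtain v where v: "v \<in> Ar D" "src D v = tgt D (F1 ?u)" "tgt D v = src D (F1 ?u)"
    "F1 ?u \<cdot>\<^bsub>D\<^esub> v = idn D (src D (F1 ?u))" "v \<cdot>\<^bsub>D\<^esub> F1 ?u = idn D (tgt D (F1 ?u))"
    using isoF by (rule D.iso_arrE)
  have ve: "D.split_epi v" using v u by (intro D.split_epiI[of v "F1 ?u"]) auto
  \<comment> \<open>Extending back by the inverse of \<open>F1 ?u\<close> gives the reverse
    inequality, so \<open>\<delta>\<close> stays in the \<open>\<R>\<close>-class of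
    \<open>\<epsilon>'\<close>.\<close>
  have "cone_ext D \<delta> v = \<epsilon>'"
  proof (rule D.cone_eqI)
    fix b assume b: "b \<in> Ob D"
    have e: "\<epsilon>' b \<in> Ar D" "tgt D (\<epsilon>' b) = vertex D \<epsilon>'" using b \<epsilon>' by auto
    have "\<epsilon>' b \<cdot>\<^bsub>D\<^esub> F1 ?u \<cdot>\<^bsub>D\<^esub> v = \<epsilon>' b \<cdot>\<^bsub>D\<^esub> (F1 ?u \<cdot>\<^bsub>D\<^esub> v)"
      by (rule D.assoc) (use e u v in auto)
    then show "cone_ext D \<delta> v b = \<epsilon>' b" using b e u v(4) by (simp add: \<delta>_def)
  qed (use \<delta> \<epsilon>' v ve in auto)
  then have "D.cone.rle \<epsilon>' \<delta>" using D.rle_cone_ext[OF \<delta>(1) ve] \<delta> v by simp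
  moreover have "D.cone.rle \<delta> \<epsilon>'" unfolding \<delta>_def using \<epsilon>' u by (intro D.rle_cone_ext) auto
  ultimately have "\<delta> \<in> D.R \<epsilon>'" using \<delta> \<epsilon>' D.cone.in_R_class_iff[of \<epsilon>' \<delta>] by simp
  moreover have "D.R \<epsilon>' = G (C.R \<gamma>)" using D.cone.R_class_eq G_closed \<epsilon>' \<gamma> by simp
  ultimately have "\<delta> \<in> G (C.R \<gamma>)" by simp
  moreover have "\<delta> (F0 c) = F1 (\<gamma> c)" if "c \<in> Ob C" for c
  proof -
    have "\<delta> (F0 c) = F1 (\<epsilon> c) \<cdot>\<^bsub>D\<^esub> F1 ?u" using that \<epsilon>'(4) by (simp add: \<delta>_def)
    also have "\<dots> = F1 (\<epsilon> c \<cdot>\<^bsub>C\<^esub> ?u)"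
      using that \<epsilon> \<gamma> by (intro functor_cmp[OF is_functor, symmetric]) auto
    finally show ?thesis using ext[OF that] by simp
  qed
  ultimately show ?thesis by blast
qed

lemma cc_hom:
  assumes \<gamma>: "\<gamma> \<in> cones C"
  shows cc_hom_class: "cc_hom C FG \<gamma> \<in> G (C.R \<gamma>)"
    and cc_hom_apply: "c \<in> Ob C \<Longrightarrow> cc_hom C FG \<gamma> (F0 c) = F1 (\<gamma> c)"
    and cc_hom_cones: "cc_hom C FG \<gamma> \<in> cones D"
    and cc_hom_vertex: "vertex D (cc_hom C FG \<gamma>) = F0 (vertex C \<gamma>)"
proof -
  obtain \<delta> where \<delta>: "\<delta> \<in> G (C.R \<gamma>)" "\<forall>c\<in>Ob C. \<delta> (F0 c) = F1 (\<gamma> c)" using cc_hom_ex[OF \<gamma>] by blast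
  then have "cc_hom C FG \<gamma> = \<delta>"
    using cc_hom_unique[OF \<gamma>] \<gamma> unfolding cc_hom_def by (auto intro!: the_equality)
  with \<delta> show 1: "cc_hom C FG \<gamma> \<in> G (C.R \<gamma>)"
    and 2: "c \<in> Ob C \<Longrightarrow> cc_hom C FG \<gamma> (F0 c) = F1 (\<gamma> c)" for c by auto
  have "G (C.R \<gamma>) \<in> all_R D" using \<gamma> by (simp add: G_closed)
  then show 3: "cc_hom C FG \<gamma> \<in> cones D" using 1 D.cone.R_classes_elems by blast
  have "tgt D (cc_hom C FG \<gamma> (F0 (vertex C \<gamma>))) = F0 (vertex C \<gamma>)"
    using 2[of "vertex C \<gamma>"] \<gamma> by simp
  then show "vertex D (cc_hom C FG \<gamma>) = F0 (vertex C \<gamma>)" using 3 \<gamma> by simp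
qed

lemma cc_hom_eqI:
  assumes "\<gamma> \<in> cones C" "\<delta> \<in> G (C.R \<gamma>)" "\<And>c. c \<in> Ob C \<Longrightarrow> \<delta> (F0 c) = F1 (\<gamma> c)"
  shows "cc_hom C FG \<gamma> = \<delta>"
  using cc_hom_unique[OF assms(1) cc_hom_class[OF assms(1)] assms(2)] cc_hom_apply[OF assms(1)]
    assms(3)
  by simp

text \<open>Both sides lie \<open>\<R>\<close>-below \<open>cc_hom C FG \<gamma>\<close>, so by
  \<open>below_unique\<close> they need comparing only at objects \<open>F0 c\<close>; there the
  functor laws and \<open>map_epi_part\<close> decide.\<close>

lemma cc_hom_mul:
  assumes \<gamma>: "\<gamma> \<in> cones C" and \<delta>: "\<delta> \<in> cones C"
  shows "cc_hom C FG (\<gamma> \<odot>\<^bsub>cone_semigroup C\<^esub> \<delta>)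
    = cc_hom C FG \<gamma> \<odot>\<^bsub>cone_semigroup D\<^esub> cc_hom C FG \<delta>"
proof (rule below_unique[OF \<gamma> cc_hom_class[OF \<gamma>]])
  let ?\<gamma>\<delta> = "\<gamma> \<odot>\<^bsub>cone_semigroup C\<^esub> \<delta>"
  have \<gamma>\<delta>: "?\<gamma>\<delta> \<in> cones C" using \<gamma> \<delta> by simp
  show "D.cone.rle (cc_hom C FG ?\<gamma>\<delta>) (cc_hom C FG \<gamma>)"
    using G_mono[OF \<gamma>\<delta> \<gamma> C.cone.rle_mul[OF \<gamma> \<delta>] cc_hom_class[OF \<gamma>\<delta>] cc_hom_class[OF \<gamma>]] .
  show "D.cone.rle (cc_hom C FG \<gamma> \<odot>\<^bsub>cone_semigroup D\<^esub> cc_hom C FG \<delta>) (cc_hom C FG \<gamma>)"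
    using cc_hom_cones \<gamma> \<delta> by (intro D.cone.rle_mul) auto
  show "cc_hom C FG ?\<gamma>\<delta> \<in> cones D" "cc_hom C FG \<gamma> \<odot>\<^bsub>cone_semigroup D\<^esub> cc_hom C FG \<delta> \<in> cones D"
    using cc_hom_cones \<gamma> \<delta> \<gamma>\<delta> by auto
  fix c assume c: "c \<in> Ob C"
  have "(cc_hom C FG \<gamma> \<odot>\<^bsub>cone_semigroup D\<^esub> cc_hom C FG \<delta>) (F0 c)
      = F1 (\<gamma> c) \<cdot>\<^bsub>D\<^esub> epi_part D (F1 (\<delta> (vertex C \<gamma>)))"
    using c \<gamma> \<delta> D.cone_mul_apply[OF cc_hom_cones[OF \<gamma>] cc_hom_cones[OF \<delta>], of "F0 c"]
    by (simp add: cc_hom_apply cc_hom_vertex)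
  also have "\<dots> = F1 (\<gamma> c \<cdot>\<^bsub>C\<^esub> epi_part C (\<delta> (vertex C \<gamma>)))"
    using c \<gamma> \<delta> by (simp add: map_epi_part)
  also have "\<dots> = cc_hom C FG ?\<gamma>\<delta> (F0 c)"
    using c \<gamma> \<delta> cc_hom_apply[OF \<gamma>\<delta> c] by simp
  finally show "cc_hom C FG ?\<gamma>\<delta> (F0 c)
      = (cc_hom C FG \<gamma> \<odot>\<^bsub>cone_semigroup D\<^esub> cc_hom C FG \<delta>) (F0 c)" ..
qed

theorem cc_hom_semigroup_hom: "semigroup_hom (cone_semigroup C) (cone_semigroup D) (cc_hom C FG)"
  unfolding semigroup_hom_def using cc_hom_cones cc_hom_mul by (auto simp: cc_hom_def)

text \<open>This and the two lemmas after it express all three parts of \<open>FG\<close> through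
  \<open>cc_hom C FG\<close>, which is how faithfulness is obtained.\<close>

lemma G_eq: assumes "\<gamma> \<in> cones C" shows "G (C.R \<gamma>) = D.R (cc_hom C FG \<gamma>)"
  using D.cone.R_class_eq[OF _ cc_hom_class[OF assms]] G_closed assms by simp

lemma F0_eq: "c \<in> Ob C \<Longrightarrow> F0 c = vertex D (cc_hom C FG (C.unit_cone c))"
  by (simp add: cc_hom_vertex)

text \<open>At the source of \<open>f\<close>, the arrow cone has the epimorphic part of
  \<open>f\<close>; its image is completed by the image of the inclusion part.\<close>

lemma F1_eq:
  assumes f: "f \<in> Ar C"
  shows "F1 f = cc_hom C FG (C.arrow_cone f) (F0 (src C f)) \<cdot>\<^bsub>D\<^esub>
    D.inc (F0 (tgt C (epi_part C f))) (F0 (tgt C f))"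
proof -
  note e = C.epi_part_factor[OF f]
  have "F1 f = F1 (epi_part C f \<cdot>\<^bsub>C\<^esub> C.inc (tgt C (epi_part C f)) (tgt C f))" unfolding e(4) ..
  also have "\<dots> = F1 (epi_part C f) \<cdot>\<^bsub>D\<^esub> F1 (C.inc (tgt C (epi_part C f)) (tgt C f))"
    using e f by (intro functor_cmp[OF is_functor]) auto
  finally show ?thesis using f e by (simp add: cc_hom_apply map_inc)
qed

end

lemma cc_hom_faithful:
  assumes "normal_category C" "normal_category D"
    and FG: "cc_morphism C (all_R C) D (all_R D) FG" "cc_morphism C (all_R C) D (all_R D) FG'"
    and eq: "cc_hom C FG = cc_hom C FG'"
  shows "FG = FG'"
proof -
  interpret C: normal_category C by fact
  interpret D: normal_category D by fact
  interpret A: cc_map C D FG by unfold_locales fact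
  interpret B: cc_map C D FG' by unfold_locales fact
  have ext: "fst (fst X) \<in> extensional (Ob C)" "snd (fst X) \<in> extensional (Ar C)"
    "snd X \<in> extensional (all_R C)" if "cc_morphism C (all_R C) D (all_R D) X" for X
    using that by (auto simp: cc_morphism_def is_functor_def PiE_iff split: prod.splits)
  have F0: "A.F0 = B.F0"
    by (rule extensionalityI[OF ext(1)[OF FG(1)] ext(1)[OF FG(2)]])
      (simp only: A.F0_eq B.F0_eq eq)
  moreover have "A.F1 = B.F1"
    by (rule extensionalityI[OF ext(2)[OF FG(1)] ext(2)[OF FG(2)]])
      (simp only: A.F1_eq B.F1_eq eq F0)
  moreover have "A.G = B.G"
  proof (rule extensionalityI[OF ext(3)[OF FG(1)] ext(3)[OF FG(2)]])
    fix d assume "d \<in> all_R C"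
    then obtain \<gamma> where "\<gamma> \<in> cones C" "d = C.R \<gamma>" by (rule C.cone.R_classesE)
    then show "A.G d = B.G d" using A.G_eq B.G_eq eq by simp
  qed
  ultimately show ?thesis by (simp add: prod_eq_iff)
qed

section \<open>The CC-morphism induced by a homomorphism, and fullness\<close>

locale cone_hom = C: normal_category C + D: normal_category D
  for C :: "('o, 'm, 'x) scat_scheme" and D :: "('p, 'n, 'y) scat_scheme"  +
  fixes \<phi> :: "('o \<Rightarrow> 'm) \<Rightarrow> ('p \<Rightarrow> 'n)"
  assumes hom: "semigroup_hom (cone_semigroup C) (cone_semigroup D) \<phi>"
begin

lemma \<phi>_cones [simp]: "\<gamma> \<in> cones C \<Longrightarrow> \<phi> \<gamma> \<in> cones D"
  by (rule semigroup_hom_closed[OF hom])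

lemma \<phi>_mul:
  "\<gamma> \<in> cones C \<Longrightarrow> \<delta> \<in> cones C \<Longrightarrow>
    \<phi> (\<gamma> \<odot>\<^bsub>cone_semigroup C\<^esub> \<delta>) = \<phi> \<gamma> \<odot>\<^bsub>cone_semigroup D\<^esub> \<phi> \<delta>"
  by (rule semigroup_hom_mul[OF hom])

lemma \<phi>_idems [simp]: "\<epsilon> \<in> idems (cone_semigroup C) \<Longrightarrow> \<phi> \<epsilon> \<in> idems (cone_semigroup D)"
  by (rule semigroup_hom_idems[OF hom])

lemma \<phi>_rle: "C.cone.rle \<gamma> \<delta> \<Longrightarrow> \<delta> \<in> cones C \<Longrightarrow> D.cone.rle (\<phi> \<gamma>) (\<phi> \<delta>)"
  unfolding C.cone.rle_def D.cone.rle_def using \<phi>_mul \<phi>_cones by blast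

lemma \<phi>_vertex_le:
  assumes "\<gamma> \<in> cones C" "\<delta> \<in> cones C" "C.le (vertex C \<gamma>) (vertex C \<delta>)"
  shows "D.le (vertex D (\<phi> \<gamma>)) (vertex D (\<phi> \<delta>))"
  using assms C.vertex_le_iff[of \<gamma> \<delta>] D.vertex_le_iff[of "\<phi> \<gamma>" "\<phi> \<delta>"] \<phi>_mul \<phi>_cones by blast

definition obj :: "'o \<Rightarrow> 'p" where
  "obj c = vertex D (\<phi> (C.unit_cone c))"

definition arr :: "'m \<Rightarrow> 'n" where
  "arr f = \<phi> (C.arrow_cone f) (obj (src C f)) \<cdot>\<^bsub>D\<^esub>
    D.inc (vertex D (\<phi> (C.arrow_cone f))) (obj (tgt C f))"

lemma obj_Ob [simp]: "c \<in> Ob C \<Longrightarrow> obj c \<in> Ob D"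
  by (simp add: obj_def)

lemma obj_le: "C.le a b \<Longrightarrow> D.le (obj a) (obj b)"
  unfolding obj_def using C.le_Ob by (intro \<phi>_vertex_le) auto

text \<open>Comparison of vertices is a left divisibility relation between cones, hence preserved by
  \<open>\<phi>\<close>. So cones with equal vertices have images with equal vertices, whatever unit
  cones were chosen.\<close>

lemma vertex_\<phi>: assumes "\<gamma> \<in> cones C" shows "vertex D (\<phi> \<gamma>) = obj (vertex C \<gamma>)"
  unfolding obj_def using assms by (intro D.le_antisym \<phi>_vertex_le) auto

lemma arrow_vertex_le:
  "f \<in> Ar C \<Longrightarrow> D.le (vertex D (\<phi> (C.arrow_cone f))) (obj (tgt C f))"
  using obj_le C.epi_part_factor(3)[of f] by (simp add: vertex_\<phi>)

lemma arr_simps [simp]: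
  assumes "f \<in> Ar C"
  shows "arr f \<in> Ar D" "src D (arr f) = obj (src C f)" "tgt D (arr f) = obj (tgt C f)"
  using assms arrow_vertex_le[OF assms] by (auto simp: arr_def)

lemma arr_inc: assumes "C.le a b" shows "arr (C.inc a b) = D.inc (obj a) (obj b)"
proof -
  have a: "a \<in> Ob C" using assms C.le_Ob by blast
  then have "\<phi> (C.unit_cone a) (obj a) = idn D (obj a)"
    using D.idem_vertex[of "\<phi> (C.unit_cone a)"] by (simp add: obj_def)
  moreover have "D.le (obj a) (obj b)" using assms by (rule obj_le)
  ultimately show ?thesis using assms a by (simp add: arr_def C.arrow_cone_inc vertex_\<phi>)
qed

text \<open>The arrow cone of \<open>\<gamma> c\<close> is \<open>unit_cone c\<close> times
  \<open>\<gamma>\<close>. Its image at \<open>obj c\<close> is the epimorphic part of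
  \<open>\<phi> \<gamma> (obj c)\<close>, and the inclusion in the definition of \<open>arr\<close>
  restores the rest. Both the CC condition and \<open>cc_hom_ccm\<close> rest on this
  identity.\<close>

lemma arr_cone:
  assumes \<gamma>: "\<gamma> \<in> cones C" and c: "c \<in> Ob C"
  shows "arr (\<gamma> c) = \<phi> \<gamma> (obj c)"
proof -
  let ?g = "\<phi> \<gamma> (obj c)"
  have g: "?g \<in> Ar D" "tgt D ?g = vertex D (\<phi> \<gamma>)" using \<gamma> c by auto
  have eq: "\<phi> (C.arrow_cone (\<gamma> c)) = \<phi> (C.unit_cone c) \<odot>\<^bsub>cone_semigroup D\<^esub> \<phi> \<gamma>"
    using \<gamma> c \<phi>_mul[of "C.unit_cone c" \<gamma>] by (simp add: C.unit_cone_mul)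
  have u: "\<phi> (C.unit_cone c) (obj c) = idn D (obj c)"
    using c D.idem_vertex[of "\<phi> (C.unit_cone c)"] by (simp add: obj_def)
  have v: "vertex D (\<phi> (C.unit_cone c)) = obj c" by (simp add: obj_def)
  have "\<phi> (C.arrow_cone (\<gamma> c)) (obj c) = epi_part D ?g"
    using \<gamma> c u v by (simp add: eq)
  moreover have "vertex D (\<phi> (C.arrow_cone (\<gamma> c))) = tgt D (epi_part D ?g)"
    using \<gamma> c v D.vertex_cone_mul[of "\<phi> (C.unit_cone c)" "\<phi> \<gamma>"] by (simp add: eq)
  moreover have "obj (tgt C (\<gamma> c)) = vertex D (\<phi> \<gamma>)" using \<gamma> c by (simp add: vertex_\<phi>)
  ultimately show ?thesis
    using \<gamma> c D.epi_part_factor(4)[OF g(1)] g(2) by (simp add: arr_def)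
qed

text \<open>Multiplicativity expresses the left side through the component \<open>?y\<close> of
  \<open>?B\<close> at the vertex of \<open>?A\<close>. The cone condition rewrites
  \<open>?y\<close> as an inclusion followed by the component of \<open>?B\<close> at
  \<open>obj (tgt C f)\<close>, and that inclusion is the one with which \<open>arr f\<close>
  ends.\<close>

lemma arr_cmp:
  assumes f: "f \<in> Ar C" and g: "g \<in> Ar C" and fg: "tgt C f = src C g"
  shows "arr (f \<cdot>\<^bsub>C\<^esub> g) = arr f \<cdot>\<^bsub>D\<^esub> arr g"
proof -
  let ?A = "\<phi> (C.arrow_cone f)" and ?B = "\<phi> (C.arrow_cone g)"
  let ?x = "?A (obj (src C f))" and ?y = "?B (vertex D ?A)"
  have AB: "?A \<in> cones D" "?B \<in> cones D" using f g by auto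
  have le: "D.le (vertex D ?A) (obj (tgt C f))" "D.le (vertex D ?B) (obj (tgt C g))"
    using arrow_vertex_le f g by auto
  have y: "?y \<in> Ar D" "src D ?y = vertex D ?A" "tgt D ?y = vertex D ?B" using AB by auto
  note e = D.epi_part_factor[OF y(1)]
  have x: "?x \<in> Ar D" "tgt D ?x = vertex D ?A" "src D ?x = obj (src C f)" using AB f by auto
  have "arr (f \<cdot>\<^bsub>C\<^esub> g) = ?x \<cdot>\<^bsub>D\<^esub> epi_part D ?y \<cdot>\<^bsub>D\<^esub> D.inc (tgt D (epi_part D ?y)) (obj (tgt C g))"
    using f g fg AB by (simp add: arr_def C.arrow_cone_cmp \<phi>_mul)
  also have "D.inc (tgt D (epi_part D ?y)) (obj (tgt C g))
      = D.inc (tgt D (epi_part D ?y)) (vertex D ?B) \<cdot>\<^bsub>D\<^esub> D.inc (vertex D ?B) (obj (tgt C g))"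
    using e(3) y(3) le(2) by (intro D.inc_cmp[symmetric]) auto
  also have "?x \<cdot>\<^bsub>D\<^esub> epi_part D ?y \<cdot>\<^bsub>D\<^esub> \<dots> = ?x \<cdot>\<^bsub>D\<^esub>
      (epi_part D ?y \<cdot>\<^bsub>D\<^esub> D.inc (tgt D (epi_part D ?y)) (vertex D ?B)) \<cdot>\<^bsub>D\<^esub> D.inc (vertex D ?B)
        (obj (tgt C g))"
    using e(1-3) x y le by (simp add: D.assoc)
  also have "\<dots> = ?x \<cdot>\<^bsub>D\<^esub> ?y \<cdot>\<^bsub>D\<^esub> D.inc (vertex D ?B) (obj (tgt C g))" using e(4) y(3) by simp
  also have "?y = D.inc (vertex D ?A) (obj (tgt C f)) \<cdot>\<^bsub>D\<^esub> ?B (obj (tgt C f))"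
    using D.cone_inc[OF AB(2) le(1)] ..
  finally show ?thesis
    using x le f g fg AB by (simp add: arr_def D.assoc)
qed

text \<open>All members of the union over a class are equal, so no representative has to be chosen.\<close>

definition ccm where
  "ccm = ((restrict obj (Ob C), restrict arr (Ar C)),
    \<lambda>d\<in>all_R C. \<Union>\<gamma>\<in>d. D.R (\<phi> \<gamma>))"

lemma ccm_class: assumes \<gamma>: "\<gamma> \<in> cones C" shows "snd ccm (C.R \<gamma>) = D.R (\<phi> \<gamma>)"
proof -
  have *: "D.R (\<phi> \<delta>) = D.R (\<phi> \<gamma>)" if \<delta>: "\<delta> \<in> C.R \<gamma>" for \<delta>
  proof -
    have "\<delta> \<in> cones C" "C.cone.rle \<delta> \<gamma>" "C.cone.rle \<gamma> \<delta>" using C.cone.in_R_class_iff[OF \<gamma>] \<delta>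
        by blast+
    then show ?thesis using \<gamma> \<phi>_rle D.cone.R_class_eq_iff \<phi>_cones by metis
  qed
  have "(\<Union>\<delta>\<in>C.R \<gamma>. D.R (\<phi> \<delta>)) = (\<Union>\<delta>\<in>C.R \<gamma>. D.R (\<phi> \<gamma>))" by (rule SUP_cong) (use * in auto)
  also have "\<dots> = D.R (\<phi> \<gamma>)" using C.cone.R_class_self[OF \<gamma>] by blast
  finally show ?thesis using C.cone.R_class_in[OF \<gamma>] by (simp add: ccm_def)
qed

theorem cc_morphism_ccm: "cc_morphism C (all_R C) D (all_R D) ccm"
proof -
  have "is_functor C D (fst ccm)"
    unfolding is_functor_def
  proof (intro conjI ballI impI)
    show "snd (fst ccm) (idn C a) = idn D (fst (fst ccm) a)" if "a \<in> Ob C" for a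
      using that arr_inc[of a a] by (simp add: ccm_def)
    show "snd (fst ccm) (f \<cdot>\<^bsub>C\<^esub> g) = snd (fst ccm) f \<cdot>\<^bsub>D\<^esub> snd (fst ccm) g"
      if "f \<in> Ar C" "g \<in> Ar C" "tgt C f = src C g" for f g
      using that arr_cmp by (simp add: ccm_def)
  qed (auto simp: ccm_def)
  moreover have "snd (fst ccm) ` Incl C \<subseteq> Incl D"
  proof
    fix j assume "j \<in> snd (fst ccm) ` Incl C"
    then obtain i where i: "i \<in> Incl C" "j = snd (fst ccm) i" by blast
    then have "j = D.inc (obj (src C i)) (obj (tgt C i))" "D.le (obj (src C i)) (obj (tgt C i))"
      using arr_inc[of "src C i" "tgt C i"] C.inc_src_tgt[of i] C.leI[of i] obj_le
      by (auto simp: ccm_def)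
    then show "j \<in> Incl D" by simp
  qed
  moreover have "snd ccm \<in> all_R C \<rightarrow>\<^sub>E all_R D"
    using ccm_class by (auto simp: PiE_iff ccm_def elim!: C.cone.R_classesE)
  moreover have "R_le (cone_semigroup D) (snd ccm d\<^sub>1) (snd ccm d\<^sub>2)"
    if d: "d\<^sub>1 \<in> all_R C" "d\<^sub>2 \<in> all_R C" "R_le (cone_semigroup C) d\<^sub>1 d\<^sub>2" for d\<^sub>1 d\<^sub>2
  proof -
    obtain \<gamma> \<delta> where "\<gamma> \<in> cones C" "d\<^sub>1 = C.R \<gamma>" "\<delta> \<in> cones C" "d\<^sub>2 = C.R \<delta>"
      using d(1,2) by (metis C.cone.R_classesE)
    then show ?thesis
      using d(3) C.cone.R_le_iff[of \<gamma> \<delta>] D.cone.R_le_iff[of "\<phi> \<gamma>" "\<phi> \<delta>"] ccm_class \<phi>_rle by simp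
  qed
  moreover have "connected_to D (fst (fst ccm) c) (snd ccm d) \<and> (\<forall>c'\<in>Ob C.
      snd (fst ccm) (conn_idem C c d c') = conn_idem D (fst (fst ccm) c) (snd ccm d) (fst (fst
          ccm) c'))"
    if c: "c \<in> Ob C" "d \<in> all_R C" "connected_to C c d" for c d
  proof -
    let ?\<epsilon> = "conn_idem C c d"
    have \<epsilon>: "?\<epsilon> \<in> d" "?\<epsilon> \<in> idems (cone_semigroup C)" "vertex C ?\<epsilon> = c" "C.R ?\<epsilon> = d"
      using C.connected_toE[OF c(3,2)] by metis+
    have \<epsilon>c: "?\<epsilon> \<in> cones C" using \<epsilon>(2) by simp
    then have G: "snd ccm d = D.R (\<phi> ?\<epsilon>)" using ccm_class[of ?\<epsilon>] \<epsilon>(4) by simp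
    have \<phi>\<epsilon>: "\<phi> ?\<epsilon> \<in> idems (cone_semigroup D)" "\<phi> ?\<epsilon> \<in> D.R (\<phi> ?\<epsilon>)" "D.R (\<phi> ?\<epsilon>) \<in> all_R D"
      "vertex D (\<phi> ?\<epsilon>) = obj c"
      using \<epsilon> \<epsilon>c D.cone.R_class_self[of "\<phi> ?\<epsilon>"] by (auto simp: vertex_\<phi>)
    have "connected_to D (obj c) (snd ccm d)" unfolding G using \<phi>\<epsilon> by (intro D.connected_toI) auto
    moreover have "conn_idem D (obj c) (snd ccm d) = \<phi> ?\<epsilon>" unfolding G using \<phi>\<epsilon>
        by (intro D.conn_idem_eq)
    ultimately show ?thesis using c \<epsilon>c arr_cone[OF \<epsilon>c] by (simp add: ccm_def)
  qed
  ultimately show ?thesis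
    unfolding cc_morphism_def
    using C.connected_category_all_R D.connected_category_all_R by (auto split: prod.splits)
qed

theorem cc_hom_ccm: "cc_hom C ccm = \<phi>"
proof -
  interpret cc_map C D ccm by unfold_locales (rule cc_morphism_ccm)
  have \<phi>: "\<phi> \<in> extensional (cones C)" using hom by (auto simp: semigroup_hom_def PiE_iff)
  show ?thesis
  proof (rule extensionalityI[OF _ \<phi>])
    show "cc_hom C ccm \<in> extensional (cones C)" by (simp add: cc_hom_def)
    fix \<gamma> assume \<gamma>: "\<gamma> \<in> cones C"
    show "cc_hom C ccm \<gamma> = \<phi> \<gamma>"
    proof (rule cc_hom_eqI[OF \<gamma>])
      show "\<phi> \<gamma> \<in> snd ccm (C.R \<gamma>)" using ccm_class[OF \<gamma>] \<gamma> D.cone.R_class_self by simp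
      show "\<phi> \<gamma> (fst (fst ccm) c) = snd (fst ccm) (\<gamma> c)" if "c \<in> Ob C" for c
        using that \<gamma> arr_cone[OF \<gamma> that] by (simp add: ccm_def)
    qed
  qed
qed

end

lemma cc_hom_full:
  assumes "normal_category C" "normal_category D"
    "semigroup_hom (cone_semigroup C) (cone_semigroup D) \<phi>"
  obtains FG where "cc_morphism C (all_R C) D (all_R D) FG" "cc_hom C FG = \<phi>"
proof -
  interpret C: normal_category C by fact
  interpret D: normal_category D by fact
  interpret cone_hom C D \<phi> by unfold_locales fact
  show thesis using that cc_morphism_ccm cc_hom_ccm .
qed

section \<open>Compatibility with identities and composition\<close>

lemma cc_morphism_id:
  assumes "normal_category C"
  shows "cc_morphism C (all_R C) C (all_R C) (cc_id C (all_R C))"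
proof -
  interpret C: normal_category C by fact
  show ?thesis
    using C.connected_category_all_R C.connected_toE C.Incl_Ar
    by (auto simp: cc_morphism_def cc_id_def id_functor_def is_functor_def)
      (metis C.cone.idems_elems C.cone_apply(1))
qed

lemma cc_hom_id:
  assumes "normal_category C"
  shows "cc_hom C (cc_id C (all_R C)) = (\<lambda>\<gamma>\<in>cones C. \<gamma>)"
proof -
  interpret C: normal_category C by fact
  interpret cc_map C C "cc_id C (all_R C)" by unfold_locales (rule cc_morphism_id[OF assms])
  have "cc_hom C (cc_id C (all_R C)) \<gamma> = \<gamma>" if "\<gamma> \<in> cones C" for \<gamma>
    using that C.cone.R_class_self[OF that] C.cone.R_class_in[OF that]
    by (intro cc_hom_eqI) (auto simp: cc_id_def id_functor_def)
  then show ?thesis by (intro extensionalityI[of _ "cones C"]) (auto simp: cc_hom_def)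
qed

lemma is_functor_comp:
  assumes "category C" "is_functor C D F" "is_functor D E F'"
  shows "is_functor C E (comp_functor C F F')"
proof -
  interpret category C by fact
  show ?thesis
    using functor_simps[OF assms(2)] functor_simps[OF assms(3)]
    unfolding is_functor_def comp_functor_def by auto
qed

lemma cc_morphism_comp:
  assumes "normal_category C" "normal_category D"
    and FG: "cc_morphism C (all_R C) D (all_R D) FG" "cc_morphism D (all_R D) E (all_R E) FG'"
  shows "cc_morphism C (all_R C) E (all_R E) (cc_comp C (all_R C) FG FG')"
proof -
  have E: "normal_category E" using FG(2) by (auto simp: cc_morphism_def connected_category_def)
  interpret C: normal_category C by fact
  interpret D: normal_category D by fact
  interpret E: normal_category E by fact
  interpret A: cc_map C D FG by unfold_locales fact
  interpret B: cc_map D E FG' by unfold_locales fact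
  have "is_functor C E (comp_functor C (fst FG) (fst FG'))"
    by (rule is_functor_comp[OF C.category_axioms A.is_functor B.is_functor])
  moreover have "snd (comp_functor C (fst FG) (fst FG')) ` Incl C \<subseteq> Incl E"
    using A.Incl_image B.Incl_image C.Incl_Ar by (auto simp: comp_functor_def)
  moreover have "(\<lambda>d\<in>all_R C. B.G (A.G d)) \<in> all_R C \<rightarrow>\<^sub>E all_R E"
    using A.G_closed B.G_closed by auto
  moreover have "R_le (cone_semigroup E) (B.G (A.G d\<^sub>1)) (B.G (A.G d\<^sub>2))"
    if d: "d\<^sub>1 \<in> all_R C" "d\<^sub>2 \<in> all_R C" "R_le (cone_semigroup C) d\<^sub>1 d\<^sub>2" for d\<^sub>1 d\<^sub>2
  proof -
    have "R_le (cone_semigroup D) (A.G d\<^sub>1) (A.G d\<^sub>2)"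
      using FG(1) d by (auto simp: cc_morphism_def split: prod.splits)
    then show ?thesis
      using FG(2) A.G_closed[OF d(1)] A.G_closed[OF d(2)]
        by (auto simp: cc_morphism_def split: prod.splits)
  qed
  moreover have "connected_to E (B.F0 (A.F0 c)) (B.G (A.G d)) \<and>
    (\<forall>c'\<in>Ob C. snd (comp_functor C (fst FG) (fst FG')) (conn_idem C c d c')
      = conn_idem E (B.F0 (A.F0 c)) (B.G (A.G d)) (B.F0 (A.F0 c')))"
    if c: "d \<in> all_R C" "connected_to C c d" for c d
  proof -
    note A = A.conn_cond[OF c]
    note B = B.conn_cond[OF A.G_closed[OF c(1)] A(1)]
    have "conn_idem C c d \<in> cones C" using C.connected_toE[OF c(2,1)] C.cone.idems_elems by metis
    then show ?thesis using A B by (auto simp: comp_functor_def)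
  qed
  ultimately show ?thesis
    unfolding cc_morphism_def cc_comp_def
    using C.connected_category_all_R E.connected_category_all_R
    by (auto simp: comp_functor_def)
qed

lemma cc_hom_comp:
  assumes "normal_category C" "normal_category D"
    and FG: "cc_morphism C (all_R C) D (all_R D) FG" "cc_morphism D (all_R D) E (all_R E) FG'"
  shows "cc_hom C (cc_comp C (all_R C) FG FG') = compose (cones C) (cc_hom D FG') (cc_hom C FG)"
proof -
  have E: "normal_category E" using FG(2) by (auto simp: cc_morphism_def connected_category_def)
  interpret C: normal_category C by fact
  interpret D: normal_category D by fact
  interpret E: normal_category E by fact
  interpret A: cc_map C D FG by unfold_locales fact
  interpret B: cc_map D E FG' by unfold_locales fact
  interpret AB: cc_map C E "cc_comp C (all_R C) FG FG'"
    by unfold_locales (rule cc_morphism_comp[OF assms])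
  have "cc_hom C (cc_comp C (all_R C) FG FG') \<gamma> = cc_hom D FG' (cc_hom C FG \<gamma>)"
      if \<gamma>: "\<gamma> \<in> cones C" for \<gamma>
  proof (rule AB.cc_hom_eqI[OF \<gamma>])
    have A: "cc_hom C FG \<gamma> \<in> cones D" by (rule A.cc_hom_cones[OF \<gamma>])
    show "cc_hom D FG' (cc_hom C FG \<gamma>) \<in> AB.G (C.R \<gamma>)"
      using B.cc_hom_class[OF A] A.G_eq[OF \<gamma>] \<gamma> by (simp add: cc_comp_def)
    show "cc_hom D FG' (cc_hom C FG \<gamma>) (AB.F0 c) = AB.F1 (\<gamma> c)" if "c \<in> Ob C" for c
      using that \<gamma> B.cc_hom_apply[OF A, of "A.F0 c"] A.cc_hom_apply[OF \<gamma> that]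
      by (simp add: cc_comp_def comp_functor_def)
  qed
  then show ?thesis by (intro extensionalityI[of _ "cones C"]) (auto simp: cc_hom_def compose_def)
qed

section \<open>Fully faithful and essentially surjective functors\<close>

locale ff_functor = C: category C + D: category D
  for C :: "('o, 'm, 'x) cat_scheme" and D :: "('p, 'n, 'y) cat_scheme" +
  fixes F :: "('o, 'm, 'p, 'n) fctr"
  assumes is_functor: "is_functor C D F"
    and full: "\<lbrakk>a \<in> Ob C; b \<in> Ob C; g \<in> Hom D (fst F a) (fst F b)\<rbrakk> \<Longrightarrow> \<exists>f\<in>Hom C a b. snd F f = g"
    and faithful: "\<lbrakk>f \<in> Hom C a b; f' \<in> Hom C a b; snd F f = snd F f'\<rbrakk> \<Longrightarrow> f = f'"
begin

declare functor_simps[OF is_functor, simp]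

definition lift :: "'o \<Rightarrow> 'o \<Rightarrow> 'n \<Rightarrow> 'm" where
  "lift a b g = (SOME f. f \<in> Hom C a b \<and> snd F f = g)"

lemma lift:
  assumes "a \<in> Ob C" "b \<in> Ob C" "g \<in> Ar D" "src D g = fst F a" "tgt D g = fst F b"
  shows "lift a b g \<in> Ar C" "src C (lift a b g) = a" "tgt C (lift a b g) = b"
      "snd F (lift a b g) = g"
proof -
  have "\<exists>f. f \<in> Hom C a b \<and> snd F f = g" using full[of a b g] assms by (auto simp: Hom_def)
  then have "lift a b g \<in> Hom C a b \<and> snd F (lift a b g) = g" unfolding lift_def by (rule someI_ex)
  then show "lift a b g \<in> Ar C" "src C (lift a b g) = a" "tgt C (lift a b g) = b"
      "snd F (lift a b g) = g"
    by (auto simp: Hom_def)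
qed

lemma faithfulI:
  "\<lbrakk>f \<in> Ar C; f' \<in> Ar C; src C f = src C f'; tgt C f = tgt C f'; snd F f = snd F f'\<rbrakk> \<Longrightarrow> f = f'"
  using faithful[of f "src C f" "tgt C f" f'] by (simp add: Hom_def)

text \<open>The quasi-inverse conjugates an arrow by chosen isomorphisms \<open>i\<close> and lifts
  the result through the full functor. Equations in \<open>C\<close> are verified after applying
  \<open>F\<close>, where the chosen isomorphisms cancel.\<close>

lemma equivalent_categories:
  assumes eso: "\<And>d. d \<in> Ob D \<Longrightarrow> \<exists>c\<in>Ob C. \<exists>i\<in>Hom D (fst F c) d. iso_arr D i"
  shows "equivalent_categories C D"
proof -
  have "\<forall>d. \<exists>c i i'. d \<in> Ob D \<longrightarrow> c \<in> Ob C \<and> i \<in> Ar D \<and> src D i = fst F c \<and> tgt D i = d \<and>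
    i' \<in> Ar D \<and> src D i' = d \<and> tgt D i' = fst F c \<and> i \<cdot>\<^bsub>D\<^esub> i' = idn D (fst F c) \<and> i' \<cdot>\<^bsub>D\<^esub> i = idn
        D d"
    (is "\<forall>d. \<exists>c i i'. ?P d c i i'")
  proof
    fix d show "\<exists>c i i'. ?P d c i i'"
    proof (cases "d \<in> Ob D")
      case True
      then obtain c i where c: "c \<in> Ob C" "i \<in> Ar D" "src D i = fst F c" "tgt D i = d" "iso_arr D i"
        using eso[OF True] by (auto simp: Hom_def)
      obtain i' where "i' \<in> Ar D" "src D i' = tgt D i" "tgt D i' = src D i"
        "i \<cdot>\<^bsub>D\<^esub> i' = idn D (src D i)" "i' \<cdot>\<^bsub>D\<^esub> i = idn D (tgt D i)"
        using c(5) by (rule D.iso_arrE)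
      then show ?thesis using c by metis
    qed simp
  qed
  then obtain c i i' where P: "\<And>d. ?P d (c d) (i d) (i' d)" by metis
  have c [simp]: "c d \<in> Ob C" "i d \<in> Ar D" "src D (i d) = fst F (c d)" "tgt D (i d) = d"
    "i' d \<in> Ar D" "src D (i' d) = d" "tgt D (i' d) = fst F (c d)"
    "i d \<cdot>\<^bsub>D\<^esub> i' d = idn D (fst F (c d))" "i' d \<cdot>\<^bsub>D\<^esub> i d = idn D d" if "d \<in> Ob D" for d
    using P[of d] that by auto
  have cancel: "i' d \<cdot>\<^bsub>D\<^esub> (i d \<cdot>\<^bsub>D\<^esub> g) = g" if "d \<in> Ob D" "g \<in> Ar D" "src D g = d" for d g
    using that c(9)[OF that(1)] by (subst D.assoc[symmetric]) simp_all
  define G1 where "G1 g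
      = lift (c (src D g)) (c (tgt D g)) (i (src D g) \<cdot>\<^bsub>D\<^esub> g \<cdot>\<^bsub>D\<^esub> i' (tgt D g))" for g
  define G where "G = (restrict c (Ob D), restrict G1 (Ar D))"
  have G1 [simp]: "G1 g \<in> Ar C" "src C (G1 g) = c (src D g)" "tgt C (G1 g) = c (tgt D g)"
    "snd F (G1 g) = i (src D g) \<cdot>\<^bsub>D\<^esub> g \<cdot>\<^bsub>D\<^esub> i' (tgt D g)" if "g \<in> Ar D" for g
    using that lift[of "c (src D g)" "c (tgt D g)" "i (src D g) \<cdot>\<^bsub>D\<^esub> g \<cdot>\<^bsub>D\<^esub> i' (tgt D g)"]
    by (auto simp: G1_def)
  have G: "is_functor D C G"
    unfolding is_functor_def
  proof (intro conjI ballI impI)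
    show "snd G (idn D a) = idn C (fst G a)" if "a \<in> Ob D" for a
    proof -
      have "G1 (idn D a) = idn C (c a)" by (rule faithfulI) (use that in auto)
      then show ?thesis using that by (simp add: G_def)
    qed
    show "snd G (f \<cdot>\<^bsub>D\<^esub> g) = snd G f \<cdot>\<^bsub>C\<^esub> snd G g"
        if "f \<in> Ar D" "g \<in> Ar D" "tgt D f = src D g" for f g
    proof -
      have "G1 (f \<cdot>\<^bsub>D\<^esub> g) = G1 f \<cdot>\<^bsub>C\<^esub> G1 g"
        by (rule faithfulI) (use that in \<open>auto simp: D.assoc cancel\<close>)
      then show ?thesis using that by (simp add: G_def)
    qed
  qed (auto simp: G_def)
  \<comment> \<open>The unit at \<open>a\<close> lifts the inverse of the isomorphism chosen for
    \<open>fst F a\<close>; its own inverse lifts that isomorphism.\<close>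
  define \<eta> where "\<eta> a = lift a (c (fst F a)) (i' (fst F a))" for a
  have \<eta>: "\<eta> a \<in> Ar C" "src C (\<eta> a) = a" "tgt C (\<eta> a) = c (fst F a)" "snd F (\<eta> a) = i' (fst F a)"
    if "a \<in> Ob C" for a
    using lift[of a "c (fst F a)" "i' (fst F a)"] that by (auto simp: \<eta>_def)
  have \<eta>_iso: "iso_arr C (\<eta> a)" if a: "a \<in> Ob C" for a
  proof -
    let ?v = "lift (c (fst F a)) a (i (fst F a))"
    have v: "?v \<in> Ar C" "src C ?v = c (fst F a)" "tgt C ?v = a" "snd F ?v = i (fst F a)"
      using lift[of "c (fst F a)" a "i (fst F a)"] a by auto
    show ?thesis
      by (rule C.iso_arrI[of _ ?v]; (rule faithfulI)?) (use v \<eta>[OF a] a in auto)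
  qed
  have nat1: "natural_iso C C (id_functor C) (comp_functor C F G) \<eta>"
    unfolding natural_iso_def
  proof (intro conjI ballI)
    show "\<eta> a \<in> Hom C (fst (id_functor C) a) (fst (comp_functor C F G) a)" if "a \<in> Ob C" for a
      using that \<eta>[OF that] by (simp add: Hom_def id_functor_def comp_functor_def G_def)
    show "snd (id_functor C) f \<cdot>\<^bsub>C\<^esub> \<eta> (tgt C f) = \<eta> (src C f) \<cdot>\<^bsub>C\<^esub> snd (comp_functor C F G) f"
      if f: "f \<in> Ar C" for f
    proof -
      have "f \<cdot>\<^bsub>C\<^esub> \<eta> (tgt C f) = \<eta> (src C f) \<cdot>\<^bsub>C\<^esub> G1 (snd F f)"
        by (rule faithfulI) (use f \<eta> in \<open>auto simp: cancel D.assoc\<close>)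
      then show ?thesis using f by (simp add: id_functor_def comp_functor_def G_def)
    qed
  qed (rule \<eta>_iso)
  have nat2: "natural_iso D D (comp_functor D G F) (id_functor D) i"
    unfolding natural_iso_def
  proof (intro conjI ballI)
    show "i a \<in> Hom D (fst (comp_functor D G F) a) (fst (id_functor D) a)" if "a \<in> Ob D" for a
      using that by (simp add: Hom_def id_functor_def comp_functor_def G_def)
    show "iso_arr D (i a)" if "a \<in> Ob D" for a
      using that by (intro D.iso_arrI[of _ "i' a"]) auto
    show "snd (comp_functor D G F) f \<cdot>\<^bsub>D\<^esub> i (tgt D f) = i (src D f) \<cdot>\<^bsub>D\<^esub> snd (id_functor D) f"
      if f: "f \<in> Ar D" for f
      using f by (simp add: id_functor_def comp_functor_def G_def D.assoc)
  qed
  show ?thesis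
    unfolding equivalent_categories_def
    using C.category_axioms D.category_axioms is_functor G nat1 nat2 by blast
qed

end

section \<open>Smallness and encodings\<close>

text \<open>A finite universe with \<open>n\<close> elements, where \<open>n \<ge> 1\<close> because
  types are inhabited, has a small subset with \<open>n - 1\<close> elements. Its subsets
  \<open>{}\<close> and \<open>{y}\<close> already number \<open>n\<close>, against closure under
  power sets.\<close>

lemma powerset_closed_infinite:
  assumes "powerset_closed_universe TYPE('u)"
  shows "infinite (UNIV :: 'u set)"
proof
  assume fin: "finite (UNIV :: 'u set)"
  fix x :: 'u
  let ?A = "UNIV - {x}"
  have "?A \<subset> UNIV" by blast
  then have "\<not> (UNIV :: 'u set) \<approx> ?A" using fin infinite_iff_psubset by blast
  then have "\<not> ?A \<approx> (UNIV :: 'u set)" using eqpoll_sym by blast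
  moreover have "?A \<lesssim> (UNIV :: 'u set)" by (rule subset_imp_lepoll) simp
  ultimately have "small ?A" unfolding small_def by (simp add: lepoll_iff_leqpoll)
  then have "Pow ?A \<prec> (UNIV :: 'u set)" using assms unfolding powerset_closed_universe_def by blast
  moreover have "(UNIV :: 'u set) \<lesssim> Pow ?A"
    unfolding lepoll_def by (intro exI[of _
        "\<lambda>y. if y = x then {} else {y}"]) (auto simp: inj_on_def)
  ultimately show False using lesspoll_trans2 lesspoll_not_refl by blast
qed

lemma lepoll_iff_ordLeq: "A \<lesssim> B \<longleftrightarrow> ordLeq2 (card_of A) (card_of B)"
  unfolding lepoll_def card_of_ordLeq by blast

lemma lesspoll_iff_ordLess: "A \<prec> B \<longleftrightarrow> ordLess2 (card_of A) (card_of B)"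
  unfolding lesspoll_def lepoll_iff_ordLeq eqpoll_iff_card_of_ordIso
  using ordLeq_iff_ordLess_or_ordIso not_ordLess_ordIso by blast

text \<open>The product embeds in the square of the disjoint sum. If that sum is infinite it is
  equipollent to its square, and it stays below \<open>U\<close> as a sum of two sets smaller than
  an infinite one.\<close>

lemma lesspoll_Times:
  assumes "A \<prec> U" "B \<prec> U" "infinite U"
  shows "A \<times> B \<prec> U"
proof (cases "finite (A <+> B)")
  case True
  then have "finite (A \<times> B)" by (simp add: finite_Plus_iff)
  then show ?thesis using assms(3) by (rule finite_lesspoll_infinite[rotated])
next
  case False
  let ?Z = "A <+> B"
  have "A \<lesssim> ?Z" "B \<lesssim> ?Z"
    unfolding lepoll_def by (auto intro: exI[of _ Inl] exI[of _ Inr])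
  then have "A \<times> B \<lesssim> ?Z \<times> ?Z" by (rule times_lepoll_mono)
  moreover have "?Z \<times> ?Z \<approx> ?Z"
    unfolding eqpoll_iff_card_of_ordIso by (rule card_of_Times_same_infinite[OF False])
  moreover have "?Z \<prec> U"
    using assms unfolding lesspoll_iff_ordLess by (intro card_of_Plus_ordLess_infinite)
  ultimately show ?thesis using lesspoll_trans1 lepoll_trans2 by blast
qed

lemma small_image: "A \<prec> (UNIV :: 'u set) \<Longrightarrow> small (e ` A :: 'u set)"
  unfolding small_def using image_lepoll lesspoll_trans1 by blast

text \<open>A cone is determined by its graph, a subset of \<open>Ob C \<times> Ar C\<close>. This
  product is first encoded inside \<open>'u\<close>, since closure under power sets speaks of sets
  of that type.\<close>

lemma cones_lesspoll:
  fixes C :: "('u, 'u) scat"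
  assumes U: "powerset_closed_universe TYPE('u)" and C: "small (Ob C)" "small (Ar C)"
    and "normal_category C"
  shows "cones C \<prec> (UNIV :: 'u set)"
proof -
  interpret normal_category C by fact
  have "Ob C \<times> Ar C \<prec> (UNIV :: 'u set)"
    using C powerset_closed_infinite[OF U] unfolding small_def by (intro lesspoll_Times)
  then obtain e :: "'u \<times> 'u \<Rightarrow> 'u" where e: "inj_on e (Ob C \<times> Ar C)" "small (e ` (Ob C \<times> Ar C))"
    using small_image lesspoll_imp_lepoll lepoll_def by metis
  let ?g = "\<lambda>\<gamma>. e ` ((\<lambda>c. (c, \<gamma> c)) ` Ob C)"
  have sub: "(\<lambda>c. (c, \<gamma> c)) ` Ob C \<subseteq> Ob C \<times> Ar C" if "\<gamma> \<in> cones C" for \<gamma> using that by auto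
  have "inj_on ?g (cones C)"
  proof (rule inj_onI)
    fix \<gamma> \<delta> assume *: "\<gamma> \<in> cones C" "\<delta> \<in> cones C" "?g \<gamma> = ?g \<delta>"
    then have "(\<lambda>c. (c, \<gamma> c)) ` Ob C = (\<lambda>c. (c, \<delta> c)) ` Ob C"
      using inj_on_image_eq_iff[OF e(1) sub sub] by blast
    then have "\<gamma> c = \<delta> c" if "c \<in> Ob C" for c using that by blast
    then show "\<gamma> = \<delta>" using * by (intro cone_eqI)
  qed
  moreover have "?g ` cones C \<subseteq> Pow (e ` (Ob C \<times> Ar C))" using sub by blast
  ultimately have "cones C \<lesssim> Pow (e ` (Ob C \<times> Ar C))" unfolding lepoll_def by blast
  moreover have "Pow (e ` (Ob C \<times> Ar C)) \<prec> (UNIV :: 'u set)"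
    using e(2) U unfolding powerset_closed_universe_def by blast
  ultimately show ?thesis by (rule lesspoll_trans1)
qed

text \<open>An object is named by a generating idempotent and an arrow by a triple
  \<open>(e, s, f)\<close> of elements, so both collections are bounded by finite powers of the
  carrier.\<close>

lemma left_ideal_cat_lesspoll:
  fixes S :: "'u sgrp"
  assumes U: "powerset_closed_universe TYPE('u)" and S: "small (elems S)"
  shows "Ob (left_ideal_cat S) \<prec> (UNIV :: 'u set)" "Ar (left_ideal_cat S) \<prec> (UNIV :: 'u set)"
proof -
  let ?E = "elems S"
  have sub: "idems S \<subseteq> ?E" unfolding idems_def by blast
  have "Ob (left_ideal_cat S) \<lesssim> ?E"
    using sub by (intro subset_image_lepoll[of _ "left_ideal S"]) (auto simp: left_ideal_cat_def)
  then show "Ob (left_ideal_cat S) \<prec> (UNIV :: 'u set)"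
    using S unfolding small_def by (rule lesspoll_trans1)
  have "?E \<times> ?E \<times> ?E \<prec> (UNIV :: 'u set)"
    using S powerset_closed_infinite[OF U] unfolding small_def by (intro lesspoll_Times)
  moreover have "Ar (left_ideal_cat S) \<lesssim> ?E \<times> ?E \<times> ?E"
    using sub
    by (intro subset_image_lepoll[of _ "\<lambda>(e, s, f). r_map S e (e \<odot>\<^bsub>S\<^esub> s \<odot>\<^bsub>S\<^esub> f) f"])
      (auto simp: left_ideal_cat_def image_iff Bex_def; blast)
  ultimately show "Ar (left_ideal_cat S) \<prec> (UNIV :: 'u set)" by (rule lesspoll_trans1[rotated])
qed

section \<open>Copies of structures on sets of codes\<close>

definition image_sgrp :: "('a \<Rightarrow> 'b) \<Rightarrow> 'a sgrp \<Rightarrow> 'b sgrp" where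
  "image_sgrp e S = \<lparr>elems = e ` elems S,
    mul = (\<lambda>x y. e (inv_into (elems S) e x \<odot>\<^bsub>S\<^esub> inv_into (elems S) e y))\<rparr>"

lemma image_sgrp:
  assumes "inj_on e (elems S)" "\<And>a b. a \<in> elems S \<Longrightarrow> b \<in> elems S \<Longrightarrow> a \<odot>\<^bsub>S\<^esub> b \<in> elems S"
  shows "semigroup_hom S (image_sgrp e S) (restrict e (elems S))"
    "bij_betw (restrict e (elems S)) (elems S) (elems (image_sgrp e S))"
  using assms unfolding semigroup_hom_def by (auto simp: image_sgrp_def bij_betw_def)

definition image_scat :: "('o \<Rightarrow> 'p) \<Rightarrow> ('m \<Rightarrow> 'n) \<Rightarrow> ('o, 'm) scat \<Rightarrow> ('p, 'n) scat" where
  "image_scat a b C = (let a' = inv_into (Ob C) a; b' = inv_into (Ar C) b in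
    \<lparr>Ob = a ` Ob C, Ar = b ` Ar C, src = (\<lambda>f. a (src C (b' f))), tgt = (\<lambda>f. a (tgt C (b' f))),
     idn = (\<lambda>x. b (idn C (a' x))), cmp = (\<lambda>f g. b (b' f \<cdot>\<^bsub>C\<^esub> b' g)), Incl = b ` Incl C\<rparr>)"

lemma scat_iso_image:
  assumes "normal_category C" "inj_on a (Ob C)" "inj_on b (Ar C)"
  shows "scat_iso C (image_scat a b C) (restrict a (Ob C), restrict b (Ar C))"
proof -
  interpret normal_category C by fact
  show ?thesis
    unfolding scat_iso_def is_functor_def using assms(2,3) Incl_subset
    by (auto simp: image_scat_def Let_def bij_betw_def inj_on_def)
qed

section \<open>The equivalence\<close>

lemma NormalCat_simps:
  "Ob NormalCat = {C. normal_category C \<and> small (Ob C) \<and> small (Ar C)}"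
  "(C, FG, D) \<in> Ar NormalCat \<longleftrightarrow>
    C \<in> Ob NormalCat \<and> D \<in> Ob NormalCat \<and> cc_morphism C (all_R C) D (all_R D) FG"
  "src NormalCat = fst" "tgt NormalCat = (\<lambda>m. snd (snd m))"
  "idn NormalCat C = (C, cc_id C (all_R C), C)"
  "cmp NormalCat (C, FG, D) (D', FG', E) = (C, cc_comp C (all_R C) FG FG', E)"
  by (auto simp: NormalCat_def Let_def)

lemma TLR_simps:
  "Ob TLRSemigroups = {S. totally_left_reductive S \<and> small (elems S)}"
  "(S, \<phi>, T) \<in> Ar TLRSemigroups \<longleftrightarrow>
    S \<in> Ob TLRSemigroups \<and> T \<in> Ob TLRSemigroups \<and> semigroup_hom S T \<phi>"
  "src TLRSemigroups = fst" "tgt TLRSemigroups = (\<lambda>m. snd (snd m))"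
  "idn TLRSemigroups S = (S, (\<lambda>x\<in>elems S. x), S)"
  "cmp TLRSemigroups (S, \<phi>, T) (T', \<psi>, V) = (S, compose (elems S) \<psi> \<phi>, V)"
  by (auto simp: TLRSemigroups_def Let_def)

lemma NormalCat_Hom:
  "m \<in> Hom NormalCat C D \<longleftrightarrow> (\<exists>FG. m = (C, FG, D) \<and> C \<in> Ob NormalCat \<and> D \<in> Ob NormalCat \<and>
    cc_morphism C (all_R C) D (all_R D) FG)"
  by (cases m) (auto simp: Hom_def NormalCat_simps(2-))

lemma TLR_Hom:
  "m \<in> Hom TLRSemigroups S T \<longleftrightarrow> (\<exists>\<phi>. m = (S, \<phi>, T) \<and> S \<in> Ob TLRSemigroups \<and>
    T \<in> Ob TLRSemigroups \<and> semigroup_hom S T \<phi>)"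
  by (cases m) (auto simp: Hom_def TLR_simps(2-))

lemma cc_morphism_extensional:
  assumes "cc_morphism C (all_R C) D (all_R D) FG"
  shows "fst (fst FG) \<in> Ob C \<rightarrow>\<^sub>E Ob D" "snd (fst FG) \<in> Ar C \<rightarrow>\<^sub>E Ar D" "snd FG \<in> all_R C \<rightarrow>\<^sub>E all_R D"
  using assms by (auto simp: cc_morphism_def is_functor_def split: prod.splits)

lemma category_NormalCat: "category NormalCat"
proof
  show "src NormalCat m \<in> Ob NormalCat" "tgt NormalCat m \<in> Ob NormalCat"
      if "m \<in> Ar NormalCat" for m :: "('a, 'a) scat \<times> ('a, 'a, 'a, 'a) ccm \<times> ('a, 'a) scat"
    using that by (cases m; simp add: NormalCat_simps(2-))+
  show "idn NormalCat C \<in> Hom NormalCat C C" if "C \<in> Ob NormalCat" for C :: "('a, 'a) scat"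
    using that cc_morphism_id[of C] by (auto simp: NormalCat_Hom NormalCat_simps)
  fix C D E X :: "('a, 'a) scat" and m n k
  show "cmp NormalCat m n \<in> Hom NormalCat C E"
      if mn: "m \<in> Hom NormalCat C D" "n \<in> Hom NormalCat D E"
  proof -
    obtain FG FG' where "m = (C, FG, D)" "n = (D, FG', E)" "C \<in> Ob NormalCat" "D \<in> Ob NormalCat"
      "E \<in> Ob NormalCat" "cc_morphism C (all_R C) D (all_R D) FG"
          "cc_morphism D (all_R D) E (all_R E) FG'"
      using mn by (auto simp: NormalCat_Hom)
    then show ?thesis
      using cc_morphism_comp[of C D FG E FG'] by (simp add: NormalCat_Hom NormalCat_simps)
  qed
  show "cmp NormalCat (idn NormalCat C) m = m" "cmp NormalCat m (idn NormalCat D) = m"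
    if m: "m \<in> Hom NormalCat C D"
  proof -
    obtain FG where FG: "m = (C, FG, D)" "cc_morphism C (all_R C) D (all_R D) FG"
      using m by (auto simp: NormalCat_Hom)
    note ext = cc_morphism_extensional[OF FG(2)]
    have "cc_comp C (all_R C) (cc_id C (all_R C)) FG = FG"
        "cc_comp C (all_R C) FG (cc_id D (all_R D)) = FG"
      using ext by (auto simp: cc_comp_def cc_id_def comp_functor_def id_functor_def prod_eq_iff
          fun_eq_iff PiE_iff extensional_def)
    then show "cmp NormalCat (idn NormalCat C) m = m" "cmp NormalCat m (idn NormalCat D) = m"
      using FG by (auto simp: NormalCat_simps)
  qed
  show "cmp NormalCat (cmp NormalCat m n) k = cmp NormalCat m (cmp NormalCat n k)"
    if mnk: "m \<in> Hom NormalCat C D" "n \<in> Hom NormalCat D E" "k \<in> Hom NormalCat E X"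
  proof -
    obtain FG where FG: "m = (C, FG, D)" "cc_morphism C (all_R C) D (all_R D) FG"
      using mnk(1) by (auto simp: NormalCat_Hom)
    obtain FG' FG'' where FG': "n = (D, FG', E)" "k = (E, FG'', X)"
      using mnk by (auto simp: NormalCat_Hom)
    show ?thesis
      using cc_morphism_extensional[OF FG(2)] FG FG'
      by (auto simp: NormalCat_simps cc_comp_def comp_functor_def fun_eq_iff PiE_iff)
  qed
qed

lemma TLR_closed:
  assumes "S \<in> Ob TLRSemigroups" "x \<in> elems S" "y \<in> elems S"
  shows "x \<odot>\<^bsub>S\<^esub> y \<in> elems S"
  using assms by (auto simp: TLR_simps totally_left_reductive_def regular_semigroup_def)

lemma category_TLR: "category TLRSemigroups"
proof
  show "src TLRSemigroups m \<in> Ob TLRSemigroups" "tgt TLRSemigroups m \<in> Ob TLRSemigroups"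
    if "m \<in> Ar TLRSemigroups" for m :: "'a sgrp \<times> ('a \<Rightarrow> 'a) \<times> 'a sgrp"
    using that by (cases m; simp add: TLR_simps(2-))+
  show "idn TLRSemigroups S \<in> Hom TLRSemigroups S S" if "S \<in> Ob TLRSemigroups" for S :: "'a sgrp"
    using that semigroup_hom_id[of S] TLR_closed[of S] by (auto simp: TLR_Hom TLR_simps(2-))
  fix S T V W :: "'a sgrp" and m n k
  show "cmp TLRSemigroups m n \<in> Hom TLRSemigroups S V"
    if "m \<in> Hom TLRSemigroups S T" "n \<in> Hom TLRSemigroups T V"
    using that semigroup_hom_compose[of S T _ V] TLR_closed[of S]
      by (auto simp: TLR_Hom TLR_simps(2-))
  show "cmp TLRSemigroups (idn TLRSemigroups S) m = m"
      "cmp TLRSemigroups m (idn TLRSemigroups T) = m"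
    if "m \<in> Hom TLRSemigroups S T"
    using that by (auto simp: TLR_Hom TLR_simps(2-) semigroup_hom_def compose_def fun_eq_iff
      PiE_iff extensional_def) metis
  show "cmp TLRSemigroups (cmp TLRSemigroups m n) k = cmp TLRSemigroups m (cmp TLRSemigroups n k)"
    if "m \<in> Hom TLRSemigroups S T" "n \<in> Hom TLRSemigroups T V" "k \<in> Hom TLRSemigroups V W"
    using that by (auto simp: TLR_Hom TLR_simps(2-) semigroup_hom_def compose_def fun_eq_iff
      PiE_iff)
qed

lemma TLR_iso:
  assumes "S \<in> Ob TLRSemigroups" "T \<in> Ob TLRSemigroups" "semigroup_hom S T \<phi>"
    "bij_betw \<phi> (elems S) (elems T)"
  shows "iso_arr TLRSemigroups (S, \<phi>, T)"
proof -
  interpret category TLRSemigroups by (rule category_TLR)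
  let ?\<psi> = "restrict (inv_into (elems S) \<phi>) (elems T)"
  have \<psi>: "semigroup_hom T S ?\<psi>"
      using semigroup_hom_inverse(1)[OF assms(3,4)] TLR_closed[OF assms(1)] .
  have "?\<psi> (\<phi> x) = x" if "x \<in> elems S" for x
    using that bij_betw_inv_into_left[OF assms(4)] semigroup_hom_closed[OF assms(3)] by simp
  moreover have "\<phi> (?\<psi> x) = x" if "x \<in> elems T" for x
    using that bij_betw_inv_into_right[OF assms(4)] by simp
  ultimately show ?thesis
    using assms \<psi>
    by (intro iso_arrI[of _
      "(T, ?\<psi>, S)"]) (auto simp: TLR_simps(2-) compose_def intro!: restrict_ext)
qed

theorem theorem7p4:
  assumes "powerset_closed_universe TYPE('u)"
  shows "equivalent_categories
    (NormalCat :: (('u, 'u) scat, ('u, 'u) scat \<times> ('u, 'u, 'u, 'u) ccm \<times> ('u, 'u) scat) cat)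
    (TLRSemigroups :: ('u sgrp, 'u sgrp \<times> ('u \<Rightarrow> 'u) \<times> 'u sgrp) cat)"
proof -
  let ?N = "NormalCat :: (('u, 'u) scat, ('u, 'u) scat \<times> ('u, 'u, 'u, 'u) ccm \<times> ('u, 'u) scat) cat"
  let ?T = "TLRSemigroups :: ('u sgrp, 'u sgrp \<times> ('u \<Rightarrow> 'u) \<times> 'u sgrp) cat"
  have normal: "normal_category C" if "C \<in> Ob ?N" for C using that by (simp add: NormalCat_simps)
  \<comment> \<open>Cones are functions, but the objects of the target category have carriers in
    \<open>'u\<close>. Since there are few enough cones, one encoding is chosen for each small
    normal category.\<close>
  have "\<forall>C. \<exists>e :: ('u \<Rightarrow> 'u) \<Rightarrow> 'u. C \<in> Ob ?N \<longrightarrow> inj_on e (cones C)"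
    using cones_lesspoll[OF assms] unfolding NormalCat_simps
    by (metis (no_types, lifting) lepoll_def lesspoll_imp_lepoll mem_Collect_eq)
  then obtain e :: "('u, 'u) scat \<Rightarrow> ('u \<Rightarrow> 'u) \<Rightarrow> 'u" where
    e: "\<And>C. C \<in> Ob ?N \<Longrightarrow> inj_on (e C) (cones C)" by metis
  \<comment> \<open>On objects the functor yields the coded semigroup of cones;
    \<open>\<eta>\<close> encodes and \<open>\<zeta>\<close> decodes.\<close>
  define \<Phi> where "\<Phi> C = image_sgrp (e C) (cone_semigroup C)" for C
  define \<eta> where "\<eta> C = restrict (e C) (cones C)" for C
  define \<zeta> where "\<zeta> C = restrict (inv_into (cones C) (\<eta> C)) (elems (\<Phi> C))" for C
  have closed: "\<gamma> \<odot>\<^bsub>cone_semigroup C\<^esub> \<delta> \<in> cones C"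
      if "C \<in> Ob ?N" "\<gamma> \<in> cones C" "\<delta> \<in> cones C" for C \<gamma> \<delta>
    using that normal_category.cone_mul_closed[OF normal] by blast
  have \<eta>: "semigroup_hom (cone_semigroup C) (\<Phi> C) (\<eta> C)" "bij_betw (\<eta> C) (cones C) (elems (\<Phi> C))"
    if "C \<in> Ob ?N" for C
    using image_sgrp[OF e[OF that]] closed[OF that] by (auto simp: \<Phi>_def \<eta>_def)
  have \<zeta>: "semigroup_hom (\<Phi> C) (cone_semigroup C) (\<zeta> C)" "bij_betw (\<zeta> C) (elems (\<Phi> C)) (cones C)"
    if "C \<in> Ob ?N" for C
    using semigroup_hom_inverse[OF \<eta>[OF that]] closed[OF that] by (auto simp: \<zeta>_def)
  have \<zeta>\<eta>: "\<zeta> C (\<eta> C \<gamma>) = \<gamma>" if "C \<in> Ob ?N" "\<gamma> \<in> cones C" for C \<gamma>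
    using that bij_betw_inv_into_left[OF \<eta>(2)[OF that(1)] that(2)] bij_betw_apply[OF \<eta>(2)[OF
      that(1)] that(2)]
    by (simp add: \<zeta>_def)
  have \<eta>\<zeta>: "\<eta> C (\<zeta> C x) = x" if "C \<in> Ob ?N" "x \<in> elems (\<Phi> C)" for C x
    using that bij_betw_inv_into_right[OF \<eta>(2)[OF that(1)] that(2)] by (simp add: \<zeta>_def)
  have \<eta>_in: "\<eta> C \<gamma> \<in> elems (\<Phi> C)" if "C \<in> Ob ?N" "\<gamma> \<in> cones C" for C \<gamma>
    using that semigroup_hom_closed[OF \<eta>(1)] by blast
  have \<zeta>_in: "\<zeta> C x \<in> cones C" if "C \<in> Ob ?N" "x \<in> elems (\<Phi> C)" for C x
    using that semigroup_hom_closed[OF \<zeta>(1)] by blast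
  have \<Phi>_Ob: "\<Phi> C \<in> Ob ?T" if C: "C \<in> Ob ?N" for C
  proof -
    interpret normal_category C using C by (rule normal)
    have reg: "regular_semigroup (\<Phi> C)"
      using regular_semigroup_image[OF regular_cone_semigroup \<eta>(1)[OF C]] \<eta>(2)[OF C]
      by (simp add: bij_betw_def)
    interpret cone_coordinates C "\<Phi> C" "\<eta> C"
      by unfold_locales (rule reg \<eta>[OF C])+
    have "small (elems (\<Phi> C))"
      using C cones_lesspoll[OF assms, of C] small_image
        by (auto simp: \<Phi>_def image_sgrp_def NormalCat_simps)
    then show ?thesis using totally_left_reductive by (simp add: TLR_simps)
  qed
  \<comment> \<open>On morphisms the functor is \<open>cc_hom\<close> conjugated by the encodings,
    so fullness and faithfulness reduce to those of \<open>cc_hom\<close>.\<close>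
  define \<Psi> where "\<Psi> C FG D
      = compose (elems (\<Phi> C)) (\<eta> D) (compose (elems (\<Phi> C)) (cc_hom C FG) (\<zeta> C))"
    for C FG D
  have \<Psi>_apply: "\<Psi> C FG D x = \<eta> D (cc_hom C FG (\<zeta> C x))" if "x \<in> elems (\<Phi> C)" for C FG D x
    using that by (simp add: \<Psi>_def compose_def)
  have \<Psi>_ext: "\<Psi> C FG D \<in> extensional (elems (\<Phi> C))" for C FG D
    by (simp add: \<Psi>_def)
  have cc_hom_hom: "semigroup_hom (cone_semigroup C) (cone_semigroup D) (cc_hom C FG)"
    if "C \<in> Ob ?N" "D \<in> Ob ?N" "cc_morphism C (all_R C) D (all_R D) FG" for C D FG
  proof -
    interpret cc_map C D FG using that normal by (simp add: cc_map_def cc_map_axioms_def)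
    show ?thesis by (rule cc_hom_semigroup_hom)
  qed
  have \<Psi>_hom: "semigroup_hom (\<Phi> C) (\<Phi> D) (\<Psi> C FG D)"
    if "C \<in> Ob ?N" "D \<in> Ob ?N" "cc_morphism C (all_R C) D (all_R D) FG" for C D FG
    unfolding \<Psi>_def using that \<eta> \<zeta> cc_hom_hom TLR_closed[OF \<Phi>_Ob]
        by (intro semigroup_hom_compose) blast+
  define F where "F = (restrict \<Phi> (Ob ?N), \<lambda>m\<in>Ar ?N. case m of (C, FG, D) \<Rightarrow> (\<Phi> C, \<Psi> C FG D, \<Phi> D))"
  have F1: "snd F (C, FG, D) = (\<Phi> C, \<Psi> C FG D, \<Phi> D)" if "(C, FG, D) \<in> Ar ?N" for C FG D
    using that by (simp add: F_def)
  have is_functor: "is_functor ?N ?T F"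
    unfolding is_functor_def
  proof (intro conjI ballI impI)
    show "fst F \<in> Ob ?N \<rightarrow>\<^sub>E Ob ?T" using \<Phi>_Ob by (simp add: F_def)
    show "snd F \<in> Ar ?N \<rightarrow>\<^sub>E Ar ?T"
      using \<Phi>_Ob \<Psi>_hom by (auto simp: F_def NormalCat_simps(2) TLR_simps(2))
    show "src ?T (snd F m) = fst F (src ?N m)" "tgt ?T (snd F m) = fst F (tgt ?N m)"
        if "m \<in> Ar ?N" for m
      using that by (cases m; simp add: F_def NormalCat_simps(2-) TLR_simps(2-))+
    show "snd F (idn ?N C) = idn ?T (fst F C)" if C: "C \<in> Ob ?N" for C
    proof -
      have "cc_morphism C (all_R C) C (all_R C) (cc_id C (all_R C))"
        using normal[OF C] by (rule cc_morphism_id)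
      moreover have "\<Psi> C (cc_id C (all_R C)) C = (\<lambda>x\<in>elems (\<Phi> C). x)"
        by (rule extensionalityI[OF \<Psi>_ext])
          (use C cc_hom_id[OF normal[OF C]] \<zeta>_in \<eta>\<zeta> in \<open>simp_all add: \<Psi>_apply\<close>)
      ultimately show ?thesis using C by (simp add: F_def NormalCat_simps(2-) TLR_simps(2-))
    qed
    show "snd F (cmp ?N m n) = cmp ?T (snd F m) (snd F n)"
      if mn: "m \<in> Ar ?N" "n \<in> Ar ?N" "tgt ?N m = src ?N n" for m n
    proof -
      obtain C FG D where m: "m = (C, FG, D)" by (cases m)
      obtain D' FG' E where "n = (D', FG', E)" by (cases n)
      then have n: "n = (D, FG', E)" using mn(3) m by (simp add: NormalCat_simps(2-))
      have CDE: "C \<in> Ob ?N" "D \<in> Ob ?N" "E \<in> Ob ?N"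
        and FG: "cc_morphism C (all_R C) D (all_R D) FG" "cc_morphism D (all_R D) E (all_R E) FG'"
        using mn m n by (simp_all add: NormalCat_simps(2-))
      note comp = cc_morphism_comp[OF normal[OF CDE(1)] normal[OF CDE(2)] FG]
        cc_hom_comp[OF normal[OF CDE(1)] normal[OF CDE(2)] FG]
      have "\<Psi> C (cc_comp C (all_R C) FG FG') E = compose (elems (\<Phi> C)) (\<Psi> D FG' E) (\<Psi> C FG D)"
      proof (rule extensionalityI[OF \<Psi>_ext])
        fix x assume x: "x \<in> elems (\<Phi> C)"
        have z: "\<zeta> C x \<in> cones C" using \<zeta>_in CDE x by blast
        have h: "cc_hom C FG (\<zeta> C x) \<in> cones D"
          using semigroup_hom_closed[OF cc_hom_hom[OF CDE(1,2) FG(1)] z] .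
        show "\<Psi> C (cc_comp C (all_R C) FG FG') E x = compose (elems (\<Phi> C)) (\<Psi> D FG' E) (\<Psi> C FG D) x"
          using x z h CDE comp \<eta>_in \<zeta>\<eta> by (simp add: \<Psi>_apply compose_def)
      qed simp
      moreover have "(C, cc_comp C (all_R C) FG FG', E) \<in> Ar ?N"
        using comp(1) CDE by (simp add: NormalCat_simps(2))
      ultimately show ?thesis
        using m n mn F1 by (simp add: NormalCat_simps(6) TLR_simps(6))
    qed
  qed
  interpret N: category ?N by (rule category_NormalCat)
  interpret T: category ?T by (rule category_TLR)
  interpret ff_functor ?N ?T F
  proof
    show "\<exists>f\<in>Hom ?N C D. snd F f = g" if C: "C \<in> Ob ?N" "D \<in> Ob ?N"
        and g: "g \<in> Hom ?T (fst F C) (fst F D)"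
      for C D g
    proof -
      obtain \<psi> where \<psi>: "g = (\<Phi> C, \<psi>, \<Phi> D)" "semigroup_hom (\<Phi> C) (\<Phi> D) \<psi>"
        using g C by (auto simp: TLR_Hom F_def)
      \<comment> \<open>Removing the codes on both sides turns \<open>\<psi>\<close> into a
        homomorphism between actual semigroups of cones, to which \<open>cc_hom_full\<close>
        applies.\<close>
      let ?\<phi> = "compose (cones C) (\<zeta> D) (compose (cones C) \<psi> (\<eta> C))"
      have "semigroup_hom (cone_semigroup C) (cone_semigroup D) ?\<phi>"
        using C \<psi>(2) \<eta>(1) \<zeta>(1) closed by (intro semigroup_hom_compose) blast+
      then obtain FG where FG: "cc_morphism C (all_R C) D (all_R D) FG" "cc_hom C FG = ?\<phi>"
        using cc_hom_full normal C by metis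
      have "\<psi> \<in> extensional (elems (\<Phi> C))" using \<psi>(2) by (auto simp: semigroup_hom_def PiE_iff)
      then have "\<Psi> C FG D = \<psi>"
        by (rule extensionalityI[OF \<Psi>_ext])
          (use C \<zeta>_in \<eta>\<zeta> semigroup_hom_closed[OF \<psi>(2)] in \<open>simp add: \<Psi>_apply FG(2) compose_def\<close>)
      moreover have "(C, FG, D) \<in> Hom ?N C D" using C FG(1) by (auto simp: NormalCat_Hom)
      moreover have "(C, FG, D) \<in> Ar ?N" using C FG(1) by (simp add: NormalCat_simps(2))
      ultimately show ?thesis using \<psi>(1) F1 by metis
    qed
    show "f = f'" if f: "f \<in> Hom ?N C D" "f' \<in> Hom ?N C D" and eq: "snd F f = snd F f'" for C D f f'
    proof -
      obtain FG FG' where FG: "f = (C, FG, D)" "f' = (C, FG', D)" "C \<in> Ob ?N" "D \<in> Ob ?N"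
        "cc_morphism C (all_R C) D (all_R D) FG" "cc_morphism C (all_R C) D (all_R D) FG'"
        using f by (auto simp: NormalCat_Hom)
      have \<Psi>: "\<Psi> C FG D = \<Psi> C FG' D" using eq f FG(1,2) F1 by (auto simp: Hom_def)
      have "cc_hom C FG \<gamma> = cc_hom C FG' \<gamma>" if \<gamma>: "\<gamma> \<in> cones C" for \<gamma>
      proof -
        have "\<eta> D (cc_hom C FG \<gamma>) = \<eta> D (cc_hom C FG' \<gamma>)"
          using fun_cong[OF \<Psi>, of "\<eta> C \<gamma>"] \<eta>_in[OF FG(3) \<gamma>] \<zeta>\<eta>[OF FG(3) \<gamma>] by (simp add: \<Psi>_apply)
        then show ?thesis
          using \<zeta>\<eta>[OF FG(4)] semigroup_hom_closed[OF cc_hom_hom[OF FG(3,4)] \<gamma>] FG(5,6) by metis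
      qed
      then have "cc_hom C FG = cc_hom C FG'"
        by (intro extensionalityI[of _ "cones C"]) (auto simp: cc_hom_def)
      then show ?thesis using cc_hom_faithful normal FG by metis
    qed
  qed (rule is_functor)
  show ?thesis
  proof (rule equivalent_categories)
    fix S assume S: "S \<in> Ob ?T"
    then have tlr: "totally_left_reductive S" "small (elems S)" by (simp_all add: TLR_simps)
    then interpret S: regular_sgrp S by unfold_locales (simp add: totally_left_reductive_def)
    \<comment> \<open>Objects and arrows of the left ideal category are sets and maps over
      \<open>'u\<close>, so they too need codes in \<open>'u\<close> before they can form an object
      of \<open>?N\<close>.\<close>
    obtain a :: "'u set \<Rightarrow> 'u" and b :: "'u lmap \<Rightarrow> 'u"
      where ab: "inj_on a (Ob S.LC)" "inj_on b (Ar S.LC)"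
      using left_ideal_cat_lesspoll[OF assms tlr(2)] lesspoll_imp_lepoll unfolding lepoll_def
        by metis
    define C where "C = image_scat a b S.LC"
    interpret normal_iso S.LC C "(restrict a (Ob S.LC), restrict b (Ar S.LC))"
      unfolding C_def
      by (intro normal_iso.intro normal_iso_axioms.intro scat_iso_image ab S.normal_category_LC)
    have "Ob C = a ` Ob S.LC" "Ar C = b ` Ar S.LC" by (simp_all add: C_def image_scat_def Let_def)
    then have C: "C \<in> Ob ?N"
      using D.normal_category_axioms left_ideal_cat_lesspoll[OF assms tlr(2), THEN small_image]
      by (simp add: NormalCat_simps)
    \<comment> \<open>Total left reductivity gives an isomorphism with the cones of the left ideal
      category, and relabelling that category by codes carries its cones along.\<close>
    have "isomorphic_semigroups S (cone_semigroup C)"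
      using tlr(1) cone_semigroup_iso isomorphic_semigroups_trans[of S] S.mul_closed
      unfolding totally_left_reductive_def by blast
    moreover have "isomorphic_semigroups (cone_semigroup C) (\<Phi> C)"
      using \<eta>[OF C] unfolding isomorphic_semigroups_def by blast
    ultimately have "isomorphic_semigroups S (\<Phi> C)"
      using isomorphic_semigroups_trans[of S] S.mul_closed by blast
    then have "isomorphic_semigroups (\<Phi> C) S" using isomorphic_semigroups_sym S.mul_closed by blast
    then obtain \<chi> where \<chi>: "semigroup_hom (\<Phi> C) S \<chi>" "bij_betw \<chi> (elems (\<Phi> C)) (elems S)"
      unfolding isomorphic_semigroups_def by blast
    have "(\<Phi> C, \<chi>, S) \<in> Hom ?T (fst F C) S" using C S \<chi>(1) \<Phi>_Ob by (simp add: TLR_Hom F_def)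
    moreover have "iso_arr ?T (\<Phi> C, \<chi>, S)" using TLR_iso[OF \<Phi>_Ob[OF C] S \<chi>] .
    ultimately show "\<exists>C\<in>Ob ?N. \<exists>i\<in>Hom ?T (fst F C) S. iso_arr ?T i" using C by blast
  qed
qed

end
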